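(* Let $\alpha\in(0,1)$ and $\theta>1/2$ be fixed constants. Let $\mathsf{G}$ be an atomless probability measure on $[0,+\infty)$ such that $\int_0^{+\infty}x^{2\alpha}\,\mathsf{G}(\mathrm{d}x)<+\infty$. Let $\widetilde{\mathfrak{p}}_{\alpha,\theta}$ be a Pitman--Yor process with parameters $(\alpha,\theta)$ and base measure $\mathsf{G}$, and let $\mathfrak{V}=\int x^2\,\widetilde{\mathfrak{p}}_{\alpha,\theta}(\mathrm{d}x)-\left(\int x\,\widetilde{\mathfrak{p}}_{\alpha,\theta}(\mathrm{d}x)\right)^2$ be its random variance. Then, for any $t\ge 0$, $$\mathbb{E}_{(\alpha,\theta)}\left[\left(\frac{1}{1+t\mathfrak{V}}\right)^{\theta-1/2}\right]=\int_0^1\frac12\left\{\Psi_+\left(\sqrt{t\rho(1-\rho)},\,t(1-\rho)\right)+\Psi_-\left(\sqrt{t\rho(1-\rho)},\,t(1-\rho)\right)\right\}\mathrm{Beta}(\mathrm{d}\rho;1/2,\theta-1/2),$$ where $$\Psi_{\pm}(u,v):=\left\{\int_0^{+\infty}[1\pm 2ux+vx^2]^{\alpha}\,\mathsf{G}(\mathrm{d}x)\right\}^{-\theta/\alpha}.$$ Moreover, if $\theta>3/2$, then for every $z>0$, $$\mathbb{E}_{(\alpha,\theta)}\left[\frac{1}{z+\mathfrak{V}}\right]=\int_0^{+\infty}\frac{f_{\mathfrak{V}}(x)}{z+x}\,\mathrm{d}x=z^{\theta-1}\int_{\Delta_2}\left[\frac{\Phi_+(z;\xi,\eta)+\Phi_-(z;\xi,\eta)}{2}\right]\mathrm{Dir}(\mathrm{d}\xi\,\mathrm{d}\eta;1/2,1,\theta-3/2),$$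 where $f_{\mathfrak{V}}$ denotes the probability density function of $\mathfrak{V}$ and $$\Phi_{\pm}(z;\xi,\eta):=\left\{\int_0^{+\infty}[z\pm 2\sqrt{z\xi\eta}\,x+\eta x^2]^{\alpha}\,\mathsf{G}(\mathrm{d}x)\right\}^{-\theta/\alpha}.$$
   Context: Pitman--Yor process: for $\alpha\in[0,1)$, $\theta>-\alpha$ and a probability measure $\mathsf{G}$ on $\mathbb{R}$, let $V_n\sim\mathrm{Beta}(1-\alpha,\theta+n\alpha)$, $n\ge1$, be independent, put $\omega_1:=V_1$ and $\omega_n:=V_n\prod_{i=1}^{n-1}(1-V_i)$ for $n\ge2$, and let $\xi_1,\xi_2,\dots$ be i.i.d. with law $\mathsf{G}$, independent of $(V_n)_{n\ge1}$. Then $\widetilde{\mathfrak{p}}_{\alpha,\theta}:=\sum_{n\ge1}\omega_n\delta_{\xi_n}$. $\mathbb{E}_{(\alpha,\theta)}$ denotes expectation with respect to the randomness of $\widetilde{\mathfrak{p}}_{\alpha,\theta}$. $\mathrm{Beta}(\mathrm{d}\rho;a,b)$ is the beta probability distribution on $(0,1)$, with density $\frac{\Gamma(a+b)}{\Gamma(a)\Gamma(b)}\rho^{a-1}(1-\rho)^{b-1}$. $\Delta_2:=\{(\xi,\eta):\xi,\eta\ge0,\ \xi+\eta\le1\}$, and $\mathrm{Dir}(\mathrm{d}\xi\,\mathrm{d}\eta;a,b,c)$ is the Dirichlet probability distribution on $\Delta_2$, with density $\frac{\Gamma(a+b+c)}{\Gamma(a)\Gamma(b)\Gamma(c)}\xi^{a-1}\eta^{b-1}(1-\xi-\eta)^{c-1}$.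 *)

theory Defs
  imports "HOL-Probability.Probability"
begin

definition beta_distribution :: "real \<Rightarrow> real \<Rightarrow> real measure" where
  "beta_distribution a b = density lborel (\<lambda>r. ennreal (indicator {0<..<1} r *
     (Gamma (a + b) / (Gamma a * Gamma b) * r powr (a - 1) * (1 - r) powr (b - 1))))"

definition Delta2 :: "(real \<times> real) set" where
  "Delta2 = {(x, y). 0 \<le> x \<and> 0 \<le> y \<and> x + y \<le> 1}"

definition dirichlet_distribution :: "real \<Rightarrow> real \<Rightarrow> real \<Rightarrow> (real \<times> real) measure" where
  "dirichlet_distribution a b c = density lborel (\<lambda>(x, y). ennreal (indicator Delta2 (x, y) *
     (Gamma (a + b + c) / (Gamma a * Gamma b * Gamma c)
        * x powr (a - 1) * y powr (b - 1) * (1 - x - y) powr (c - 1))))"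

text \<open>Sequences are indexed by the integers n \<open>\<ge>\<close> 1; the value at 0 is irrelevant throughout.\<close>

definition stick_weight :: "(nat \<Rightarrow> real) \<Rightarrow> nat \<Rightarrow> real" where
  "stick_weight v n = v n * (\<Prod>i\<in>{1..<n}. 1 - v i)"

text \<open>The discrete measure putting mass \<open>w n\<close> at the point \<open>x n\<close>, for n \<open>\<ge>\<close> 1, where \<open>w\<close> are the
  stick-breaking weights of \<open>v\<close>. It is written as the image under \<open>x\<close> of the weighted counting
  measure; the lemma below identifies it with the sum of point masses.\<close>

definition stick_breaking_measure :: "(nat \<Rightarrow> real) \<Rightarrow> (nat \<Rightarrow> real) \<Rightarrow> real measure" where
  "stick_breaking_measure v x =
     distr (density (count_space {1..}) (\<lambda>n. ennreal (stick_weight v n))) borel x"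

lemma emeasure_stick_breaking_measure:
  assumes "A \<in> sets borel"
  shows "emeasure (stick_breaking_measure v x) A
    = (\<Sum>n. ennreal (stick_weight v (Suc n)) * emeasure (return borel (x (Suc n))) A)"
proof -
  have bij: "bij_betw Suc UNIV {1..}"
    by (rule bij_betwI[where g = "\<lambda>n. n - 1"]) auto
  have "emeasure (stick_breaking_measure v x) A
      = (\<integral>\<^sup>+ n. ennreal (stick_weight v n) * indicator (x -` A \<inter> {1..}) n \<partial>count_space {1..})"
    using assms unfolding stick_breaking_measure_def
    by (subst emeasure_distr) (auto simp: emeasure_density)
  also have "\<dots> = (\<integral>\<^sup>+ n. ennreal (stick_weight v (Suc n))
      * indicator (x -` A \<inter> {1..}) (Suc n) \<partial>count_space UNIV)"
    by (rule nn_integral_bij_count_space[OF bij, symmetric])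
  also have "\<dots> = (\<Sum>n. ennreal (stick_weight v (Suc n)) * indicator (x -` A \<inter> {1..}) (Suc n))"
    by (rule nn_integral_count_space_nat)
  also have "\<dots> = (\<Sum>n. ennreal (stick_weight v (Suc n)) * emeasure (return borel (x (Suc n))) A)"
    using assms by (intro suminf_cong) (auto simp: indicator_def)
  finally show ?thesis .
qed

locale pitman_yor = prob_space M for M :: "'w measure" +
  fixes \<alpha> \<theta> :: real and G :: "real measure"
    and V \<xi> :: "nat \<Rightarrow> 'w \<Rightarrow> real"
  assumes parameters: "0 \<le> \<alpha>" "\<alpha> < 1" "\<theta> > - \<alpha>"
    and base_prob: "prob_space G"
    and sets_base: "sets G = sets borel"
    and sticks_indep: "indep_vars (\<lambda>_. borel) V {1..}"
    and sticks_law: "\<And>n. n \<ge> 1 \<Longrightarrow> distr M borel (V n) = beta_distribution (1 - \<alpha>) (\<theta> + real n * \<alpha>)"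
    and atoms_indep: "indep_vars (\<lambda>_. borel) \<xi> {1..}"
    and atoms_law: "\<And>n. n \<ge> 1 \<Longrightarrow> distr M borel (\<xi> n) = G"
    and sticks_atoms_indep:
      "indep_var (PiM {1..} (\<lambda>_. borel)) (\<lambda>\<omega>. \<lambda>n\<in>{1..}. V n \<omega>)
                 (PiM {1..} (\<lambda>_. borel)) (\<lambda>\<omega>. \<lambda>n\<in>{1..}. \<xi> n \<omega>)"

definition pitman_yor_process ::
  "(nat \<Rightarrow> 'w \<Rightarrow> real) \<Rightarrow> (nat \<Rightarrow> 'w \<Rightarrow> real) \<Rightarrow> 'w \<Rightarrow> real measure" where
  "pitman_yor_process V \<xi> \<omega> = stick_breaking_measure (\<lambda>n. V n \<omega>) (\<lambda>n. \<xi> n \<omega>)"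

definition measure_variance :: "real measure \<Rightarrow> real" where
  "measure_variance \<mu> = (\<integral>x. x\<^sup>2 \<partial>\<mu>) - (\<integral>x. x \<partial>\<mu>)\<^sup>2"

text \<open>In \<open>Psi\<close> and \<open>Phi\<close> the first argument is the sign, 1 or -1.\<close>

definition Psi :: "real \<Rightarrow> real \<Rightarrow> real \<Rightarrow> real measure \<Rightarrow> real \<Rightarrow> real \<Rightarrow> real" where
  "Psi s \<alpha> \<theta> G u v =
     (LINT x:{0..}|G. (1 + s * (2 * u * x) + v * x\<^sup>2) powr \<alpha>) powr (- \<theta> / \<alpha>)"

definition Phi :: "real \<Rightarrow> real \<Rightarrow> real \<Rightarrow> real measure \<Rightarrow> real \<Rightarrow> real \<Rightarrow> real \<Rightarrow> real" where
  "Phi s \<alpha> \<theta> G z x' y' =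
     (LINT x:{0..}|G. (z + s * (2 * sqrt (z * x' * y') * x) + y' * x\<^sup>2) powr \<alpha>) powr (- \<theta> / \<alpha>)"

end

theory Submission
  imports Defs
begin

text \<open>
  Let \<open>Y\<close> be the mean of a nonnegative function \<open>h\<close> under the process with parameters \<open>(\<alpha>, \<theta>)\<close>, and
  \<open>Y'\<close> its mean under the process obtained by deleting the first stick, which has parameters
  \<open>(\<alpha>, \<theta> + \<alpha>)\<close>. The integral of \<open>(v a + (1 - v) b) powr (- p - q)\<close> against \<open>Beta(p, q)\<close> is
  \<open>a powr (- p) b powr (- q)\<close>; applied to the first stick and to \<open>u \<sim> Beta(\<theta>, 1)\<close> it gives
  \<open>E (1 + l Y)^(- \<theta>) = E_u [\<gamma>(u l) E (1 + u l Y')^(- \<theta> - \<alpha>)]\<close> with \<open>\<gamma>(s) = \<integral> (1 + s h)^(\<alpha> - 1) dG\<close>.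
  The function \<open>\<phi>(l)^(- \<theta> / \<alpha>)\<close>, \<open>\<phi>(s) = \<integral> (1 + s h)^\<alpha> dG\<close>, satisfies the same recursion.
  The difference of the two is at most \<open>K \<theta> l\<close>, and \<open>n\<close> iterations improve this to
  \<open>K (\<theta> + n \<alpha>) \<Prod>i<n. (\<theta> + i \<alpha>) / (\<theta> + i \<alpha> + 1)\<close> times \<open>l\<close>, which tends to 0 because \<open>\<alpha> < 1\<close>.
  Hence \<open>E (\<integral> f dp)^(- \<theta>) = (\<integral> f^\<alpha> dG)^(- \<theta> / \<alpha>)\<close> for \<open>f\<close> bounded away from 0.

  The powers of \<open>1 + t (m2 - m1^2)\<close> and \<open>z + m2 - m1^2\<close> are mixtures, over a Beta resp. Dirichlet law
  and a random sign, of powers \<open>- \<theta>\<close> of expressions that are linear in the moments \<open>m1\<close>, \<open>m2\<close>,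
  that is, of integrals of positive quadratic polynomials; this gives both formulas.
\<close>

subsection \<open>Beta and Dirichlet integrals\<close>

text \<open>Only the moment of order 2\<alpha> of the base measure is given, so the mean of x^2
  under the process may have infinite expectation, and its finiteness cannot be read off from first
  moments. The identity then supplies what was left open: letting the scale l tend to 0 shows that
  the means are finite, and the constant 1 shows that the weights sum to 1.

  The variance enters through the integral of (y^2 + 2 b y + d)^(- \<theta>) over the line, which
  depends on d - b^2 only. Mapped to the unit interval it becomes a Beta(1/2, \<theta> - 1/2)
  mixture, the random sign distinguishing the two half-lines. A further mixture over Beta(1,
  \<theta> - 3/2) lowers the exponent \<theta> - 1/2 to 1; the two mixing laws together form the
  Dirichlet law.

  The density of the variance comes not from these transforms but from the first stick: given
  everything else, the variance is a quadratic function of it.\<close>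

text \<open>Bridge to the gauge integral, in which the Beta integral, the change of variables and
  the fundamental theorem of calculus are available.\<close>

lemma nn_integral_eq_iff_has_integral:
  fixes f :: "real \<Rightarrow> real"
  assumes "(\<lambda>x. indicator S x * f x) \<in> borel_measurable borel" "\<And>x. x \<in> S \<Longrightarrow> 0 \<le> f x" "0 \<le> r"
  shows "(\<integral>\<^sup>+x. ennreal (indicator S x * f x) \<partial>lborel) = ennreal r \<longleftrightarrow> (f has_integral r) S"
proof -
  have nonneg: "0 \<le> indicator S x * f x" for x
    using assms(2) by (auto simp: indicator_def)
  have "((\<lambda>x. indicator S x * f x) has_integral r) UNIV \<longleftrightarrow> (f has_integral r) S"
    by (subst has_integral_restrict_UNIV[symmetric])
       (auto simp: indicator_def of_bool_def if_distrib if_distribR cong: if_cong)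
  then show ?thesis
    using nn_integral_has_integral[OF assms(1) nonneg _ assms(3)]
      nn_integral_has_integral_lborel[OF assms(1) nonneg] by auto
qed

text \<open>By the change of variables for absolutely integrable functions, either side equals a
  finite \<open>r\<close> iff the other does. This forces equality in \<open>ennreal\<close>: if one
  side is infinite, the other cannot be finite.\<close>

lemma nn_integral_change_of_variables:
  fixes f g g' :: "real \<Rightarrow> real"
  assumes S: "S \<in> sets borel" and bij: "bij_betw g S T"
    and deriv: "\<And>x. x \<in> S \<Longrightarrow> (g has_real_derivative g' x) (at x)"
    and nonneg: "\<And>x. x \<in> T \<Longrightarrow> 0 \<le> f x"
    and meas: "(\<lambda>x. indicator T x * f x) \<in> borel_measurable borel"
      "(\<lambda>x. indicator S x * (\<bar>g' x\<bar> * f (g x))) \<in> borel_measurable borel"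
  shows "(\<integral>\<^sup>+x. ennreal (indicator T x * f x) \<partial>lborel)
    = (\<integral>\<^sup>+x. ennreal (indicator S x * (\<bar>g' x\<bar> * f (g x))) \<partial>lborel)" (is "?F = ?H")
proof -
  have gS: "g ` S = T" and inj: "inj_on g S"
    using bij by (auto simp: bij_betw_def)
  have nonneg': "0 \<le> \<bar>g' x\<bar> * f (g x)" if "x \<in> S" for x
    using nonneg gS that by auto
  have char: "(h has_integral r) A \<longleftrightarrow> h absolutely_integrable_on A \<and> integral A h = r"
    if "\<And>x. x \<in> A \<Longrightarrow> 0 \<le> h x" for h :: "real \<Rightarrow> real" and A r
    using that by (auto simp: absolutely_integrable_on_iff_nonneg has_integral_iff)
  have iff: "?F = ennreal r \<longleftrightarrow> ?H = ennreal r" if "0 \<le> r" for r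
  proof -
    have "?H = ennreal r \<longleftrightarrow> ((\<lambda>x. \<bar>g' x\<bar> * f (g x)) has_integral r) S"
      using nonneg' that by (intro nn_integral_eq_iff_has_integral meas) auto
    also have "\<dots> \<longleftrightarrow> (\<lambda>x. \<bar>g' x\<bar> * f (g x)) absolutely_integrable_on S \<and>
        integral S (\<lambda>x. \<bar>g' x\<bar> * f (g x)) = r"
      using nonneg' by (rule char)
    also have "\<dots> \<longleftrightarrow> f absolutely_integrable_on (g ` S) \<and> integral (g ` S) f = r"
      using S by (intro has_absolute_integral_change_of_variables_1' inj)
        (auto intro: has_field_derivative_at_within deriv)
    also have "\<dots> \<longleftrightarrow> (f has_integral r) T"
      using char[OF nonneg, where r = r] gS by simp
    also have "\<dots> \<longleftrightarrow> ?F = ennreal r"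
      using nonneg that by (intro nn_integral_eq_iff_has_integral[symmetric] meas) auto
    finally show ?thesis by simp
  qed
  show ?thesis
  proof (cases ?F rule: ennreal_cases)
    case (real r)
    then show ?thesis using iff[of r] by simp
  next
    case top
    then show ?thesis using iff[of "enn2real ?H"]
      by (cases ?H rule: ennreal_cases) auto
  qed
qed

lemma sets_beta_distribution [simp, measurable_cong]: "sets (beta_distribution a b) = sets borel"
  by (simp add: beta_distribution_def)

lemma space_beta_distribution [simp]: "space (beta_distribution a b) = UNIV"
  by (simp add: beta_distribution_def)

lemma nn_integral_beta_distribution:
  assumes [measurable]: "F \<in> borel_measurable borel"
  shows "(\<integral>\<^sup>+r. F r \<partial>beta_distribution a b) = (\<integral>\<^sup>+r. ennreal (indicator {0<..<1} r *
     (Gamma (a + b) / (Gamma a * Gamma b) * r powr (a - 1) * (1 - r) powr (b - 1))) * F r \<partial>lborel)"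
  unfolding beta_distribution_def by (subst nn_integral_density) auto

lemma AE_beta_distribution: "AE r in beta_distribution a b. 0 < r \<and> r < 1"
  unfolding beta_distribution_def by (subst AE_density) (auto simp: indicator_def)

lemma Beta_real_pos:
  assumes "0 < p" "0 < q"
  shows "0 < Beta p (q :: real)"
  using assms by (auto simp: Beta_def intro!: divide_pos_pos mult_pos_pos Gamma_real_pos)

lemma nn_integral_beta_distribution_Beta:
  assumes [measurable]: "F \<in> borel_measurable borel" and pq: "0 < p" "0 < q"
  shows "(\<integral>\<^sup>+r. F r \<partial>beta_distribution p q) = ennreal (1 / Beta p q) *
    (\<integral>\<^sup>+r. ennreal (indicator {0<..<1} r * (r powr (p - 1) * (1 - r) powr (q - 1))) * F r \<partial>lborel)"
proof -
  have "(\<integral>\<^sup>+r. F r \<partial>beta_distribution p q) = (\<integral>\<^sup>+r. ennreal (1 / Beta p q) *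
      (ennreal (indicator {0<..<1} r * (r powr (p - 1) * (1 - r) powr (q - 1))) * F r) \<partial>lborel)"
    unfolding nn_integral_beta_distribution[OF assms(1)]
  proof (intro nn_integral_cong)
    fix r :: real
    have "indicator {0<..<1} r * (Gamma (p + q) / (Gamma p * Gamma q) * r powr (p - 1) * (1 - r) powr (q - 1))
        = 1 / Beta p q * (indicator {0<..<1} r * (r powr (p - 1) * (1 - r) powr (q - 1)))"
      by (simp add: Beta_def)
    then show "ennreal (indicator {0<..<1} r * (Gamma (p + q) / (Gamma p * Gamma q) * r powr (p - 1) * (1 - r) powr (q - 1))) * F r
        = ennreal (1 / Beta p q) * (ennreal (indicator {0<..<1} r * (r powr (p - 1) * (1 - r) powr (q - 1))) * F r)"
      using Beta_real_pos[OF pq] by (metis ennreal_mult' less_imp_le mult.assoc zero_le_divide_1_iff)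
  qed
  then show ?thesis by (simp add: nn_integral_cmult)
qed

lemma nn_integral_Beta_kernel:
  assumes "0 < p" "0 < q"
  shows "(\<integral>\<^sup>+r. ennreal (indicator {0<..<1} r * (r powr (p - 1) * (1 - r) powr (q - 1))) \<partial>lborel)
    = ennreal (Beta p q)"
proof -
  have "((\<lambda>r. r powr (p - 1) * (1 - r) powr (q - 1)) has_integral Beta p q) {0<..<1}"
    using has_integral_Beta_real[OF assms]
    by (simp add: has_integral_Icc_iff_Ioo)
  then show ?thesis
    using Beta_real_pos[OF assms] by (subst nn_integral_eq_iff_has_integral) auto
qed

text \<open>The Moebius map \<open>g\<close> of the unit interval transforms the Beta kernel into
  itself times \<open>a powr p * b powr q\<close> times the integrand. Both kernels therefore have
  integral \<open>Beta p q\<close>.\<close>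

lemma nn_integral_beta_distribution_linear_powr:
  assumes pq: "0 < p" "0 < q" and ab: "0 < a" "0 < b"
  shows "(\<integral>\<^sup>+v. ennreal ((v * a + (1 - v) * b) powr (- (p + q))) \<partial>beta_distribution p q)
    = ennreal (a powr (- p) * b powr (- q))"
proof -
  define g where "g v = v * a / (v * a + (1 - v) * b)" for v
  define g' where "g' v = a * b / (v * a + (1 - v) * b)\<^sup>2" for v
  define k where "k r = r powr (p - 1) * (1 - r) powr (q - 1)" for r :: real
  have pos: "0 < v * a + (1 - v) * b" if "v \<in> {0<..<1}" for v
    using that ab by (auto intro!: add_pos_pos)
  have one_minus: "1 - g v = (1 - v) * b / (v * a + (1 - v) * b)" if "v \<in> {0<..<1}" for v
    using pos[OF that] by (simp add: g_def field_simps)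
  \<comment> \<open>The inverse is the same map with \<open>a\<close> and \<open>b\<close>
    exchanged.\<close>
  have bij: "bij_betw g {0<..<1} {0<..<1}"
  proof (rule bij_betwI[where g = "\<lambda>u. u * b / (u * b + (1 - u) * a)"])
    show "g \<in> {0<..<1} \<rightarrow> {0<..<1}"
    proof
      fix v :: real assume v: "v \<in> {0<..<1}"
      have "0 < g v" "0 < 1 - g v"
        using v ab pos[OF v] unfolding one_minus[OF v] by (auto simp: g_def)
      then show "g v \<in> {0<..<1}" by auto
    qed
    show "(\<lambda>u. u * b / (u * b + (1 - u) * a)) \<in> {0<..<1} \<rightarrow> {0<..<1}"
    proof
      fix v :: real assume v: "v \<in> {0<..<1}"
      have "0 < v * b + (1 - v) * a" "0 < (1 - v) * a" "0 < v * b"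
        using v ab by (auto intro!: add_pos_pos)
      then show "v * b / (v * b + (1 - v) * a) \<in> {0<..<1}" by auto
    qed
    show "g v * b / (g v * b + (1 - g v) * a) = v" if v: "v \<in> {0<..<1}" for v
    proof -
      have "g v * b + (1 - g v) * a = a * b / (v * a + (1 - v) * b)"
        unfolding one_minus[OF v] by (simp add: g_def add_divide_distrib[symmetric] algebra_simps)
      then show ?thesis using ab pos[OF v] by (simp add: g_def)
    qed
    show "g (u * b / (u * b + (1 - u) * a)) = u" if u: "u \<in> {0<..<1}" for u
    proof -
      define d where "d = u * b + (1 - u) * a"
      have d: "0 < d" using u ab by (auto simp: d_def intro!: add_pos_pos)
      have "1 - u * b / d = (1 - u) * a / d" using d by (simp add: d_def field_simps)
      then have "u * b / d * a + (1 - u * b / d) * b = u * b / d * a + (1 - u) * a / d * b"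
        by simp
      also have "\<dots> = a * b / d"
        by (simp add: add_divide_distrib[symmetric] algebra_simps)
      finally have "u * b / d * a + (1 - u * b / d) * b = a * b / d" .
      then show ?thesis using ab d by (simp add: g_def flip: d_def)
    qed
  qed
  have deriv: "(g has_real_derivative g' v) (at v)" if "v \<in> {0<..<1}" for v
    using pos[OF that] unfolding g_def g'_def
    by (auto intro!: derivative_eq_intros simp: power2_eq_square) (simp add: algebra_simps)
  \<comment> \<open>The denominator occurs with power 2 from the Jacobian and with powers p - 1 and
    q - 1 from the kernel, in total p + q.\<close>
  have key: "\<bar>g' v\<bar> * k (g v) = a powr p * b powr q * (k v * (v * a + (1 - v) * b) powr (- (p + q)))"
    if v: "v \<in> {0<..<1}" for v
  proof -
    define d where "d = v * a + (1 - v) * b"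
    have d: "0 < d" using pos[OF v] by (simp add: d_def)
    have "\<bar>g' v\<bar> * k (g v) = a * b / d powr 2 * ((v * a / d) powr (p - 1) * ((1 - v) * b / d) powr (q - 1))"
      unfolding k_def one_minus[OF v] unfolding g_def g'_def d_def[symmetric]
      using ab d by (simp add: powr_numeral abs_mult)
    also have "\<dots> = a powr 1 * b powr 1 / d powr 2 * ((v powr (p - 1) * a powr (p - 1) / d powr (p - 1))
        * ((1 - v) powr (q - 1) * b powr (q - 1) / d powr (q - 1)))"
      using ab d v by (simp add: powr_mult powr_divide)
    also have "\<dots> = (a powr 1 * a powr (p - 1)) * (b powr 1 * b powr (q - 1)) *
        (k v / (d powr 2 * d powr (p - 1) * d powr (q - 1)))"
      by (simp add: k_def mult_ac)
    also have "\<dots> = a powr p * b powr q * (k v * d powr (- (p + q)))"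
    proof -
      have "a powr 1 * a powr (p - 1) = a powr p" "b powr 1 * b powr (q - 1) = b powr q"
        "d powr 2 * d powr (p - 1) * d powr (q - 1) = d powr (p + q)"
        unfolding powr_add[symmetric] by simp_all
      then show ?thesis by (simp only: powr_minus_divide) simp
    qed
    finally show ?thesis by (simp add: d_def)
  qed
  have "ennreal (Beta p q) = (\<integral>\<^sup>+r. ennreal (indicator {0<..<1} r * k r) \<partial>lborel)"
    unfolding k_def by (rule nn_integral_Beta_kernel[OF pq, symmetric])
  also have "\<dots> = (\<integral>\<^sup>+v. ennreal (indicator {0<..<1} v * (\<bar>g' v\<bar> * k (g v))) \<partial>lborel)"
    by (rule nn_integral_change_of_variables[OF _ bij deriv]) (auto simp: k_def g'_def g_def)
  also have "\<dots> = (\<integral>\<^sup>+v. ennreal (a powr p * b powr q) *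
      ennreal (indicator {0<..<1} v * (k v * (v * a + (1 - v) * b) powr (- (p + q)))) \<partial>lborel)"
  proof (intro nn_integral_cong)
    fix v :: real
    show "ennreal (indicator {0<..<1} v * (\<bar>g' v\<bar> * k (g v))) = ennreal (a powr p * b powr q) *
      ennreal (indicator {0<..<1} v * (k v * (v * a + (1 - v) * b) powr (- (p + q))))"
    proof (cases "v \<in> {0<..<1}")
      case True
      then show ?thesis unfolding key[OF True] by (simp add: ennreal_mult')
    qed simp
  qed
  also have "\<dots> = ennreal (a powr p * b powr q) * (\<integral>\<^sup>+v.
      ennreal (indicator {0<..<1} v * (k v * (v * a + (1 - v) * b) powr (- (p + q)))) \<partial>lborel)"
    by (rule nn_integral_cmult) (auto simp: k_def)
  finally have main: "ennreal (Beta p q) = \<dots>" .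
  have "(\<integral>\<^sup>+v. ennreal ((v * a + (1 - v) * b) powr (- (p + q))) \<partial>beta_distribution p q)
     = ennreal (1 / Beta p q) * (\<integral>\<^sup>+v. ennreal (indicator {0<..<1} v * (k v * (v * a + (1 - v) * b) powr (- (p + q)))) \<partial>lborel)"
    using pq by (subst nn_integral_beta_distribution_Beta) (simp_all add: k_def ennreal_mult' mult.assoc)
  also have "\<dots> = ennreal (a powr (- p) * b powr (- q)) * (ennreal (1 / Beta p q) * (ennreal (a powr p * b powr q) *
     (\<integral>\<^sup>+v. ennreal (indicator {0<..<1} v * (k v * (v * a + (1 - v) * b) powr (- (p + q)))) \<partial>lborel)))"
  proof -
    have "ennreal (a powr (- p) * b powr (- q)) * ennreal (a powr p * b powr q) = 1"
      using ab by (simp add: powr_minus field_simps flip: ennreal_mult')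
    moreover have "e * (x * (d * y)) = (e * d) * (x * y)" for e x d y :: ennreal
      by (simp add: ac_simps)
    ultimately show ?thesis by simp
  qed
  also have "\<dots> = ennreal (a powr (- p) * b powr (- q))"
    using Beta_real_pos[OF pq] unfolding main[symmetric] by (simp flip: ennreal_mult')
  finally show ?thesis .
qed

lemma prob_space_beta_distribution:
  assumes "0 < a" "0 < b"
  shows "prob_space (beta_distribution a b)"
proof
  \<comment> \<open>The normalization is the case where both coefficients are 1, with integrand
    1.\<close>
  show "emeasure (beta_distribution a b) (space (beta_distribution a b)) = 1"
    using nn_integral_beta_distribution_linear_powr[OF assms, of 1 1]
    by (simp flip: nn_integral_const[where c=1, simplified])
qed

section \<open>Mixtures that turn powers of linear expressions in the moments into powers of a
  variance\<close>

text \<open>Under r = y^2 / (1 + y^2) the two bases become (y^2 + 2 b y + d) / (1 + y^2) at y and at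
  - y, so the two signs cover the two half-lines. The second Beta parameter \<theta> - 1/2 is the
  one for which Jacobian and kernel leave exactly (1 + y^2)^(- \<theta>), which cancels the
  denominators.\<close>

lemma nn_integral_beta_half_kernel_quadratic:
  fixes \<theta> b d :: real
  assumes "b\<^sup>2 < d"
  shows "(\<integral>\<^sup>+r. ennreal (indicator {0<..<1} r * (r powr (1 / 2 - 1) * (1 - r) powr (\<theta> - 1 / 2 - 1) *
        (1 / 2 * ((r + 2 * b * sqrt (r * (1 - r)) + d * (1 - r)) powr (- \<theta>)
                + (r - 2 * b * sqrt (r * (1 - r)) + d * (1 - r)) powr (- \<theta>))))) \<partial>lborel)
    = (\<integral>\<^sup>+y. ennreal ((y\<^sup>2 + 2 * b * y + d) powr (- \<theta>)) \<partial>lborel)"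
proof -
  define q where "q y = (y\<^sup>2 + 2 * b * y + d) powr (- \<theta>)" for y
  have [measurable]: "q \<in> borel_measurable borel" unfolding q_def by measurable
  define k where "k r = r powr (1 / 2 - 1) * (1 - r) powr (\<theta> - 1 / 2 - 1) *
        (1 / 2 * ((r + 2 * b * sqrt (r * (1 - r)) + d * (1 - r)) powr (- \<theta>)
                + (r - 2 * b * sqrt (r * (1 - r)) + d * (1 - r)) powr (- \<theta>)))" for r :: real
  define g where "g y = y\<^sup>2 / (1 + y\<^sup>2)" for y :: real
  define g' where "g' y = 2 * y / (1 + y\<^sup>2)\<^sup>2" for y :: real
  have pos: "0 < 1 + y\<^sup>2" for y :: real by (simp add: add_pos_nonneg)
  have quad: "0 < y\<^sup>2 + 2 * b * y + d" for y
  proof -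
    have "y\<^sup>2 + 2 * b * y + d = (y + b)\<^sup>2 + (d - b\<^sup>2)" by (simp add: power2_eq_square algebra_simps)
    then show ?thesis using assms zero_le_power2[of "y + b"] by linarith
  qed
  have one_minus: "1 - g y = 1 / (1 + y\<^sup>2)" for y
    using pos[of y] by (simp add: g_def field_simps)
  have bij: "bij_betw g {0<..} {0<..<1}"
  proof (rule bij_betwI[where g = "\<lambda>r. sqrt (r / (1 - r))"])
    show "g \<in> {0<..} \<rightarrow> {0<..<1}"
    proof
      fix y :: real assume "y \<in> {0<..}"
      then have "0 < g y" "0 < 1 - g y" using pos[of y] unfolding one_minus by (auto simp: g_def)
      then show "g y \<in> {0<..<1}" by auto
    qed
    show "sqrt (g y / (1 - g y)) = y" if "y \<in> {0<..}" for y
      using that pos[of y] unfolding one_minus by (simp add: g_def)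
    show "g (sqrt (r / (1 - r))) = r" if "r \<in> {0<..<1}" for r
      using that by (simp add: g_def field_simps)
  qed auto
  have deriv: "(g has_real_derivative g' y) (at y)" for y
    using pos[of y] unfolding g_def g'_def
    by (auto intro!: derivative_eq_intros simp: power2_eq_square) (simp add: field_simps)
  have key: "\<bar>g' y\<bar> * k (g y) = q y + q (- y)" if y: "0 < y" for y
  proof -
    define e where "e = 1 + y\<^sup>2"
    have e: "0 < e" using pos[of y] by (simp add: e_def)
    have sq: "sqrt (g y * (1 - g y)) = y / e"
      using y unfolding one_minus by (simp add: g_def e_def real_sqrt_divide real_sqrt_mult)
    have lin: "(g y + s + d * (1 - g y)) = (y\<^sup>2 + s * e + d) / e" for s
    proof -
      have "g y = y\<^sup>2 / e" by (simp add: g_def e_def)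
      then show ?thesis using e unfolding one_minus e_def[symmetric] by (simp add: add_divide_distrib)
    qed
    have plus: "(g y + 2 * b * sqrt (g y * (1 - g y)) + d * (1 - g y)) powr (- \<theta>) = q y * e powr \<theta>"
      using e quad[of y] unfolding lin sq
      by (simp add: q_def powr_divide powr_minus_divide)
    have minus: "(g y - 2 * b * sqrt (g y * (1 - g y)) + d * (1 - g y)) powr (- \<theta>) = q (- y) * e powr \<theta>"
      using e quad[of "- y"] lin[of "- 2 * b * (y / e)"] unfolding sq
      by (simp add: q_def powr_divide powr_minus_divide)
    \<comment> \<open>The first parameter 1/2 makes the powers of \<open>y\<close> cancel against
      the factor \<open>y\<close> of the Jacobian.\<close>
    have "\<bar>g' y\<bar> * (g y powr (1 / 2 - 1) * (1 - g y) powr (\<theta> - 1 / 2 - 1))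
        = 2 * y powr 1 / e powr 2 * ((y powr 2 / e) powr (- (1 / 2)) * (1 / e) powr (\<theta> - 3 / 2))"
      using y e unfolding one_minus by (simp add: g'_def g_def powr_numeral abs_mult flip: e_def)
    also have "\<dots> = 2 * (y powr 1 * y powr (- 1)) * (e powr (- 2) * e powr (1 / 2) * e powr (- (\<theta> - 3 / 2)))"
    proof -
      have "(y powr 2 / e) powr (- (1 / 2)) = y powr (- 1) * e powr (1 / 2)"
        using y e by (simp add: powr_divide powr_powr powr_minus_divide)
      moreover have "(1 / e) powr (\<theta> - 3 / 2) = e powr (- (\<theta> - 3 / 2))"
        using e unfolding powr_minus_divide by (simp add: powr_divide)
      moreover have "e powr (- 2) = 1 / e powr 2" unfolding powr_minus_divide ..
      ultimately show ?thesis by (simp only:) simp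
    qed
    also have "\<dots> = 2 * e powr (- \<theta>)"
      using y e by (simp flip: powr_add)
    finally have "\<bar>g' y\<bar> * k (g y) = 2 * e powr (- \<theta>) * (1 / 2 * (q y * e powr \<theta> + q (- y) * e powr \<theta>))"
      unfolding k_def plus minus by (simp only: mult.assoc[symmetric])
    also have "\<dots> = q y + q (- y)"
      using e by (simp add: powr_minus field_simps)
    finally show ?thesis .
  qed
  have nonneg: "0 \<le> k r" for r by (simp add: k_def)
  have "(\<integral>\<^sup>+r. ennreal (indicator {0<..<1} r * k r) \<partial>lborel)
      = (\<integral>\<^sup>+y. ennreal (indicator {0<..} y * (\<bar>g' y\<bar> * k (g y))) \<partial>lborel)"
    by (rule nn_integral_change_of_variables[OF _ bij deriv nonneg])
       (auto simp: k_def g'_def g_def)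
  also have "\<dots> = (\<integral>\<^sup>+y. ennreal (indicator {0<..} y * q y) + ennreal (indicator {0<..} y * q (- y)) \<partial>lborel)"
    by (intro nn_integral_cong) (auto simp: key indicator_def q_def simp flip: ennreal_plus)
  also have "\<dots> = (\<integral>\<^sup>+y. ennreal (indicator {0<..} y * q y) \<partial>lborel)
      + (\<integral>\<^sup>+y. ennreal (indicator {0<..} y * q (- y)) \<partial>lborel)"
    by (intro nn_integral_add) auto
  also have "(\<integral>\<^sup>+y. ennreal (indicator {0<..} y * q (- y)) \<partial>lborel)
      = (\<integral>\<^sup>+y. ennreal (indicator {..<0} y * q y) \<partial>lborel)"
    by (subst nn_integral_real_affine[where c = "- 1" and t = 0])
       (auto intro!: nn_integral_cong simp: indicator_def)
  also have "(\<integral>\<^sup>+y. ennreal (indicator {0<..} y * q y) \<partial>lborel) + \<dots>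
      = (\<integral>\<^sup>+y. ennreal (indicator {0<..} y * q y) + ennreal (indicator {..<0} y * q y) \<partial>lborel)"
    by (intro nn_integral_add[symmetric]) auto
  \<comment> \<open>The two open half-lines miss only the point 0.\<close>
  also have "\<dots> = (\<integral>\<^sup>+y. ennreal (q y) \<partial>lborel)"
    using AE_lborel_singleton[of "0 :: real"]
    by (intro nn_integral_cong_AE) (auto simp: indicator_def elim!: eventually_mono)
  finally show ?thesis unfolding k_def q_def .
qed

text \<open>Completing the square: the substitution of \<open>- b + sqrt D * y\<close> for
  \<open>y\<close> turns the polynomial into D (y^2 + 1). The scaling contributes
  \<open>sqrt D\<close>, which accounts for the 1/2 in the exponent. With \<open>b\<close> and
  \<open>d\<close> affine in the first and second moments, D becomes the variance.\<close>

lemma nn_integral_quadratic_powr: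
  fixes \<theta> b d :: real
  assumes "b\<^sup>2 < d"
  shows "(\<integral>\<^sup>+y. ennreal ((y\<^sup>2 + 2 * b * y + d) powr (- \<theta>)) \<partial>lborel)
    = ennreal ((d - b\<^sup>2) powr (1 / 2 - \<theta>)) * (\<integral>\<^sup>+y. ennreal ((y\<^sup>2 + 1) powr (- \<theta>)) \<partial>lborel)"
proof -
  define D where "D = d - b\<^sup>2"
  have D: "0 < D" using assms by (simp add: D_def)
  have quad: "(- b + sqrt D * y)\<^sup>2 + 2 * b * (- b + sqrt D * y) + d = D * (y\<^sup>2 + 1)" for y
  proof -
    have "(- b + sqrt D * y)\<^sup>2 + 2 * b * (- b + sqrt D * y) + d = (sqrt D)\<^sup>2 * y\<^sup>2 + (d - b\<^sup>2)"
      by (simp add: power2_eq_square algebra_simps)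
    then show ?thesis using D by (simp add: D_def algebra_simps)
  qed
  have "(\<integral>\<^sup>+y. ennreal ((y\<^sup>2 + 2 * b * y + d) powr (- \<theta>)) \<partial>lborel)
     = ennreal (sqrt D) * (\<integral>\<^sup>+y. ennreal ((D * (y\<^sup>2 + 1)) powr (- \<theta>)) \<partial>lborel)"
    unfolding quad[symmetric] using D
    by (subst nn_integral_real_affine[where c = "sqrt D" and t = "- b"]) auto
  also have "\<dots> = ennreal (sqrt D) * (\<integral>\<^sup>+y. ennreal (D powr (- \<theta>)) * ennreal ((y\<^sup>2 + 1) powr (- \<theta>)) \<partial>lborel)"
    using D by (simp add: powr_mult ennreal_mult')
  also have "\<dots> = ennreal (sqrt D * D powr (- \<theta>)) * (\<integral>\<^sup>+y. ennreal ((y\<^sup>2 + 1) powr (- \<theta>)) \<partial>lborel)"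
    using D by (simp add: nn_integral_cmult ennreal_mult' mult.assoc)
  also have "sqrt D * D powr (- \<theta>) = D powr (1 / 2 - \<theta>)"
    using D by (simp add: powr_half_sqrt[symmetric] flip: powr_add)
  finally show ?thesis by (simp add: D_def)
qed

text \<open>The remaining integral \<open>?J\<close> is never computed. For b = 0 and d = 1 the
  integrand is 1, so the total mass of the Beta law gives its quotient by the Beta constant.\<close>

lemma nn_integral_beta_half_quadratic:
  fixes \<theta> b d :: real
  assumes "1 / 2 < \<theta>" "b\<^sup>2 < d"
  shows "(\<integral>\<^sup>+r. ennreal (1 / 2 * ((r + 2 * b * sqrt (r * (1 - r)) + d * (1 - r)) powr (- \<theta>)
        + (r - 2 * b * sqrt (r * (1 - r)) + d * (1 - r)) powr (- \<theta>))) \<partial>beta_distribution (1 / 2) (\<theta> - 1 / 2))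
    = ennreal ((d - b\<^sup>2) powr (1 / 2 - \<theta>))"
proof -
  let ?J = "\<integral>\<^sup>+y. ennreal ((y\<^sup>2 + 1) powr (- \<theta>)) \<partial>lborel"
  have pq: "0 < (1 / 2 :: real)" "0 < \<theta> - 1 / 2" using assms by auto
  have eq: "(\<integral>\<^sup>+r. ennreal (1 / 2 * ((r + 2 * b * sqrt (r * (1 - r)) + d * (1 - r)) powr (- \<theta>)
        + (r - 2 * b * sqrt (r * (1 - r)) + d * (1 - r)) powr (- \<theta>))) \<partial>beta_distribution (1 / 2) (\<theta> - 1 / 2))
    = ennreal (1 / Beta (1 / 2) (\<theta> - 1 / 2)) * (ennreal ((d - b\<^sup>2) powr (1 / 2 - \<theta>)) * ?J)"
    if "b\<^sup>2 < d" for b d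
    unfolding nn_integral_quadratic_powr[OF that, symmetric]
      nn_integral_beta_half_kernel_quadratic[OF that, symmetric]
    using pq by (subst nn_integral_beta_distribution_Beta) (auto simp: mult.assoc simp flip: ennreal_mult)
  interpret prob_space "beta_distribution (1 / 2) (\<theta> - 1 / 2)"
    by (rule prob_space_beta_distribution[OF pq])
  have "ennreal (1 / Beta (1 / 2) (\<theta> - 1 / 2)) * ?J = 1"
    using eq[of 0 1] emeasure_space_1 by simp
  then show ?thesis
    using eq[OF assms(2)] by (simp add: mult.left_commute[of _ "ennreal (_ powr _)"])
qed

section \<open>The Dirichlet law as two successive Beta laws\<close>

lemma sets_Delta2 [simp, measurable]: "Delta2 \<in> sets borel"
proof -
  have "closed Delta2"
    unfolding Delta2_def case_prod_beta by (intro closed_Collect_conj closed_Collect_le continuous_intros)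
  then show ?thesis by simp
qed

text \<open>Stick-breaking form of the Dirichlet law: the second coordinate is a Beta(b, c) fraction
  of what the first leaves over. Rescaling by 1 - x makes the density factor, with
  \<open>Gamma (b + c)\<close> cancelling between the two constants.\<close>

lemma nn_integral_dirichlet_distribution:
  assumes [measurable]: "F \<in> borel_measurable borel" and abc: "0 < a" "0 < b" "0 < c"
  shows "(\<integral>\<^sup>+p. F p \<partial>dirichlet_distribution a b c)
    = (\<integral>\<^sup>+x. (\<integral>\<^sup>+y. F (x, (1 - x) * y) \<partial>beta_distribution b c) \<partial>beta_distribution a (b + c))"
proof -
  define k where "k p q r = indicator {0<..<1} r *
     (Gamma (p + q) / (Gamma p * Gamma q) * r powr (p - 1) * (1 - r) powr (q - 1))" for p q r :: real
  define D where "D x y = indicator Delta2 (x, y) * (Gamma (a + b + c) / (Gamma a * Gamma b * Gamma c)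
        * x powr (a - 1) * y powr (b - 1) * (1 - x - y) powr (c - 1))" for x y :: real
  have [measurable]: "Delta2 \<in> sets (borel \<Otimes>\<^sub>M borel)"
    unfolding borel_prod by (rule sets_Delta2)
  have [measurable]: "case_prod D \<in> borel_measurable (borel \<Otimes>\<^sub>M borel)" "k p q \<in> borel_measurable borel" for p q
    unfolding D_def k_def by measurable
  have [measurable]: "F \<in> borel_measurable (borel \<Otimes>\<^sub>M borel)"
    using assms(1) by (simp add: borel_prod)
  have G: "0 < Gamma (a + b + c)" "0 < Gamma (b + c)" "0 < Gamma a" "0 < Gamma b" "0 < Gamma c"
    using abc by (auto intro!: Gamma_real_pos add_pos_pos)
  have scale: "ennreal (1 - x) * ennreal (D x ((1 - x) * y)) = ennreal (k a (b + c) x) * ennreal (k b c y)"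
    if x: "0 < x" "x < 1" for x y
  proof (cases "0 < y \<and> y < 1")
    case True
    have mem: "(x, (1 - x) * y) \<in> Delta2"
    proof -
      have "0 \<le> (1 - x) * (1 - y)" using x True by simp
      then show ?thesis using x True by (auto simp: Delta2_def algebra_simps)
    qed
    have "1 - x - (1 - x) * y = (1 - x) * (1 - y)" by (simp add: algebra_simps)
    moreover have "(1 - x) * ((1 - x) powr (b - 1) * (1 - x) powr (c - 1)) = (1 - x) powr (b + c - 1)"
      using x by (simp add: powr_mult_base flip: powr_add)
    moreover have "(1 - x) * D x ((1 - x) * y) = Gamma (a + b + c) / (Gamma a * Gamma b * Gamma c) * x powr (a - 1)
        * y powr (b - 1) * (1 - y) powr (c - 1) * ((1 - x) * ((1 - x) powr (b - 1) * (1 - x) powr (c - 1)))"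
      using x True mem unfolding D_def calculation(1) by (simp add: powr_mult mult_ac)
    ultimately have "(1 - x) * D x ((1 - x) * y) = k a (b + c) x * k b c y"
      using x True G by (simp add: k_def add.assoc mult_ac)
    moreover have "0 \<le> D x ((1 - x) * y)" "0 \<le> k a (b + c) x" "0 \<le> k b c y"
      using G by (auto simp: D_def k_def indicator_def add.assoc)
    ultimately show ?thesis using x by (simp flip: ennreal_mult)
  next
    case False
    \<comment> \<open>Here the right-hand side vanishes by its indicator. On the left the point lies
      outside \<open>Delta2\<close>, except for y = 0 and y = 1, where the density is 0 because
      \<open>0 powr _\<close> is 0 for every exponent.\<close>
    have "D x ((1 - x) * y) = 0"
    proof (cases "y \<le> 0")
      case True
      then show ?thesis using x by (cases "y = 0") (auto simp: D_def Delta2_def indicator_def zero_le_mult_iff)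
    next
      case False
      then consider "y = 1" | "1 < y" using \<open>\<not> (0 < y \<and> y < 1)\<close> by linarith
      then show ?thesis
      proof cases
        case 2
        then have "(1 - x) * 1 < (1 - x) * y" using x by (intro mult_strict_left_mono) auto
        then have "(x, (1 - x) * y) \<notin> Delta2" by (simp add: Delta2_def)
        then show ?thesis by (simp add: D_def)
      qed (simp add: D_def)
    qed
    then show ?thesis using False by (simp add: k_def)
  qed
  have inner: "(\<integral>\<^sup>+y. ennreal (D x y) * F (x, y) \<partial>lborel)
      = ennreal (k a (b + c) x) * (\<integral>\<^sup>+y. ennreal (k b c y) * F (x, (1 - x) * y) \<partial>lborel)" for x
  proof (cases "0 < x \<and> x < 1")
    case True
    then have "(\<integral>\<^sup>+y. ennreal (D x y) * F (x, y) \<partial>lborel)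
        = ennreal (1 - x) * (\<integral>\<^sup>+y. ennreal (D x ((1 - x) * y)) * F (x, (1 - x) * y) \<partial>lborel)"
      by (subst nn_integral_real_affine[where c = "1 - x" and t = 0]) auto
    also have "\<dots> = (\<integral>\<^sup>+y. ennreal (k a (b + c) x) * (ennreal (k b c y) * F (x, (1 - x) * y)) \<partial>lborel)"
      using True 
      by (subst nn_integral_cmult[symmetric]) (auto simp: scale mult.assoc[symmetric] simp del: mult.assoc)
    also have "\<dots> = ennreal (k a (b + c) x) * (\<integral>\<^sup>+y. ennreal (k b c y) * F (x, (1 - x) * y) \<partial>lborel)"
      by (rule nn_integral_cmult) auto
    finally show ?thesis .
  next
    case False
    then have "D x y = 0" for y
      by (cases "x = 0"; cases "y = 0") (auto simp: D_def Delta2_def indicator_def)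
    then show ?thesis using False by (simp add: k_def)
  qed
  have "(\<integral>\<^sup>+p. F p \<partial>dirichlet_distribution a b c) = (\<integral>\<^sup>+p. ennreal (D (fst p) (snd p)) * F p \<partial>(lborel \<Otimes>\<^sub>M lborel))"
    unfolding dirichlet_distribution_def D_def lborel_prod
    by (subst nn_integral_density) (auto simp: case_prod_beta borel_prod[symmetric])
  also have "\<dots> = (\<integral>\<^sup>+x. (\<integral>\<^sup>+y. ennreal (D x y) * F (x, y) \<partial>lborel) \<partial>lborel)"
    by (subst lborel.nn_integral_fst[symmetric]) (auto simp: case_prod_beta)
  also have "\<dots> = (\<integral>\<^sup>+x. ennreal (k a (b + c) x) * (\<integral>\<^sup>+y. F (x, (1 - x) * y) \<partial>beta_distribution b c) \<partial>lborel)"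
    unfolding inner k_def by (subst nn_integral_beta_distribution) auto
  also have "\<dots> = (\<integral>\<^sup>+x. (\<integral>\<^sup>+y. F (x, (1 - x) * y) \<partial>beta_distribution b c) \<partial>beta_distribution a (b + c))"
    unfolding k_def
    by (subst (2) nn_integral_beta_distribution) (auto simp: nn_integral_beta_distribution)
  finally show ?thesis .
qed

text \<open>With the second coordinate written as (1 - x) y, the Beta(1/2, \<theta> - 1/2) integral
  over x is taken first, for fixed y. It gives a power 1/2 - \<theta> of 1 + y (m2 - m1^2) / z.
  Since \<theta> - 1/2 is the sum of the parameters 1 and \<theta> - 3/2 of the law of y, the linear
  power identity applies and leaves the power - 1.\<close>

lemma nn_integral_dirichlet_half_quadratic:
  fixes \<theta> z m1 m2 :: real
  assumes \<theta>: "3 / 2 < \<theta>" and z: "0 < z" and m: "m1\<^sup>2 \<le> m2"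
  shows "(\<integral>\<^sup>+p. ennreal (1 / 2 * ((z + 2 * sqrt (z * fst p * snd p) * m1 + snd p * m2) powr (- \<theta>)
        + (z - 2 * sqrt (z * fst p * snd p) * m1 + snd p * m2) powr (- \<theta>))) \<partial>dirichlet_distribution (1 / 2) 1 (\<theta> - 3 / 2))
    = ennreal (z powr (1 - \<theta>) / (z + (m2 - m1\<^sup>2)))" (is "(\<integral>\<^sup>+p. ?F p \<partial>_) = _")
proof -
  let ?A = "beta_distribution (1 / 2) (\<theta> - 1 / 2)" and ?B = "beta_distribution 1 (\<theta> - 3 / 2)"
  interpret A: prob_space ?A using \<theta> by (intro prob_space_beta_distribution) auto
  interpret B: prob_space ?B using \<theta> by (intro prob_space_beta_distribution) auto
  interpret AB: pair_prob_space ?A ?B ..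
  have [measurable]: "?F \<in> borel_measurable (borel \<Otimes>\<^sub>M borel)" by measurable
  have "(\<integral>\<^sup>+p. ?F p \<partial>dirichlet_distribution (1 / 2) 1 (\<theta> - 3 / 2))
      = (\<integral>\<^sup>+x. (\<integral>\<^sup>+y. ?F (x, (1 - x) * y) \<partial>?B) \<partial>?A)"
    using \<theta> by (subst nn_integral_dirichlet_distribution) (auto simp: borel_prod[symmetric])
  also have "\<dots> = (\<integral>\<^sup>+y. (\<integral>\<^sup>+x. ?F (x, (1 - x) * y) \<partial>?A) \<partial>?B)"
    by (rule AB.Fubini'[symmetric]) measurable
  also have "\<dots> = (\<integral>\<^sup>+y. ennreal (z powr (- \<theta>)) * ennreal ((y * (1 + (m2 - m1\<^sup>2) / z) + (1 - y) * 1) powr (- (1 + (\<theta> - 3 / 2)))) \<partial>?B)"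
  proof (rule nn_integral_cong_AE, use AE_beta_distribution[of 1 "\<theta> - 3 / 2"] in eventually_elim)
    fix y :: real assume y: "0 < y \<and> y < 1"
    \<comment> \<open>After division by z the constant 1 is split as r + (1 - r), and its second
      part goes into \<open>d\<close>.\<close>
    define b d where "b = sqrt (y / z) * m1" and "d = 1 + y * m2 / z"
    have bd: "d - b\<^sup>2 = y * (1 + (m2 - m1\<^sup>2) / z) + (1 - y) * 1"
      using y z by (simp add: b_def d_def power_mult_distrib field_simps)
    have lt: "b\<^sup>2 < d"
    proof -
      have "0 < (1 - y) * 1 + y * (1 + (m2 - m1\<^sup>2) / z)"
      proof (rule add_pos_pos)
        have "0 < 1 + (m2 - m1\<^sup>2) / z" using z m by (simp add: add_pos_nonneg)
        then show "0 < y * (1 + (m2 - m1\<^sup>2) / z)" using y by simp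
      qed (use y in simp)
      then show ?thesis using bd by simp
    qed
    have "(\<integral>\<^sup>+x. ?F (x, (1 - x) * y) \<partial>?A) = (\<integral>\<^sup>+r. ennreal (z powr (- \<theta>)) *
        ennreal (1 / 2 * ((r + 2 * b * sqrt (r * (1 - r)) + d * (1 - r)) powr (- \<theta>)
        + (r - 2 * b * sqrt (r * (1 - r)) + d * (1 - r)) powr (- \<theta>))) \<partial>?A)"
    proof (rule nn_integral_cong_AE, use AE_beta_distribution[of "1 / 2" "\<theta> - 1 / 2"] in eventually_elim)
      fix r :: real assume r: "0 < r \<and> r < 1"
      have "sqrt (z * r * ((1 - r) * y)) = z * (sqrt (y / z) * sqrt (r * (1 - r)))"
      proof -
        have "z * r * ((1 - r) * y) = z\<^sup>2 * (y / z * (r * (1 - r)))"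
          using z by (simp add: power2_eq_square)
        then show ?thesis
          using z by (simp only: real_sqrt_mult real_sqrt_abs)
      qed
      then have fac: "z + 2 * sqrt (z * r * ((1 - r) * y)) * m1 + (1 - r) * y * m2
            = z * (r + 2 * b * sqrt (r * (1 - r)) + d * (1 - r))"
          "z - 2 * sqrt (z * r * ((1 - r) * y)) * m1 + (1 - r) * y * m2
            = z * (r - 2 * b * sqrt (r * (1 - r)) + d * (1 - r))"
        using z by (simp_all add: b_def d_def field_simps)
      \<comment> \<open>The bases must be nonnegative for the factor z to be split off from the
        power. Up to (d - b^2) (1 - r) they are squares.\<close>
      have "0 \<le> r + s * (2 * b * sqrt (r * (1 - r))) + d * (1 - r)" if "s\<^sup>2 = 1" for s
      proof -
        have "r + s * (2 * b * sqrt (r * (1 - r))) + d * (1 - r)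
            = (sqrt r)\<^sup>2 + 2 * (sqrt r) * (s * b * sqrt (1 - r)) + (s * b * sqrt (1 - r))\<^sup>2 + (d - b\<^sup>2) * (1 - r)"
          using r that unfolding real_sqrt_mult by (simp add: power_mult_distrib algebra_simps)
        also have "\<dots> = (sqrt r + s * b * sqrt (1 - r))\<^sup>2 + (d - b\<^sup>2) * (1 - r)"
          by (simp add: power2_sum)
        finally show ?thesis using r lt by simp
      qed
      from this[of 1] this[of "- 1"]
      have nn: "0 \<le> r + 2 * b * sqrt (r * (1 - r)) + d * (1 - r)" "0 \<le> r - 2 * b * sqrt (r * (1 - r)) + d * (1 - r)"
        by simp_all
      have powr: "(z * Q) powr (- \<theta>) = z powr (- \<theta>) * Q powr (- \<theta>)" if "0 \<le> Q" for Q
        using z that by (simp add: powr_mult)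
      show "?F (r, (1 - r) * y) = ennreal (z powr (- \<theta>)) *
          ennreal (1 / 2 * ((r + 2 * b * sqrt (r * (1 - r)) + d * (1 - r)) powr (- \<theta>)
          + (r - 2 * b * sqrt (r * (1 - r)) + d * (1 - r)) powr (- \<theta>)))"
        unfolding fst_conv snd_conv fac powr[OF nn(1)] powr[OF nn(2)]
        by (simp only: ennreal_mult'[symmetric] powr_ge_zero distrib_left mult.left_commute[of "1 / 2"])
    qed
    also have "\<dots> = ennreal (z powr (- \<theta>)) * ennreal ((d - b\<^sup>2) powr (1 / 2 - \<theta>))"
      using \<theta> by (subst nn_integral_cmult, simp, subst nn_integral_beta_half_quadratic[OF _ lt]) simp_all
    finally show "(\<integral>\<^sup>+x. ?F (x, (1 - x) * y) \<partial>?A) = ennreal (z powr (- \<theta>)) *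
        ennreal ((y * (1 + (m2 - m1\<^sup>2) / z) + (1 - y) * 1) powr (- (1 + (\<theta> - 3 / 2))))"
      unfolding bd by simp
  qed
  also have "\<dots> = ennreal (z powr (- \<theta>)) * ennreal ((1 + (m2 - m1\<^sup>2) / z) powr (- 1) * 1 powr (- (\<theta> - 3 / 2)))"
    using \<theta> z m by (subst nn_integral_cmult, simp, subst nn_integral_beta_distribution_linear_powr)
      (auto intro!: add_pos_nonneg)
  also have "\<dots> = ennreal (z powr (1 - \<theta>) / (z + (m2 - m1\<^sup>2)))"
  proof -
    have "0 < z + (m2 - m1\<^sup>2)" "0 < 1 + (m2 - m1\<^sup>2) / z"
      using z m by (auto intro!: add_pos_nonneg)
    then have "z powr (- \<theta>) * (1 + (m2 - m1\<^sup>2) / z) powr (- 1) = z powr (1 - \<theta>) / (z + (m2 - m1\<^sup>2))"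
      using z by (simp add: powr_diff powr_minus field_simps)
    then show ?thesis by (simp flip: ennreal_mult')
  qed
  finally show ?thesis .
qed

subsection \<open>Stick-breaking sums\<close>

text \<open>The integral of f under the stick-breaking measure as an explicit series in the
  coordinates, which makes measurability and the shift recursion visible. Its values lie in
  \<open>ennreal\<close> so that it makes sense before finiteness is known. Negative values of f
  count as 0, so it serves nonnegative functions only.\<close>

definition stick_sum :: "(real \<Rightarrow> real) \<Rightarrow> (nat \<Rightarrow> real) \<Rightarrow> (nat \<Rightarrow> real) \<Rightarrow> ennreal" where
  "stick_sum f v x = (\<Sum>n. ennreal (stick_weight v (Suc n)) * ennreal (f (x (Suc n))))"

lemma sets_stick_breaking_measure [simp, measurable_cong]:
  "sets (stick_breaking_measure v x) = sets borel"
  by (simp add: stick_breaking_measure_def)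

lemma space_stick_breaking_measure [simp]: "space (stick_breaking_measure v x) = UNIV"
  by (simp add: stick_breaking_measure_def)

lemma nn_integral_stick_breaking_measure:
  assumes [measurable]: "f \<in> borel_measurable borel"
  shows "(\<integral>\<^sup>+y. ennreal (f y) \<partial>stick_breaking_measure v x) = stick_sum f v x"
proof -
  have bij: "bij_betw Suc UNIV {1..}"
    by (rule bij_betwI[where g = "\<lambda>n. n - 1"]) auto
  have "(\<integral>\<^sup>+y. ennreal (f y) \<partial>stick_breaking_measure v x)
      = (\<integral>\<^sup>+n. ennreal (stick_weight v n) * ennreal (f (x n)) \<partial>count_space {1..})"
    unfolding stick_breaking_measure_def
    by (subst nn_integral_distr) (auto simp: nn_integral_density)
  also have "\<dots> = (\<integral>\<^sup>+n. ennreal (stick_weight v (Suc n)) * ennreal (f (x (Suc n))) \<partial>count_space UNIV)"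
    by (rule nn_integral_bij_count_space[OF bij, symmetric])
  also have "\<dots> = stick_sum f v x"
    unfolding stick_sum_def by (rule nn_integral_count_space_nat)
  finally show ?thesis .
qed

lemma stick_weight_cong:
  assumes "\<And>i. 1 \<le> i \<Longrightarrow> v i = v' i" "1 \<le> n"
  shows "stick_weight v n = stick_weight v' n"
  using assms by (simp add: stick_weight_def)

lemma stick_sum_cong:
  assumes "\<And>i. 1 \<le> i \<Longrightarrow> v i = v' i" "\<And>i. 1 \<le> i \<Longrightarrow> x i = x' i"
  shows "stick_sum f v x = stick_sum f v' x'"
  using assms stick_weight_cong[OF assms(1)] by (simp add: stick_sum_def)

lemma stick_weight_Suc:
  assumes "1 \<le> n"
  shows "stick_weight v (Suc n) = (1 - v 1) * stick_weight (\<lambda>i. v (Suc i)) n"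
proof -
  have "(\<Prod>i\<in>{1..<Suc n}. 1 - v i) = (1 - v 1) * (\<Prod>i\<in>{Suc 1..<Suc n}. 1 - v i)"
    using assms by (subst prod.atLeast_Suc_lessThan) auto
  also have "(\<Prod>i\<in>{Suc 1..<Suc n}. 1 - v i) = (\<Prod>i\<in>{1..<n}. 1 - v (Suc i))"
    by (rule prod.shift_bounds_Suc_ivl)
  finally show ?thesis by (simp add: stick_weight_def)
qed

text \<open>All later weights carry the factor 1 - v 1. This is the pathwise form of the equation
  satisfied by means of the process: a mean is a convex combination of the value at the first atom
  and a mean of the shifted process.\<close>

lemma stick_sum_Suc:
  assumes "v 1 \<le> 1"
  shows "stick_sum f v x = ennreal (v 1) * ennreal (f (x 1))
    + ennreal (1 - v 1) * stick_sum f (\<lambda>i. v (Suc i)) (\<lambda>i. x (Suc i))"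
proof -
  define a where "a n = ennreal (stick_weight v (Suc n)) * ennreal (f (x (Suc n)))" for n
  have tail: "a (Suc n) = ennreal (1 - v 1) *
      (ennreal (stick_weight (\<lambda>i. v (Suc i)) (Suc n)) * ennreal (f (x (Suc (Suc n)))))" for n
    using assms by (simp add: a_def stick_weight_Suc[of "Suc n"] ennreal_mult' mult.assoc)
  have "(\<lambda>n. a (Suc n)) sums (\<Sum>n. a (Suc n))"
    by (intro summable_sums summableI)
  then have "a sums ((\<Sum>n. a (Suc n)) + a 0)" by (rule sums_Suc)
  then have "stick_sum f v x = (\<Sum>n. a (Suc n)) + a 0"
    unfolding stick_sum_def a_def by (rule sums_unique[symmetric])
  also have "(\<Sum>n. a (Suc n)) = ennreal (1 - v 1) * stick_sum f (\<lambda>i. v (Suc i)) (\<lambda>i. x (Suc i))"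
    unfolding tail stick_sum_def by (rule ennreal_suminf_cmult)
  also have "a 0 = ennreal (v 1) * ennreal (f (x 1))"
    by (simp add: a_def stick_weight_def)
  finally show ?thesis by (simp add: add.commute)
qed

lemma stick_weight_nonneg:
  assumes "\<And>i. 1 \<le> i \<Longrightarrow> 0 \<le> v i \<and> v i \<le> 1" "1 \<le> n"
  shows "0 \<le> stick_weight v n"
  using assms by (auto simp: stick_weight_def intro!: mult_nonneg_nonneg prod_nonneg)

text \<open>Telescoping: each weight is the amount by which the remaining length drops.\<close>

lemma sum_stick_weight: "(\<Sum>n<N. stick_weight v (Suc n)) = 1 - (\<Prod>i\<in>{1..<Suc N}. 1 - v i)"
  by (induction N) (simp_all add: stick_weight_def algebra_simps)

text \<open>The partial sums of the weights are 1 minus a remaining length, hence at most 1. That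
  the weights sum to exactly 1 almost surely is a later result.\<close>

lemma stick_sum_le:
  assumes v: "\<And>i. 1 \<le> i \<Longrightarrow> 0 \<le> v i \<and> v i \<le> 1" and f: "\<And>y. f y \<le> K" and "0 \<le> K"
  shows "stick_sum f v x \<le> ennreal K"
  unfolding stick_sum_def
proof (rule suminf_le_const[OF summableI])
  fix N
  have w: "0 \<le> stick_weight v (Suc n)" for n using stick_weight_nonneg[OF v] by simp
  have "(\<Sum>n<N. ennreal (stick_weight v (Suc n)) * ennreal (f (x (Suc n))))
      \<le> (\<Sum>n<N. ennreal (stick_weight v (Suc n)) * ennreal K)"
    by (intro sum_mono mult_left_mono ennreal_leI f) auto
  also have "\<dots> = ennreal (\<Sum>n<N. stick_weight v (Suc n)) * ennreal K"
    using w by (simp add: sum_ennreal flip: sum_distrib_right)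
  also have "\<dots> \<le> 1 * ennreal K"
  proof (intro mult_right_mono)
    have "0 \<le> (\<Prod>i\<in>{1..<Suc N}. 1 - v i)" using v by (intro prod_nonneg) auto
    then show "ennreal (\<Sum>n<N. stick_weight v (Suc n)) \<le> 1"
      unfolding sum_stick_weight by simp
  qed auto
  finally show "(\<Sum>n<N. ennreal (stick_weight v (Suc n)) * ennreal (f (x (Suc n)))) \<le> ennreal K"
    by simp
qed

lemma measurable_stick_weight:
  assumes "\<And>n. 1 \<le> n \<Longrightarrow> v n \<in> borel_measurable N" "1 \<le> n"
  shows "(\<lambda>w. stick_weight (\<lambda>i. v i w) n) \<in> borel_measurable N"
  unfolding stick_weight_def
  by (intro borel_measurable_times borel_measurable_prod borel_measurable_diff
      borel_measurable_const assms) (use assms(2) in auto)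

lemma measurable_stick_sum:
  assumes [measurable]: "f \<in> borel_measurable borel"
    and v: "\<And>n. 1 \<le> n \<Longrightarrow> v n \<in> borel_measurable N"
    and x: "\<And>n. 1 \<le> n \<Longrightarrow> x n \<in> borel_measurable N"
  shows "(\<lambda>w. stick_sum f (\<lambda>n. v n w) (\<lambda>n. x n w)) \<in> borel_measurable N"
proof -
  have [measurable]: "(\<lambda>w. stick_weight (\<lambda>i. v i w) (Suc n)) \<in> borel_measurable N"
    "x (Suc n) \<in> borel_measurable N" for n
    by (auto intro: measurable_stick_weight v x)
  show ?thesis unfolding stick_sum_def by measurable
qed

text \<open>The measure of integration depends on \<open>w\<close>. Rewritten over the fixed space
  of indices, the dependence moves into the integrand, and measurability of parametrized integrals
  applies.\<close>

lemma measurable_integral_stick_breaking_measure: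
  fixes f :: "real \<Rightarrow> real"
  assumes [measurable]: "f \<in> borel_measurable borel"
    and v: "\<And>n. 1 \<le> n \<Longrightarrow> v n \<in> borel_measurable N"
    and x: "\<And>n. 1 \<le> n \<Longrightarrow> x n \<in> borel_measurable N"
  shows "(\<lambda>w. \<integral>y. f y \<partial>stick_breaking_measure (\<lambda>n. v n w) (\<lambda>n. x n w)) \<in> borel_measurable N"
proof -
  interpret C: sigma_finite_measure "count_space {1 :: nat..}"
    by (rule sigma_finite_measure_count_space_countable) simp
  have eq: "(\<integral>y. f y \<partial>stick_breaking_measure v x)
      = (\<integral>n. max 0 (stick_weight v n) * f (x n) \<partial>count_space {1..})" for v x :: "nat \<Rightarrow> real"
  proof -
    \<comment> \<open>A negative weight can occur when a stick lies outside the unit interval. As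
      \<open>ennreal\<close> cuts it off at 0, the measure is unchanged and the density becomes a
      nonnegative real function.\<close>
    have "density (count_space {1..}) (\<lambda>n. ennreal (stick_weight v n))
        = density (count_space {1..}) (\<lambda>n. ennreal (max 0 (stick_weight v n)))"
      by (simp add: ennreal_max_0)
    note density = this
    have "(\<integral>y. f y \<partial>stick_breaking_measure v x)
        = (\<integral>n. f (x n) \<partial>density (count_space {1..}) (\<lambda>n. ennreal (stick_weight v n)))"
      unfolding stick_breaking_measure_def by (rule integral_distr) auto
    also have "\<dots> = (\<integral>n. f (x n) \<partial>density (count_space {1..}) (\<lambda>n. ennreal (max 0 (stick_weight v n))))"
      by (simp only: density)
    also have "\<dots> = (\<integral>n. max 0 (stick_weight v n) *\<^sub>R f (x n) \<partial>count_space {1..})"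
      by (rule integral_density) auto
    finally show ?thesis by simp
  qed
  have "(\<lambda>p. max 0 (stick_weight (\<lambda>i. v i (snd p)) (fst p)) * f (x (fst p) (snd p)))
      \<in> borel_measurable (count_space {1..} \<Otimes>\<^sub>M N)"
  proof (rule measurable_pair_measure_countable1)
    fix n :: nat assume "n \<in> {1..}"
    then have [measurable]: "(\<lambda>w. stick_weight (\<lambda>i. v i w) n) \<in> borel_measurable N" "x n \<in> borel_measurable N"
      by (auto intro!: measurable_stick_weight v x)
    show "(\<lambda>y. max 0 (stick_weight (\<lambda>i. v i (snd (n, y))) (fst (n, y))) * f (x (fst (n, y)) (snd (n, y))))
        \<in> borel_measurable N"
      by simp
  qed simp
  then have "(\<lambda>p. max 0 (stick_weight (\<lambda>i. v i (fst p)) (snd p)) * f (x (snd p) (fst p)))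
      \<in> borel_measurable (N \<Otimes>\<^sub>M count_space {1..})"
    by (subst measurable_pair_swap_iff) (simp add: case_prod_beta)
  then show ?thesis
    unfolding eq by (intro C.borel_measurable_lebesgue_integral) (simp add: case_prod_beta)
qed

subsection \<open>Splitting off the first stick\<close>

text \<open>Serves the shift of the sticks and of the atoms by one index.\<close>

lemma (in prob_space) indep_vars_reindex:
  assumes ind: "indep_vars (\<lambda>_. N) X K" and inj: "inj_on h I" and h: "h ` I \<subseteq> K"
  shows "indep_vars (\<lambda>_. N) (\<lambda>i. X (h i)) I"
  unfolding indep_vars_def2
proof (intro conjI ballI indep_setsI)
  show X: "random_variable N (X (h i))" if "i \<in> I" for i
    using ind h that by (auto simp: indep_vars_def2)
  then show "{X (h i) -` A \<inter> space M |A. A \<in> sets N} \<subseteq> events" if "i \<in> I" for i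
    using that by (auto intro: measurable_sets)
  fix A J assume J: "J \<noteq> {}" "J \<subseteq> I" "finite J"
    and "\<forall>j\<in>J. A j \<in> {X (h j) -` A \<inter> space M |A. A \<in> sets N}"
  then obtain B where B: "\<And>j. j \<in> J \<Longrightarrow> A j = X (h j) -` B j \<inter> space M \<and> B j \<in> sets N"
    by (auto simp: Bex_def[symmetric] bchoice_iff dest!: bchoice) metis
  have inj': "inj_on h J" using inj J by (auto intro: inj_on_subset)
  define C where "C k = B (the_inv_into J h k)" for k
  have C: "C (h j) = B j" if "j \<in> J" for j
    using that inj' by (simp add: C_def the_inv_into_f_f)
  have "prob (\<Inter>j\<in>J. A j) = prob (\<Inter>k\<in>h ` J. X k -` C k \<inter> space M)"
    using B C by (simp add: image_image)
  also have "\<dots> = (\<Prod>k\<in>h ` J. prob (X k -` C k \<inter> space M))"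
  proof (intro indep_varsD[OF ind])
    show "h ` J \<subseteq> K" using h J by auto
  qed (use J B C in auto)
  also have "\<dots> = (\<Prod>j\<in>J. prob (A j))"
    using B C by (simp add: prod.reindex[OF inj'])
  finally show "prob (\<Inter>j\<in>J. A j) = (\<Prod>j\<in>J. prob (A j))" .
qed

lemma sets_PiM_Collect_finite_All:
  assumes "finite F" "F \<subseteq> L" "\<And>i. i \<in> F \<Longrightarrow> D i \<in> sets (N i)"
  shows "{r \<in> space (PiM L N). \<forall>i\<in>F. r i \<in> D i} \<in> sets (PiM L N)"
proof (rule sets.sets_Collect_finite_All)
  fix i assume i: "i \<in> F"
  have "{r \<in> space (PiM L N). r i \<in> D i} = (\<lambda>r. r i) -` D i \<inter> space (PiM L N)" by auto
  also have "\<dots> \<in> sets (PiM L N)"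
    using assms i by (intro measurable_sets[OF measurable_component_singleton]) auto
  finally show "{r \<in> space (PiM L N). r i \<in> D i} \<in> sets (PiM L N)" .
qed (rule assms)

text \<open>A finite joint event is the intersection of a cylinder event of the first sequence and
  one of the second. Independence of the sequences separates these two, and independence within each
  sequence does the rest. Merging the families makes blocks that mix sticks and atoms independent as
  soon as their index sets are disjoint.\<close>

lemma (in prob_space) indep_vars_case_sum:
  assumes X: "indep_vars (\<lambda>_. N) X I" and Y: "indep_vars (\<lambda>_. N) Y J"
    and XY: "indep_var (PiM I (\<lambda>_. N)) (\<lambda>w. \<lambda>i\<in>I. X i w) (PiM J (\<lambda>_. N)) (\<lambda>w. \<lambda>j\<in>J. Y j w)"
  shows "indep_vars (\<lambda>_. N) (case_sum X Y) (I <+> J)"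
  unfolding indep_vars_def2
proof (intro conjI ballI indep_setsI)
  show rv: "random_variable N (case_sum X Y i)" if "i \<in> I <+> J" for i
    using that X Y by (auto simp: indep_vars_def2)
  then show "{case_sum X Y i -` A \<inter> space M |A. A \<in> sets N} \<subseteq> events" if "i \<in> I <+> J" for i
    using that by (auto intro: measurable_sets)
  fix A K assume K: "K \<noteq> {}" "K \<subseteq> I <+> J" "finite K"
    and "\<forall>k\<in>K. A k \<in> {case_sum X Y k -` A \<inter> space M |A. A \<in> sets N}"
  then obtain B where B: "\<And>k. k \<in> K \<Longrightarrow> A k = case_sum X Y k -` B k \<inter> space M \<and> B k \<in> sets N"
    by (auto simp: Bex_def[symmetric] bchoice_iff dest!: bchoice) metis
  define KI where "KI = Inl -` K"
  define KJ where "KJ = Inr -` K"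
  have fin: "finite KI" "finite KJ" and sub: "KI \<subseteq> I" "KJ \<subseteq> J"
    and K_eq: "K = Inl ` KI \<union> Inr ` KJ"
    using K by (auto simp: KI_def KJ_def intro!: finite_vimageI)
  have BI: "B (Inl i) \<in> sets N" if "i \<in> KI" for i using B that by (auto simp: KI_def)
  have BJ: "B (Inr i) \<in> sets N" if "i \<in> KJ" for i using B that by (auto simp: KJ_def)
  define P where "P = {r \<in> space (PiM I (\<lambda>_. N)). \<forall>i\<in>KI. r i \<in> B (Inl i)}"
  define Q where "Q = {r \<in> space (PiM J (\<lambda>_. N)). \<forall>i\<in>KJ. r i \<in> B (Inr i)}"
  have [measurable]: "P \<in> sets (PiM I (\<lambda>_. N))" "Q \<in> sets (PiM J (\<lambda>_. N))"
    unfolding P_def Q_def using fin sub BI BJ by (auto intro!: sets_PiM_Collect_finite_All)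
  have rvX: "(\<lambda>w. \<lambda>i\<in>I. X i w) \<in> measurable M (PiM I (\<lambda>_. N))"
    and rvY: "(\<lambda>w. \<lambda>i\<in>J. Y i w) \<in> measurable M (PiM J (\<lambda>_. N))"
    using XY by (auto dest: indep_var_rv1 indep_var_rv2)
  have PX: "(\<lambda>w. \<lambda>i\<in>I. X i w) -` P \<inter> space M = {w \<in> space M. \<forall>i\<in>KI. X i w \<in> B (Inl i)}"
    using measurable_space[OF rvX] sub by (auto simp: P_def)
  have QY: "(\<lambda>w. \<lambda>i\<in>J. Y i w) -` Q \<inter> space M = {w \<in> space M. \<forall>i\<in>KJ. Y i w \<in> B (Inr i)}"
    using measurable_space[OF rvY] sub by (auto simp: Q_def)
  have pX: "prob {w \<in> space M. \<forall>i\<in>KI. X i w \<in> B (Inl i)} = (\<Prod>i\<in>KI. prob (A (Inl i)))"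
  proof (cases "KI = {}")
    case False
    then have "{w \<in> space M. \<forall>i\<in>KI. X i w \<in> B (Inl i)} = (\<Inter>i\<in>KI. X i -` B (Inl i) \<inter> space M)" by auto
    also have "prob \<dots> = (\<Prod>i\<in>KI. prob (X i -` B (Inl i) \<inter> space M))"
      using False fin sub BI by (intro indep_varsD[OF X]) auto
    also have "\<dots> = (\<Prod>i\<in>KI. prob (A (Inl i)))"
      using B by (intro prod.cong) (auto simp: KI_def)
    finally show ?thesis .
  qed (simp add: prob_space)
  have pY: "prob {w \<in> space M. \<forall>i\<in>KJ. Y i w \<in> B (Inr i)} = (\<Prod>i\<in>KJ. prob (A (Inr i)))"
  proof (cases "KJ = {}")
    case False
    then have "{w \<in> space M. \<forall>i\<in>KJ. Y i w \<in> B (Inr i)} = (\<Inter>i\<in>KJ. Y i -` B (Inr i) \<inter> space M)" by auto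
    also have "prob \<dots> = (\<Prod>i\<in>KJ. prob (Y i -` B (Inr i) \<inter> space M))"
      using False fin sub BJ by (intro indep_varsD[OF Y]) auto
    also have "\<dots> = (\<Prod>i\<in>KJ. prob (A (Inr i)))"
      using B by (intro prod.cong) (auto simp: KJ_def)
    finally show ?thesis .
  qed (simp add: prob_space)
  have "(\<Inter>k\<in>K. A k) = (\<Inter>k\<in>K. case_sum X Y k -` B k \<inter> space M)"
    using B by (intro INF_cong) auto
  also have "\<dots> = (\<lambda>w. (\<lambda>i\<in>I. X i w, \<lambda>i\<in>J. Y i w)) -` (P \<times> Q) \<inter> space M"
  proof -
    have "(\<lambda>w. (\<lambda>i\<in>I. X i w, \<lambda>i\<in>J. Y i w)) -` (P \<times> Q) \<inter> space M
        = ((\<lambda>w. \<lambda>i\<in>I. X i w) -` P \<inter> space M) \<inter> ((\<lambda>w. \<lambda>i\<in>J. Y i w) -` Q \<inter> space M)" by auto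
    then show ?thesis unfolding PX QY using K(1) unfolding K_eq by (auto simp: ball_Un)
  qed
  also have "prob \<dots> = (\<Prod>i\<in>KI. prob (A (Inl i))) * (\<Prod>i\<in>KJ. prob (A (Inr i)))"
    by (subst indep_varD[OF XY]) (auto simp: PX QY pX pY)
  also have "\<dots> = (\<Prod>k\<in>K. prob (A k))"
    unfolding K_eq using fin by (subst prod.union_disjoint) (auto simp: prod.reindex)
  finally show "prob (\<Inter>k\<in>K. A k) = (\<Prod>k\<in>K. prob (A k))" .
qed

text \<open>Fubini for the joint law, which is a product by independence. Only the first block is
  replaced by its law, while the second stays a random variable on \<open>M\<close>, so that a
  further block can be split off from it.\<close>

lemma (in prob_space) nn_integral_indep_blocks:
  assumes ind: "indep_var S X T Y" and a: "a \<in> measurable S A" and b: "b \<in> measurable T B"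
    and F: "F \<in> borel_measurable (A \<Otimes>\<^sub>M B)"
  shows "(\<integral>\<^sup>+w. F (a (X w), b (Y w)) \<partial>M)
    = (\<integral>\<^sup>+w. (\<integral>\<^sup>+u. F (u, b (Y w)) \<partial>distr M A (\<lambda>w. a (X w))) \<partial>M)"
proof -
  have X [measurable]: "X \<in> measurable M S" and Y [measurable]: "Y \<in> measurable M T"
    using ind by (auto dest: indep_var_rv1 indep_var_rv2)
  note [measurable] = a b F
  interpret X: prob_space "distr M S X" by (rule prob_space_distr) fact
  interpret Y: prob_space "distr M T Y" by (rule prob_space_distr) fact
  interpret XY: pair_sigma_finite "distr M S X" "distr M T Y" ..
  have "(\<integral>\<^sup>+w. F (a (X w), b (Y w)) \<partial>M)
      = (\<integral>\<^sup>+p. F (a (fst p), b (snd p)) \<partial>distr M (S \<Otimes>\<^sub>M T) (\<lambda>w. (X w, Y w)))"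
    by (subst nn_integral_distr) simp_all
  also have "\<dots> = (\<integral>\<^sup>+p. F (a (fst p), b (snd p)) \<partial>(distr M S X \<Otimes>\<^sub>M distr M T Y))"
    using ind unfolding indep_var_distribution_eq by simp
  also have "\<dots> = (\<integral>\<^sup>+y. (\<integral>\<^sup>+x. F (a x, b y) \<partial>distr M S X) \<partial>distr M T Y)"
    by (subst XY.nn_integral_snd[symmetric]) simp_all
  also have "\<dots> = (\<integral>\<^sup>+w. (\<integral>\<^sup>+x. F (a x, b (Y w)) \<partial>distr M S X) \<partial>M)"
    by (subst nn_integral_distr) simp_all
  also have "\<dots> = (\<integral>\<^sup>+w. (\<integral>\<^sup>+u. F (u, b (Y w)) \<partial>distr M A (\<lambda>w. a (X w))) \<partial>M)"
  proof (rule nn_integral_cong)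
    fix w assume "w \<in> space M"
    then have [simp]: "b (Y w) \<in> space B"
      using measurable_space[OF b] measurable_space[OF Y] by blast
    show "(\<integral>\<^sup>+x. F (a x, b (Y w)) \<partial>distr M S X) = (\<integral>\<^sup>+u. F (u, b (Y w)) \<partial>distr M A (\<lambda>w. a (X w)))"
      by (subst (1 2) nn_integral_distr) simp_all
  qed
  finally show ?thesis .
qed

context pitman_yor
begin

lemma random_stick [measurable]: "1 \<le> n \<Longrightarrow> V n \<in> borel_measurable M"
  using sticks_indep by (auto simp: indep_vars_def2)

lemma random_atom [measurable]: "1 \<le> n \<Longrightarrow> \<xi> n \<in> borel_measurable M"
  using atoms_indep by (auto simp: indep_vars_def2)

lemma AE_sticks: "AE w in M. \<forall>n\<ge>1. 0 < V n w \<and> V n w < 1"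
proof -
  have "AE w in M. 1 \<le> n \<longrightarrow> 0 < V n w \<and> V n w < 1" for n
  proof (cases "1 \<le> n")
    case True
    have "AE r in distr M borel (V n). 0 < r \<and> r < 1"
      unfolding sticks_law[OF True] by (rule AE_beta_distribution)
    then show ?thesis using random_stick[OF True] by (subst (asm) AE_distr_iff) auto
  qed simp
  then show ?thesis by (simp add: AE_all_countable)
qed

lemma shift: "pitman_yor M \<alpha> (\<theta> + \<alpha>) G (\<lambda>n. V (Suc n)) (\<lambda>n. \<xi> (Suc n))"
proof -
  \<comment> \<open>The shift as a measurable map of sequences: applied to both sides it preserves
    the independence of sticks and atoms.\<close>
  define T :: "(nat \<Rightarrow> real) \<Rightarrow> nat \<Rightarrow> real" where "T r = (\<lambda>n\<in>{1..}. r (Suc n))" for r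
  have T: "T \<in> measurable (PiM {1..} (\<lambda>_. borel)) (PiM {1..} (\<lambda>_. borel))"
    unfolding T_def by (intro measurable_restrict measurable_component_singleton) auto
  have T_restrict: "T \<circ> (\<lambda>w. \<lambda>n\<in>{1..}. X n w) = (\<lambda>w. \<lambda>n\<in>{1..}. X (Suc n) w)" for X :: "nat \<Rightarrow> 'w \<Rightarrow> real"
    by (auto simp: T_def fun_eq_iff)
  show ?thesis
  proof (intro pitman_yor.intro pitman_yor_axioms.intro)
    show "indep_vars (\<lambda>_. borel) (\<lambda>n. V (Suc n)) {1..}"
      by (rule indep_vars_reindex[OF sticks_indep]) auto
    show "indep_vars (\<lambda>_. borel) (\<lambda>n. \<xi> (Suc n)) {1..}"
      by (rule indep_vars_reindex[OF atoms_indep]) auto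
    show "indep_var (PiM {1..} (\<lambda>_. borel)) (\<lambda>w. \<lambda>n\<in>{1..}. V (Suc n) w)
        (PiM {1..} (\<lambda>_. borel)) (\<lambda>w. \<lambda>n\<in>{1..}. \<xi> (Suc n) w)"
      using indep_var_compose[OF sticks_atoms_indep T T] by (simp only: T_restrict)
    show "distr M borel (V (Suc n)) = beta_distribution (1 - \<alpha>) (\<theta> + \<alpha> + real n * \<alpha>)" if "1 \<le> n" for n
      using sticks_law[of "Suc n"] by (simp add: algebra_simps)
    show "distr M borel (\<xi> (Suc n)) = G" if "1 \<le> n" for n
      by (rule atoms_law) simp
    show "- \<alpha> < \<theta> + \<alpha>" using parameters by linarith
  qed (rule parameters base_prob sets_base prob_space_axioms)+
qed

lemma indep_sticks_atoms: "indep_vars (\<lambda>_. borel) (case_sum V \<xi>) ({1..} <+> {1..})"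
  by (rule indep_vars_case_sum[OF sticks_indep atoms_indep sticks_atoms_indep])

text \<open>The first stick is integrated out against the block of everything else, then the first
  atom against the block of all later sticks and atoms. Two sums of the remainder are carried along
  because the variance depends on two integrals; the recursion for a single mean uses the same sum
  twice.\<close>

lemma nn_integral_first_stick:
  assumes [measurable]: "f \<in> borel_measurable borel" "g \<in> borel_measurable borel"
    and F [measurable]: "F \<in> borel_measurable (borel \<Otimes>\<^sub>M (borel \<Otimes>\<^sub>M (borel \<Otimes>\<^sub>M borel)))"
  shows "(\<integral>\<^sup>+w. F (V 1 w, \<xi> 1 w, stick_sum f (\<lambda>n. V (Suc n) w) (\<lambda>n. \<xi> (Suc n) w),
        stick_sum g (\<lambda>n. V (Suc n) w) (\<lambda>n. \<xi> (Suc n) w)) \<partial>M)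
    = (\<integral>\<^sup>+w. (\<integral>\<^sup>+x. (\<integral>\<^sup>+v. F (v, x, stick_sum f (\<lambda>n. V (Suc n) w) (\<lambda>n. \<xi> (Suc n) w),
        stick_sum g (\<lambda>n. V (Suc n) w) (\<lambda>n. \<xi> (Suc n) w)) \<partial>beta_distribution (1 - \<alpha>) (\<theta> + \<alpha>)) \<partial>G) \<partial>M)"
proof -
  let ?E = "borel \<Otimes>\<^sub>M borel :: (ennreal \<times> ennreal) measure"
  define q where "q r = (stick_sum f (\<lambda>n. r (Inl (Suc n))) (\<lambda>n. r (Inr (Suc n))),
      stick_sum g (\<lambda>n. r (Inl (Suc n))) (\<lambda>n. r (Inr (Suc n))))" for r :: "nat + nat \<Rightarrow> real"
  define Q where "Q w = (stick_sum f (\<lambda>n. V (Suc n) w) (\<lambda>n. \<xi> (Suc n) w),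
        stick_sum g (\<lambda>n. V (Suc n) w) (\<lambda>n. \<xi> (Suc n) w))" for w
  \<comment> \<open>\<open>T\<close> holds the indices from 2 on, of sticks (\<open>Inl\<close>) and
    of atoms (\<open>Inr\<close>). The sums of the shifted sequences see only these
    coordinates.\<close>
  define T :: "(nat + nat) set" where "T = {2..} <+> {2..}"
  have mem: "Inl (Suc i) \<in> L" "Inr (Suc i) \<in> L" if "T \<subseteq> L" "1 \<le> i" for L i
    using that by (auto simp: T_def)
  have q: "q \<in> measurable (PiM L (\<lambda>_. borel)) ?E" if "T \<subseteq> L" for L
    unfolding q_def using that
    by (intro measurable_Pair measurable_stick_sum measurable_component_singleton assms)
       (use mem[OF that] in simp_all)
  have qQ: "q (restrict (\<lambda>i. case_sum V \<xi> i w) L) = Q w" if "T \<subseteq> L" for L w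
    unfolding q_def Q_def using that
    by (auto intro!: stick_sum_cong simp: mem)
  have [measurable_cong]: "sets G = sets borel" by (rule sets_base)
  interpret B: prob_space "beta_distribution (1 - \<alpha>) (\<theta> + \<alpha>)"
    using parameters by (intro prob_space_beta_distribution) auto
  define H where "H p = (\<integral>\<^sup>+v. F (v, p) \<partial>beta_distribution (1 - \<alpha>) (\<theta> + \<alpha>))" for p
  have H [measurable]: "H \<in> borel_measurable (borel \<Otimes>\<^sub>M ?E)"
    unfolding H_def by measurable
  define R where "R L w = restrict (\<lambda>i. case_sum V \<xi> i w) L" for L w
  define A B C :: "(nat + nat) set" where "A = {Inl 1}" and "B = insert (Inr 1) T" and "C = {Inr 1}"
  have R: "R A w (Inl 1) = V 1 w" "R B w (Inr 1) = \<xi> 1 w" "R C w (Inr 1) = \<xi> 1 w"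
      "q (R B w) = Q w" "q (R T w) = Q w" for w
    unfolding R_def by (auto simp: A_def B_def C_def intro!: qQ)
  have indep: "indep_var (PiM L (\<lambda>_. borel)) (R L) (PiM L' (\<lambda>_. borel)) (R L')"
    if "L \<inter> L' = {}" "L \<subseteq> {1..} <+> {1..}" "L' \<subseteq> {1..} <+> {1..}" for L L'
    unfolding R_def by (rule indep_var_restrict[OF indep_sticks_atoms that])
  have "(\<integral>\<^sup>+w. F (V 1 w, \<xi> 1 w, Q w) \<partial>M) = (\<integral>\<^sup>+w. F (R A w (Inl 1), (\<lambda>r. (r (Inr 1), q r)) (R B w)) \<partial>M)"
    unfolding R ..
  also have "\<dots> = (\<integral>\<^sup>+w. (\<integral>\<^sup>+v. F (v, (\<lambda>r. (r (Inr 1), q r)) (R B w))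
      \<partial>distr M borel (\<lambda>w. R A w (Inl 1))) \<partial>M)"
  proof (rule nn_integral_indep_blocks[of "PiM A (\<lambda>_. borel)" "R A" "PiM B (\<lambda>_. borel)" "R B"
        "\<lambda>r. r (Inl 1)" borel "\<lambda>r. (r (Inr 1), q r)" "borel \<Otimes>\<^sub>M ?E" F])
    show "indep_var (PiM A (\<lambda>_. borel)) (R A) (PiM B (\<lambda>_. borel)) (R B)"
      by (rule indep) (auto simp: A_def B_def T_def)
    show "(\<lambda>r. r (Inl 1)) \<in> measurable (PiM A (\<lambda>_. borel)) borel"
      by (rule measurable_component_singleton) (simp add: A_def)
    show "(\<lambda>r. (r (Inr 1), q r)) \<in> measurable (PiM B (\<lambda>_. borel)) (borel \<Otimes>\<^sub>M ?E)"
      by (intro measurable_Pair q measurable_component_singleton) (auto simp: B_def)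
  qed (rule F)
  also have "\<dots> = (\<integral>\<^sup>+w. H (\<xi> 1 w, Q w) \<partial>M)"
    unfolding R H_def using sticks_law[of 1] by simp
  also have "\<dots> = (\<integral>\<^sup>+w. H (R C w (Inr 1), q (R T w)) \<partial>M)"
    unfolding R ..
  also have "\<dots> = (\<integral>\<^sup>+w. (\<integral>\<^sup>+x. H (x, q (R T w)) \<partial>distr M borel (\<lambda>w. R C w (Inr 1))) \<partial>M)"
  proof (rule nn_integral_indep_blocks[of "PiM C (\<lambda>_. borel)" "R C" "PiM T (\<lambda>_. borel)" "R T"
        "\<lambda>r. r (Inr 1)" borel q ?E H])
    show "indep_var (PiM C (\<lambda>_. borel)) (R C) (PiM T (\<lambda>_. borel)) (R T)"
      by (rule indep) (auto simp: C_def T_def)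
    show "(\<lambda>r. r (Inr 1)) \<in> measurable (PiM C (\<lambda>_. borel)) borel"
      by (rule measurable_component_singleton) (simp add: C_def)
    show "q \<in> measurable (PiM T (\<lambda>_. borel)) ?E" by (rule q) simp
  qed (rule H)
  also have "\<dots> = (\<integral>\<^sup>+w. (\<integral>\<^sup>+x. H (x, Q w) \<partial>G) \<partial>M)"
    unfolding R using atoms_law[of 1] by simp
  finally show ?thesis unfolding H_def Q_def .
qed

end

subsection \<open>The Markov-Krein identity\<close>

lemma Beta_1_right: "0 < \<theta> \<Longrightarrow> Beta \<theta> 1 = 1 / (\<theta> :: real)"
proof -
  assume "0 < \<theta>"
  then have "Gamma (\<theta> + 1) = \<theta> * Gamma \<theta>" "0 < Gamma \<theta>"
    by (auto intro!: Gamma_plus1 Gamma_real_pos simp: nonpos_Ints_def)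
  then show ?thesis by (simp add: Beta_def)
qed

text \<open>This mean is the factor gained in each step of the recursion.\<close>

lemma integral_beta_distribution_1:
  assumes "0 < \<theta>"
  shows "(\<integral>u. u \<partial>beta_distribution \<theta> 1) = \<theta> / (\<theta> + 1)"
proof -
  have "(\<integral>\<^sup>+u. ennreal u \<partial>beta_distribution \<theta> 1) = ennreal \<theta> *
      (\<integral>\<^sup>+u. ennreal (indicator {0<..<1} u * (u powr (\<theta> + 1 - 1) * (1 - u) powr (1 - 1))) \<partial>lborel)"
    using assms by (subst nn_integral_beta_distribution_Beta)
      (auto intro!: arg_cong[where f = "\<lambda>x. _ * x"] nn_integral_cong
        simp: Beta_1_right indicator_def powr_mult_base mult.commute simp flip: ennreal_mult)
  also have "\<dots> = ennreal (\<theta> / (\<theta> + 1))"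
    using assms by (subst nn_integral_Beta_kernel) (auto simp: Beta_1_right simp flip: ennreal_mult)
  finally show ?thesis
    using AE_beta_distribution[of \<theta> 1] assms
    by (subst integral_eq_nn_integral) (auto elim: eventually_mono)
qed

text \<open>Up to the density of Beta(\<theta>, 1) the integrand is the derivative of \<open>w u = u
  powr \<theta> * \<phi> (u * l) powr (- \<theta> / \<alpha>)\<close>, whose boundary values are 0
  and the right-hand side. Finite sums allow \<phi> to be differentiated term by term; they are the
  form that integrals of simple functions take.\<close>

lemma nn_integral_beta_distribution_1_sum_powr:
  fixes c :: "real \<Rightarrow> real"
  assumes "0 < \<alpha>" "0 < \<theta>" "0 \<le> l" and H: "finite H" "\<And>y. y \<in> H \<Longrightarrow> 0 \<le> y"
    and c: "\<And>y. y \<in> H \<Longrightarrow> 0 \<le> c y" "sum c H = 1"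
  defines "\<phi> \<equiv> \<lambda>s. \<Sum>y\<in>H. c y * (1 + s * y) powr \<alpha>"
    and "\<gamma> \<equiv> \<lambda>s. \<Sum>y\<in>H. c y * (1 + s * y) powr (\<alpha> - 1)"
  shows "(\<integral>\<^sup>+u. ennreal (\<gamma> (u * l) * \<phi> (u * l) powr (- (\<theta> + \<alpha>) / \<alpha>)) \<partial>beta_distribution \<theta> 1)
    = ennreal (\<phi> l powr (- \<theta> / \<alpha>))"
proof -
  define w where "w u = u powr \<theta> * \<phi> (u * l) powr (- \<theta> / \<alpha>)" for u
  define w' where "w' u = \<theta> * u powr (\<theta> - 1) * (\<gamma> (u * l) * \<phi> (u * l) powr (- (\<theta> + \<alpha>) / \<alpha>))" for u
  have \<phi>_pos: "0 < \<phi> s" if "0 \<le> s" for s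
  proof -
    have "sum c H \<le> \<phi> s"
      unfolding \<phi>_def
    proof (intro sum_mono)
      fix y assume y: "y \<in> H"
      have "1 \<le> (1 + s * y) powr \<alpha>" using assms that y by (intro ge_one_powr_ge_zero) auto
      then have "c y * 1 \<le> c y * (1 + s * y) powr \<alpha>" using c y by (intro mult_left_mono) auto
      then show "c y \<le> c y * (1 + s * y) powr \<alpha>" by simp
    qed
    then show ?thesis using c by simp
  qed
  have \<gamma>_nonneg: "0 \<le> \<gamma> s" for s
    unfolding \<gamma>_def using c by (intro sum_nonneg) auto
  have deriv_\<phi>: "(\<phi> has_real_derivative (\<Sum>y\<in>H. c y * (\<alpha> * (1 + s * y) powr (\<alpha> - 1) * y))) (at s)"
    if "0 \<le> s" for s
    unfolding \<phi>_def using H that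
    by (intro DERIV_sum DERIV_cmult DERIV_chain2[OF has_real_derivative_powr])
       (auto intro!: derivative_eq_intros add_pos_nonneg)
  have deriv: "(w has_real_derivative w' u) (at u)" if u: "u \<in> {0<..<1}" for u
  proof -
    define S where "S = (\<Sum>y\<in>H. c y * (\<alpha> * (1 + u * l * y) powr (\<alpha> - 1) * y))"
    have s: "0 \<le> u * l" using u assms by simp
    have "((\<lambda>u. \<phi> (u * l)) has_real_derivative S * l) (at u)"
      unfolding S_def by (rule DERIV_chain2[where f = \<phi> and g = "\<lambda>u. u * l", OF deriv_\<phi>[OF s]]) (auto intro!: derivative_eq_intros)
    then have "((\<lambda>u. \<phi> (u * l) powr (- \<theta> / \<alpha>)) has_real_derivative
        - \<theta> / \<alpha> * \<phi> (u * l) powr (- \<theta> / \<alpha> - 1) * (S * l)) (at u)"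
      by (rule DERIV_chain2[where f = "\<lambda>z. z powr (- \<theta> / \<alpha>)" and g = "\<lambda>u. \<phi> (u * l)",
          OF has_real_derivative_powr[OF \<phi>_pos[OF s]]])
    then have "(w has_real_derivative \<theta> * u powr (\<theta> - 1) * \<phi> (u * l) powr (- \<theta> / \<alpha>)
        + (- \<theta> / \<alpha> * \<phi> (u * l) powr (- \<theta> / \<alpha> - 1) * (S * l)) * u powr \<theta>) (at u)"
      unfolding w_def using u by (intro DERIV_mult has_real_derivative_powr) auto
    moreover have e1: "\<phi> (u * l) powr (- \<theta> / \<alpha>) = \<phi> (u * l) powr (- \<theta> / \<alpha> - 1) * \<phi> (u * l)"
      using \<phi>_pos[OF s] by (simp add: powr_diff)
    moreover have e2: "u powr \<theta> = u powr (\<theta> - 1) * u" using u by (simp add: powr_diff)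
    \<comment> \<open>The relation \<phi>(s) = \<gamma>(s) + s \<phi>'(s) / \<alpha>, which comes
      from splitting off one factor 1 + s y from its power \<alpha>. It makes the two terms of the
      product rule combine.\<close>
    moreover have e3: "\<phi> (u * l) = \<gamma> (u * l) + u * l * S / \<alpha>"
    proof -
      have "c y * (1 + u * l * y) powr \<alpha>
          = c y * (1 + u * l * y) powr (\<alpha> - 1) + u * l * (c y * (\<alpha> * (1 + u * l * y) powr (\<alpha> - 1) * y)) / \<alpha>"
        if "y \<in> H" for y
      proof -
        have "0 < 1 + u * l * y" using H(2)[OF that] s by (simp add: add_pos_nonneg)
        then have "(1 + u * l * y) powr \<alpha> = (1 + u * l * y) powr (\<alpha> - 1) * (1 + u * l * y)"
          by (simp add: powr_diff)
        then show ?thesis using assms by (simp add: algebra_simps)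
      qed
      then show ?thesis
        unfolding \<phi>_def \<gamma>_def S_def by (simp add: sum.distrib sum_distrib_left sum_divide_distrib)
    qed
    moreover have e4: "- (\<theta> + \<alpha>) / \<alpha> = - \<theta> / \<alpha> - 1" using assms by (simp add: field_simps)
    moreover have "\<theta> * A * (P * (g + u * l * S / \<alpha>)) + (- \<theta> / \<alpha> * P * (S * l)) * (A * u) = \<theta> * A * (g * P)"
      for A P g by (simp add: algebra_simps)
    moreover have "\<phi> (u * l) powr (- \<theta> / \<alpha>) = \<phi> (u * l) powr (- \<theta> / \<alpha> - 1) * (\<gamma> (u * l) + u * l * S / \<alpha>)"
      using e1 by (simp only: e3[symmetric])
    ultimately show ?thesis unfolding w'_def e4 by (simp only:)
  qed
  have cont: "continuous_on {0..1} w"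
  proof -
    have "1 + u * l * y \<noteq> 0" if "u \<in> {0..1}" "y \<in> H" for u y
    proof -
      have "0 \<le> u * l * y" using that assms by simp
      then show ?thesis by linarith
    qed
    then have "continuous_on {0..1} (\<lambda>u. \<phi> (u * l))"
      unfolding \<phi>_def by (intro continuous_intros) auto
    moreover have "0 < \<phi> (u * l)" if "u \<in> {0..1}" for u
      using that assms by (intro \<phi>_pos) auto
    ultimately show ?thesis
      unfolding w_def using assms
      by (intro continuous_on_mult continuous_on_powr' continuous_on_id continuous_on_const)
         (auto dest: less_imp_le simp: less_le)
  qed
  \<comment> \<open>For \<theta> < 1 the function \<open>w\<close> need not be differentiable at 0,
    hence the version of the theorem that asks for derivatives in the interior and continuity on the
    closed interval.\<close>
  have "(w' has_integral (w 1 - w 0)) {0..1}"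
    using deriv by (intro fundamental_theorem_of_calculus_interior cont)
      (auto simp: has_real_derivative_iff_has_vector_derivative)
  then have int: "(w' has_integral (\<phi> l powr (- \<theta> / \<alpha>))) {0<..<1}"
    by (simp add: has_integral_Icc_iff_Ioo w_def)
  have [measurable]: "\<phi> \<in> borel_measurable borel" "\<gamma> \<in> borel_measurable borel"
    unfolding \<phi>_def \<gamma>_def by measurable
  have "(\<integral>\<^sup>+u. ennreal (\<gamma> (u * l) * \<phi> (u * l) powr (- (\<theta> + \<alpha>) / \<alpha>)) \<partial>beta_distribution \<theta> 1)
      = (\<integral>\<^sup>+u. ennreal \<theta> * (ennreal (indicator {0<..<1} u * (u powr (\<theta> - 1) * (1 - u) powr (1 - 1)))
        * ennreal (\<gamma> (u * l) * \<phi> (u * l) powr (- (\<theta> + \<alpha>) / \<alpha>))) \<partial>lborel)"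
    using assms(2) by (subst nn_integral_beta_distribution_Beta) (auto simp: Beta_1_right nn_integral_cmult)
  also have "\<dots> = (\<integral>\<^sup>+u. ennreal (indicator {0<..<1} u * w' u) \<partial>lborel)"
    using assms(2) \<gamma>_nonneg
    by (intro nn_integral_cong) (auto simp: w'_def indicator_def mult.assoc simp flip: ennreal_mult)
  also have "\<dots> = ennreal (\<phi> l powr (- \<theta> / \<alpha>))"
    using int \<gamma>_nonneg assms(2) by (subst nn_integral_eq_iff_has_integral) (auto simp: w'_def)
  finally show ?thesis .
qed

lemma integral_simple_function_comp:
  fixes h F :: "real \<Rightarrow> real"
  assumes G: "prob_space G" "sets G = sets borel" and h: "simple_function borel h"
  shows "(\<integral>x. F (h x) \<partial>G) = (\<Sum>y\<in>range h. measure G (h -` {y}) * F y)"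
proof -
  interpret G: prob_space G by (rule G)
  have space: "space G = UNIV" using sets_eq_imp_space_eq[OF G(2)] by simp
  have fin: "finite (range h)" and vimage: "h -` {y} \<in> sets G" for y
    using simple_functionD(1)[OF h] simple_functionD(2)[OF h, of "{y}"] G by auto
  have "(\<integral>x. F (h x) \<partial>G) = (\<integral>x. (\<Sum>y\<in>range h. F y * indicator (h -` {y}) x) \<partial>G)"
  proof (intro Bochner_Integration.integral_cong refl)
    fix x
    have "(\<Sum>y\<in>range h. F y * indicator (h -` {y}) x) = (\<Sum>y\<in>range h. if y = h x then F y else 0)"
      by (intro sum.cong) (auto simp: indicator_def)
    then show "F (h x) = (\<Sum>y\<in>range h. F y * indicator (h -` {y}) x)" using fin by simp
  qed
  also have "\<dots> = (\<Sum>y\<in>range h. (\<integral>x. F y * indicator (h -` {y}) x \<partial>G))"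
    using vimage by (intro Bochner_Integration.integral_sum integrable_mult_right)
      (simp add: G.emeasure_eq_measure)
  also have "\<dots> = (\<Sum>y\<in>range h. measure G (h -` {y}) * F y)"
    using vimage space by (simp add: mult.commute)
  finally show ?thesis .
qed

text \<open>An infinite sum is sent to 0 by \<open>enn2real\<close>; for unbounded f that event has
  to be treated separately until it is known to be null.\<close>

definition (in pitman_yor) stick_mean :: "(real \<Rightarrow> real) \<Rightarrow> 'w \<Rightarrow> real" where
  "stick_mean f w = enn2real (stick_sum f (\<lambda>n. V n w) (\<lambda>n. \<xi> n w))"

context pitman_yor
begin

lemma measurable_stick_sum_process [measurable]:
  "f \<in> borel_measurable borel \<Longrightarrow> (\<lambda>w. stick_sum f (\<lambda>n. V n w) (\<lambda>n. \<xi> n w)) \<in> borel_measurable M"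
  by (intro measurable_stick_sum random_stick random_atom)

lemma measurable_stick_sum_process_Suc [measurable]:
  "f \<in> borel_measurable borel \<Longrightarrow>
    (\<lambda>w. stick_sum f (\<lambda>n. V (Suc n) w) (\<lambda>n. \<xi> (Suc n) w)) \<in> borel_measurable M"
  by (intro measurable_stick_sum random_stick random_atom) auto

lemma measurable_stick_mean [measurable]:
  "f \<in> borel_measurable borel \<Longrightarrow> stick_mean f \<in> borel_measurable M"
  unfolding stick_mean_def by measurable

text \<open>The law of the first stick has parameters 1 - \<alpha> and \<theta> + \<alpha>, which
  add up to \<theta> + 1, whereas the exponent is \<theta>. The auxiliary Beta(\<theta>, 1) variable
  u raises the exponent to \<theta> + 1 at the price of replacing l by u l. Then the linear power
  identity integrates out the stick and separates the first atom from the remainder.\<close>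

lemma nn_integral_stick_sum_powr:
  assumes h [measurable]: "h \<in> borel_measurable borel" and hK: "\<And>x. 0 \<le> h x" "\<And>x. h x \<le> K"
    and l: "0 \<le> l" and \<theta>: "0 < \<theta>"
  shows "(\<integral>\<^sup>+w. ennreal ((1 + l * enn2real (stick_sum h (\<lambda>n. V n w) (\<lambda>n. \<xi> n w))) powr (- \<theta>)) \<partial>M)
    = (\<integral>\<^sup>+u. (\<integral>\<^sup>+x. ennreal ((1 + u * l * h x) powr (\<alpha> - 1)) \<partial>G) *
        (\<integral>\<^sup>+w. ennreal ((1 + u * l * enn2real (stick_sum h (\<lambda>n. V (Suc n) w) (\<lambda>n. \<xi> (Suc n) w)))
          powr (- (\<theta> + \<alpha>))) \<partial>M) \<partial>beta_distribution \<theta> 1)"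
proof -
  have [measurable_cong]: "sets G = sets borel" by (rule sets_base)
  define y where "y w = enn2real (stick_sum h (\<lambda>n. V n w) (\<lambda>n. \<xi> n w))" for w
  define y' where "y' w = enn2real (stick_sum h (\<lambda>n. V (Suc n) w) (\<lambda>n. \<xi> (Suc n) w))" for w
  have [measurable]: "y \<in> borel_measurable M" "y' \<in> borel_measurable M"
    unfolding y_def y'_def by measurable
  have nonneg: "0 \<le> y w" "0 \<le> y' w" for w by (simp_all add: y_def y'_def)
  have rec: "AE w in M. y w = V 1 w * h (\<xi> 1 w) + (1 - V 1 w) * y' w"
    using AE_sticks
  proof eventually_elim
    case (elim w)
    have "stick_sum h (\<lambda>n. V (Suc n) w) (\<lambda>n. \<xi> (Suc n) w) \<le> ennreal K"
      using elim hK order.trans[OF hK(1) hK(2)] by (intro stick_sum_le) (auto intro: less_imp_le)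
    then have fin: "stick_sum h (\<lambda>n. V (Suc n) w) (\<lambda>n. \<xi> (Suc n) w) = ennreal (y' w)"
      unfolding y'_def by (intro ennreal_enn2real[symmetric]) (auto intro: le_less_trans)
    have "stick_sum h (\<lambda>n. V n w) (\<lambda>n. \<xi> n w)
        = ennreal (V 1 w) * ennreal (h (\<xi> 1 w)) + ennreal (1 - V 1 w) * ennreal (y' w)"
      using elim by (subst stick_sum_Suc) (auto simp: fin less_imp_le)
    also have "\<dots> = ennreal (V 1 w * h (\<xi> 1 w) + (1 - V 1 w) * y' w)"
      using elim hK(1) nonneg by (subst ennreal_plus) (auto simp: ennreal_mult less_imp_le)
    finally have ss: "stick_sum h (\<lambda>n. V n w) (\<lambda>n. \<xi> n w)
        = ennreal (V 1 w * h (\<xi> 1 w) + (1 - V 1 w) * y' w)" .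
    have "0 \<le> V 1 w * h (\<xi> 1 w) + (1 - V 1 w) * y' w"
      using elim hK(1) nonneg by (auto simp: less_imp_le)
    then show ?case unfolding y_def ss by (rule enn2real_ennreal)
  qed
  interpret U: prob_space "beta_distribution \<theta> 1"
    using \<theta> by (intro prob_space_beta_distribution) auto
  interpret UM: pair_prob_space "beta_distribution \<theta> 1" M ..
  have "(\<integral>\<^sup>+w. ennreal ((1 + l * y w) powr (- \<theta>)) \<partial>M)
      = (\<integral>\<^sup>+w. (\<integral>\<^sup>+u. ennreal ((u * (1 + l * y w) + (1 - u) * 1) powr (- (\<theta> + 1))) \<partial>beta_distribution \<theta> 1) \<partial>M)"
    using l nonneg \<theta> by (subst nn_integral_beta_distribution_linear_powr) (auto simp: add_pos_nonneg)
  also have "\<dots> = (\<integral>\<^sup>+u. (\<integral>\<^sup>+w. ennreal ((u * (1 + l * y w) + (1 - u) * 1) powr (- (\<theta> + 1))) \<partial>M) \<partial>beta_distribution \<theta> 1)"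
    by (rule UM.Fubini') measurable
  also have "\<dots> = (\<integral>\<^sup>+u. (\<integral>\<^sup>+x. ennreal ((1 + u * l * h x) powr (\<alpha> - 1)) \<partial>G) *
        (\<integral>\<^sup>+w. ennreal ((1 + u * l * y' w) powr (- (\<theta> + \<alpha>))) \<partial>M) \<partial>beta_distribution \<theta> 1)"
  proof (rule nn_integral_cong_AE, use AE_beta_distribution[of \<theta> 1] in eventually_elim)
    fix u :: real assume u: "0 < u \<and> u < 1"
    define F where "F = (\<lambda>(v, x, p, q :: ennreal). ennreal ((v * (1 + u * l * h x)
        + (1 - v) * (1 + u * l * enn2real p)) powr (- ((1 - \<alpha>) + (\<theta> + \<alpha>)))))"
    have [measurable]: "F \<in> borel_measurable (borel \<Otimes>\<^sub>M (borel \<Otimes>\<^sub>M (borel \<Otimes>\<^sub>M borel)))"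
      unfolding F_def by measurable
    have pos: "0 < 1 + u * l * h x" "0 < 1 + u * l * y' w" for x w
      using u l hK(1) nonneg by (auto intro!: add_pos_nonneg mult_nonneg_nonneg)
    have "(\<integral>\<^sup>+w. ennreal ((u * (1 + l * y w) + (1 - u) * 1) powr (- (\<theta> + 1))) \<partial>M)
        = (\<integral>\<^sup>+w. F (V 1 w, \<xi> 1 w, stick_sum h (\<lambda>n. V (Suc n) w) (\<lambda>n. \<xi> (Suc n) w),
            stick_sum h (\<lambda>n. V (Suc n) w) (\<lambda>n. \<xi> (Suc n) w)) \<partial>M)"
    proof (rule nn_integral_cong_AE, use rec in eventually_elim)
      case (elim w)
      have "u * (1 + l * y w) + (1 - u) * 1
          = V 1 w * (1 + u * l * h (\<xi> 1 w)) + (1 - V 1 w) * (1 + u * l * y' w)"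
        unfolding elim by (simp add: algebra_simps)
      moreover have "- (\<theta> + 1) = - ((1 - \<alpha>) + (\<theta> + \<alpha>))" by simp
      ultimately show ?case unfolding F_def y'_def by (simp only: prod.case)
    qed
    also have "\<dots> = (\<integral>\<^sup>+w. (\<integral>\<^sup>+x. (\<integral>\<^sup>+v. F (v, x, stick_sum h (\<lambda>n. V (Suc n) w) (\<lambda>n. \<xi> (Suc n) w),
        stick_sum h (\<lambda>n. V (Suc n) w) (\<lambda>n. \<xi> (Suc n) w)) \<partial>beta_distribution (1 - \<alpha>) (\<theta> + \<alpha>)) \<partial>G) \<partial>M)"
      by (rule nn_integral_first_stick) measurable
    also have "\<dots> = (\<integral>\<^sup>+w. (\<integral>\<^sup>+x. ennreal ((1 + u * l * h x) powr (\<alpha> - 1))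
        * ennreal ((1 + u * l * y' w) powr (- (\<theta> + \<alpha>))) \<partial>G) \<partial>M)"
    proof (intro nn_integral_cong)
      fix w x
      have "(\<integral>\<^sup>+v. ennreal ((v * (1 + u * l * h x) + (1 - v) * (1 + u * l * y' w)) powr (- ((1 - \<alpha>) + (\<theta> + \<alpha>))))
            \<partial>beta_distribution (1 - \<alpha>) (\<theta> + \<alpha>))
          = ennreal ((1 + u * l * h x) powr (- (1 - \<alpha>)) * (1 + u * l * y' w) powr (- (\<theta> + \<alpha>)))"
        using parameters by (intro nn_integral_beta_distribution_linear_powr pos) auto
      then show "(\<integral>\<^sup>+v. F (v, x, stick_sum h (\<lambda>n. V (Suc n) w) (\<lambda>n. \<xi> (Suc n) w),
          stick_sum h (\<lambda>n. V (Suc n) w) (\<lambda>n. \<xi> (Suc n) w)) \<partial>beta_distribution (1 - \<alpha>) (\<theta> + \<alpha>))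
          = ennreal ((1 + u * l * h x) powr (\<alpha> - 1)) * ennreal ((1 + u * l * y' w) powr (- (\<theta> + \<alpha>)))"
        by (simp add: F_def y'_def ennreal_mult)
    qed
    also have "\<dots> = (\<integral>\<^sup>+x. ennreal ((1 + u * l * h x) powr (\<alpha> - 1)) \<partial>G) *
        (\<integral>\<^sup>+w. ennreal ((1 + u * l * y' w) powr (- (\<theta> + \<alpha>))) \<partial>M)"
      by (simp add: nn_integral_multc nn_integral_cmult)
    finally show "(\<integral>\<^sup>+w. ennreal ((u * (1 + l * y w) + (1 - u) * 1) powr (- (\<theta> + 1))) \<partial>M) = \<dots>" .
  qed
  finally show ?thesis unfolding y_def y'_def .
qed

end

section \<open>Iteration of the recursion for simple functions\<close>

text \<open>Bernoulli's inequality for negative exponents, from exp x \<ge> 1 + x and ln (1 + x)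
  \<le> x. It yields the error estimate from which the iteration starts.\<close>

lemma powr_neg_ge_linear:
  fixes x p :: real
  assumes "0 \<le> x" "0 \<le> p"
  shows "1 - p * x \<le> (1 + x) powr (- p)"
proof -
  have "p * ln (1 + x) \<le> p * x"
    using assms ln_add_one_self_le_self[of x] by (intro mult_left_mono) auto
  then have "1 - p * x \<le> 1 + - p * ln (1 + x)" by simp
  also have "\<dots> \<le> exp (- p * ln (1 + x))" by (rule exp_ge_add_one_self)
  also have "\<dots> = (1 + x) powr (- p)" using assms by (simp add: powr_def)
  finally show ?thesis .
qed

text \<open>The product is at most \<open>\<theta> exp (- (1 - \<alpha>) \<Sum> 1 / (\<theta> + i \<alpha> + 1))\<close>, and the sum diverges
  logarithmically; this is where \<open>\<alpha> < 1\<close> enters.\<close>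

lemma tendsto_prod_linear_ratio:
  fixes \<alpha> \<theta> :: real
  assumes "0 < \<alpha>" "\<alpha> < 1" "0 < \<theta>"
  shows "(\<lambda>n. (\<theta> + real n * \<alpha>) * (\<Prod>i<n. (\<theta> + real i * \<alpha>) / (\<theta> + real i * \<alpha> + 1))) \<longlonglongrightarrow> 0"
proof -
  define p where "p n = (\<theta> + real n * \<alpha>) * (\<Prod>i<n. (\<theta> + real i * \<alpha>) / (\<theta> + real i * \<alpha> + 1))" for n
  \<comment> \<open>Chosen so that (1 - \<alpha>) / (\<theta> + n \<alpha> + 1) is at least \<delta>
    / (n + 1), because \<theta> + n \<alpha> + 1 \<le> (\<theta> + 2) (n + 1).\<close>
  define \<delta> where "\<delta> = (1 - \<alpha>) / (\<theta> + 2)"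
  have \<delta>: "0 < \<delta>" using assms by (simp add: \<delta>_def)
  have a: "0 < \<theta> + real n * \<alpha>" for n using assms by (simp add: add_pos_nonneg)
  have a': "0 \<le> \<theta> + real n * \<alpha>" "0 \<le> \<theta> + real n * \<alpha> + 1" for n
    using a[of n] by linarith+
  have p_nonneg: "0 \<le> p n" for n
    unfolding p_def by (intro mult_nonneg_nonneg prod_nonneg divide_nonneg_nonneg a')
  have step: "p (Suc n) \<le> p n * exp (- \<delta> * inverse (real (Suc n)))" for n
  proof -
    define b where "b = \<theta> + real n * \<alpha>"
    have b: "0 < b" using a by (simp add: b_def)
    have eq: "p (Suc n) = p n * ((b + \<alpha>) / (b + 1))"
    proof -
      have "\<theta> + real (Suc n) * \<alpha> = b + \<alpha>" by (simp add: b_def algebra_simps)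
      then show ?thesis unfolding p_def by (simp add: b_def mult_ac)
    qed
    have "(b + \<alpha>) / (b + 1) = 1 - (1 - \<alpha>) / (b + 1)"
      using b by (simp add: field_simps)
    also have "\<dots> \<le> 1 - \<delta> * inverse (real (Suc n))"
    proof -
      have "real n * \<alpha> \<le> real n * 1" using assms by (intro mult_left_mono) auto
      moreover have "0 \<le> \<theta> * real n" using assms by simp
      ultimately have "b + 1 \<le> (\<theta> + 2) * real (Suc n)" by (simp add: b_def algebra_simps)
      then have "(1 - \<alpha>) / ((\<theta> + 2) * real (Suc n)) \<le> (1 - \<alpha>) / (b + 1)"
        using assms b by (intro divide_left_mono mult_pos_pos) auto
      then show ?thesis by (simp add: \<delta>_def divide_inverse mult.assoc)
    qed
    also have "\<dots> \<le> exp (- \<delta> * inverse (real (Suc n)))"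
      using exp_ge_add_one_self[of "- \<delta> * inverse (real (Suc n))"] by simp
    finally show ?thesis unfolding eq using p_nonneg by (rule mult_left_mono)
  qed
  have bound: "p n \<le> \<theta> * exp (- \<delta> * harm n)" for n
  proof (induction n)
    case (Suc n)
    have "p (Suc n) \<le> \<theta> * exp (- \<delta> * harm n) * exp (- \<delta> * inverse (real (Suc n)))"
      using step[of n] Suc by (auto intro: order.trans mult_right_mono)
    also have "\<dots> = \<theta> * exp (- \<delta> * harm (Suc n))"
      by (simp add: harm_Suc exp_add[symmetric] algebra_simps del: exp_add)
    finally show ?case .
  qed (simp add: p_def harm_def)
  have bound': "p n \<le> \<theta> * exp (- \<delta> * ln (real n + 1))" for n
  proof -
    have "exp (- \<delta> * harm n) \<le> exp (- \<delta> * ln (real n + 1))"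
      using \<delta> ln_le_harm[of n] by simp
    then show ?thesis using bound[of n] assms by (auto intro: order.trans mult_left_mono)
  qed
  have "(\<lambda>n. \<theta> * exp (- \<delta> * ln (real n + 1))) \<longlonglongrightarrow> 0"
  proof -
    have "filterlim (\<lambda>n. ln (real n + 1)) at_top sequentially"
      using filterlim_compose[OF ln_at_top filterlim_tendsto_add_at_top[OF tendsto_const filterlim_real_sequentially], of 1]
      by (simp add: add.commute)
    then have "filterlim (\<lambda>n. - \<delta> * ln (real n + 1)) at_bot sequentially"
      using \<delta> by (intro filterlim_tendsto_neg_mult_at_bot[OF tendsto_const]) auto
    then have "(\<lambda>n. exp (- \<delta> * ln (real n + 1))) \<longlonglongrightarrow> 0"
      by (rule filterlim_compose[OF exp_at_bot])
    then have "(\<lambda>n. \<theta> * exp (- \<delta> * ln (real n + 1))) \<longlonglongrightarrow> \<theta> * 0"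
      by (intro tendsto_mult tendsto_const)
    then show ?thesis by simp
  qed
  note lim = this
  have "p \<longlonglongrightarrow> 0"
    by (rule real_tendsto_sandwich[OF _ _ tendsto_const lim]; rule always_eventually; intro allI p_nonneg bound')
  then show ?thesis unfolding p_def .
qed

context pitman_yor
begin

lemma stick_mean_powr_bounds:
  assumes "0 \<le> l" "0 \<le> \<theta>'"
  shows "0 < (1 + l * stick_mean h w) powr (- \<theta>')" "(1 + l * stick_mean h w) powr (- \<theta>') \<le> 1"
proof -
  have "0 \<le> l * stick_mean h w" using assms by (simp add: stick_mean_def)
  then show "0 < (1 + l * stick_mean h w) powr (- \<theta>')" "(1 + l * stick_mean h w) powr (- \<theta>') \<le> 1"
    using assms powr_mono[of "- \<theta>'" 0 "1 + l * stick_mean h w"] by auto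
qed

text \<open>Both quantities are averages over u of \<gamma>(u l) times the corresponding quantity of
  the shifted process at u l. As 0 \<le> \<gamma> \<le> 1, an error C s for the shifted process
  gives C l times the mean of u.\<close>

lemma simple_function_stick_mean_contraction:
  assumes h: "simple_function borel h" and h0: "\<And>x. 0 \<le> h x" and \<alpha>: "0 < \<alpha>" and \<theta>: "0 < \<theta>"
    and C: "\<And>s. 0 \<le> s \<Longrightarrow>
      \<bar>expectation (\<lambda>w. (1 + s * enn2real (stick_sum h (\<lambda>n. V (Suc n) w) (\<lambda>n. \<xi> (Suc n) w))) powr (- (\<theta> + \<alpha>)))
        - (\<integral>x. (1 + s * h x) powr \<alpha> \<partial>G) powr (- (\<theta> + \<alpha>) / \<alpha>)\<bar> \<le> C * s"
    and l: "0 \<le> l"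
  shows "\<bar>expectation (\<lambda>w. (1 + l * stick_mean h w) powr (- \<theta>))
    - (\<integral>x. (1 + l * h x) powr \<alpha> \<partial>G) powr (- \<theta> / \<alpha>)\<bar> \<le> C * l * (\<theta> / (\<theta> + 1))"
proof -
  have [measurable_cong]: "sets G = sets borel" by (rule sets_base)
  interpret G: prob_space G by (rule base_prob)
  interpret U: prob_space "beta_distribution \<theta> 1"
    using \<theta> by (intro prob_space_beta_distribution) auto
  interpret S: pitman_yor M \<alpha> "\<theta> + \<alpha>" G "\<lambda>n. V (Suc n)" "\<lambda>n. \<xi> (Suc n)" by (rule shift)
  have [measurable]: "h \<in> borel_measurable borel"
    using h by (rule borel_measurable_simple_function)
  obtain K where K: "\<And>x. h x \<le> K"
  proof
    show "h x \<le> Max (range h)" for x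
      using simple_functionD(1)[OF h] by (intro Max_ge) auto
  qed
  define \<gamma> where "\<gamma> s = (\<integral>x. (1 + s * h x) powr (\<alpha> - 1) \<partial>G)" for s
  define \<phi> where "\<phi> s = (\<integral>x. (1 + s * h x) powr \<alpha> \<partial>G)" for s
  define m where "m s = expectation (\<lambda>w. (1 + s * S.stick_mean h w) powr (- (\<theta> + \<alpha>)))" for s
  have [measurable]: "\<gamma> \<in> borel_measurable borel" "\<phi> \<in> borel_measurable borel" "m \<in> borel_measurable borel"
    unfolding \<gamma>_def \<phi>_def m_def by measurable
  have one_le: "1 \<le> 1 + s * h x" if "0 \<le> s" for s x using that h0 by simp
  have \<gamma>_int: "integrable G (\<lambda>x. (1 + s * h x) powr (\<alpha> - 1))"
    and \<gamma>_bounds: "0 \<le> \<gamma> s" "\<gamma> s \<le> 1" if s: "0 \<le> s" for s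
  proof -
    have le: "(1 + s * h x) powr (\<alpha> - 1) \<le> 1" for x
      using powr_mono[of "\<alpha> - 1" 0 "1 + s * h x"] one_le[OF s] parameters by simp
    show int: "integrable G (\<lambda>x. (1 + s * h x) powr (\<alpha> - 1))"
      using le by (intro G.integrable_const_bound[where B = 1]) auto
    show "0 \<le> \<gamma> s" unfolding \<gamma>_def by simp
    show "\<gamma> s \<le> 1" unfolding \<gamma>_def using le int by (intro G.integral_le_const) auto
  qed
  have m_bounds: "0 \<le> m s" "m s \<le> 1" and m_int: "integrable M (\<lambda>w. (1 + s * S.stick_mean h w) powr (- (\<theta> + \<alpha>)))"
    if s: "0 \<le> s" for s
  proof -
    note b = S.stick_mean_powr_bounds[OF s, of "\<theta> + \<alpha>" h]
    show int: "integrable M (\<lambda>w. (1 + s * S.stick_mean h w) powr (- (\<theta> + \<alpha>)))"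
      using b \<theta> \<alpha> by (intro integrable_const_bound[where B = 1]) auto
    show "0 \<le> m s" unfolding m_def by simp
    show "m s \<le> 1" unfolding m_def using b \<theta> \<alpha> int by (intro integral_le_const) auto
  qed
  have \<phi>_ge: "1 \<le> \<phi> s" if s: "0 \<le> s" for s
  proof -
    have "integrable G (\<lambda>x. (1 + s * h x) powr \<alpha>)"
      using K h0 one_le[OF s] \<alpha> s
      by (intro G.integrable_const_bound[where B = "(1 + s * K) powr \<alpha>"] AE_I2)
         (auto intro!: powr_mono2 mult_left_mono add_nonneg_nonneg)
    then show ?thesis
      unfolding \<phi>_def using one_le[OF s] \<alpha> by (intro G.integral_ge_const AE_I2) (auto intro: ge_one_powr_ge_zero)
  qed
  have M_eq: "expectation (\<lambda>w. (1 + l * stick_mean h w) powr (- \<theta>))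
      = (\<integral>u. \<gamma> (u * l) * m (u * l) \<partial>beta_distribution \<theta> 1)"
  proof -
    have "(\<integral>\<^sup>+w. ennreal ((1 + l * stick_mean h w) powr (- \<theta>)) \<partial>M)
        = (\<integral>\<^sup>+u. ennreal (\<gamma> (u * l) * m (u * l)) \<partial>beta_distribution \<theta> 1)"
      unfolding stick_mean_def nn_integral_stick_sum_powr[OF \<open>h \<in> borel_measurable borel\<close> h0 K l \<theta>]
    proof (rule nn_integral_cong_AE, use AE_beta_distribution[of \<theta> 1] in eventually_elim)
      fix u :: real assume "0 < u \<and> u < 1"
      then have u: "0 \<le> u * l" using l by simp
      show "(\<integral>\<^sup>+x. ennreal ((1 + u * l * h x) powr (\<alpha> - 1)) \<partial>G) *
        (\<integral>\<^sup>+w. ennreal ((1 + u * l * enn2real (stick_sum h (\<lambda>n. V (Suc n) w) (\<lambda>n. \<xi> (Suc n) w)))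
          powr (- (\<theta> + \<alpha>))) \<partial>M) = ennreal (\<gamma> (u * l) * m (u * l))"
        using \<gamma>_int[OF u] m_int[OF u] \<gamma>_bounds[OF u]
        by (simp add: nn_integral_eq_integral \<gamma>_def m_def S.stick_mean_def ennreal_mult')
    qed
    then have "expectation (\<lambda>w. (1 + l * stick_mean h w) powr (- \<theta>))
        = enn2real (\<integral>\<^sup>+u. ennreal (\<gamma> (u * l) * m (u * l)) \<partial>beta_distribution \<theta> 1)"
      by (subst integral_eq_nn_integral) auto
    also have "\<dots> = (\<integral>u. \<gamma> (u * l) * m (u * l) \<partial>beta_distribution \<theta> 1)"
    proof (intro integral_eq_nn_integral[symmetric])
      show "AE u in beta_distribution \<theta> 1. 0 \<le> \<gamma> (u * l) * m (u * l)"
        using AE_beta_distribution[of \<theta> 1]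
      proof eventually_elim
        case (elim u)
        then have "0 \<le> u * l" using l by simp
        then show ?case using \<gamma>_bounds m_bounds by simp
      qed
    qed simp
    finally show ?thesis .
  qed
  have \<phi>_eq: "\<phi> l powr (- \<theta> / \<alpha>) = (\<integral>u. \<gamma> (u * l) * \<phi> (u * l) powr (- (\<theta> + \<alpha>) / \<alpha>) \<partial>beta_distribution \<theta> 1)"
  proof -
    have sum: "(\<integral>x. F (h x) \<partial>G) = (\<Sum>y\<in>range h. measure G (h -` {y}) * F y)" for F :: "real \<Rightarrow> real"
      by (rule integral_simple_function_comp[OF base_prob sets_base h])
    have "(\<integral>\<^sup>+u. ennreal (\<gamma> (u * l) * \<phi> (u * l) powr (- (\<theta> + \<alpha>) / \<alpha>)) \<partial>beta_distribution \<theta> 1)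
        = ennreal (\<phi> l powr (- \<theta> / \<alpha>))"
    proof -
      have mass: "(\<Sum>y\<in>range h. measure G (h -` {y})) = 1"
        using sum[of "\<lambda>_. 1"] G.prob_space by simp
      have \<gamma>_sum: "\<gamma> s = (\<Sum>y\<in>range h. measure G (h -` {y}) * (1 + s * y) powr (\<alpha> - 1))"
        and \<phi>_sum: "\<phi> s = (\<Sum>y\<in>range h. measure G (h -` {y}) * (1 + s * y) powr \<alpha>)" for s
        unfolding \<gamma>_def \<phi>_def by (rule sum)+
      have "finite (range h)" "\<And>y. y \<in> range h \<Longrightarrow> 0 \<le> y"
        using simple_functionD(1)[OF h] h0 by auto
      from nn_integral_beta_distribution_1_sum_powr[OF \<alpha> \<theta> l this measure_nonneg mass]
      show ?thesis unfolding \<gamma>_sum \<phi>_sum .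
    qed
    moreover have "AE u in beta_distribution \<theta> 1. 0 \<le> \<gamma> (u * l) * \<phi> (u * l) powr (- (\<theta> + \<alpha>) / \<alpha>)"
      using AE_beta_distribution[of \<theta> 1]
    proof eventually_elim
      case (elim u)
      then have "0 \<le> u * l" using l by simp
      then show ?case using \<gamma>_bounds by simp
    qed
    ultimately show ?thesis
      by (subst integral_eq_nn_integral) simp_all
  qed
  have int1: "integrable (beta_distribution \<theta> 1) (\<lambda>u. \<gamma> (u * l) * m (u * l))"
  proof (intro U.integrable_const_bound[where B = 1])
    show "AE u in beta_distribution \<theta> 1. norm (\<gamma> (u * l) * m (u * l)) \<le> 1"
      using AE_beta_distribution[of \<theta> 1]
    proof eventually_elim
      case (elim u)
      then have u: "0 \<le> u * l" using l by simp
      show ?case using \<gamma>_bounds[OF u] m_bounds[OF u] by (simp add: abs_mult mult_le_one)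
    qed
  qed simp
  have int2: "integrable (beta_distribution \<theta> 1) (\<lambda>u. \<gamma> (u * l) * \<phi> (u * l) powr (- (\<theta> + \<alpha>) / \<alpha>))"
  proof (intro U.integrable_const_bound[where B = 1])
    show "AE u in beta_distribution \<theta> 1. norm (\<gamma> (u * l) * \<phi> (u * l) powr (- (\<theta> + \<alpha>) / \<alpha>)) \<le> 1"
      using AE_beta_distribution[of \<theta> 1]
    proof eventually_elim
      case (elim u)
      then have u: "0 \<le> u * l" using l by simp
      have "- (\<theta> + \<alpha>) / \<alpha> \<le> 0"
        using \<alpha> \<theta> by (intro divide_nonpos_pos) auto
      then have "\<phi> (u * l) powr (- (\<theta> + \<alpha>) / \<alpha>) \<le> 1"
        using powr_mono[of "- (\<theta> + \<alpha>) / \<alpha>" 0 "\<phi> (u * l)"] \<phi>_ge[OF u] \<alpha> \<theta> by simp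
      then show ?case using \<gamma>_bounds[OF u] by (simp add: abs_mult mult_le_one)
    qed
  qed simp
  have int_id: "integrable (beta_distribution \<theta> 1) (\<lambda>u. u)"
  proof (intro U.integrable_const_bound[where B = 1])
    show "AE u in beta_distribution \<theta> 1. norm u \<le> 1"
      using AE_beta_distribution[of \<theta> 1] by eventually_elim simp
  qed simp
  have "\<bar>expectation (\<lambda>w. (1 + l * stick_mean h w) powr (- \<theta>)) - \<phi> l powr (- \<theta> / \<alpha>)\<bar>
      = \<bar>\<integral>u. \<gamma> (u * l) * m (u * l) - \<gamma> (u * l) * \<phi> (u * l) powr (- (\<theta> + \<alpha>) / \<alpha>) \<partial>beta_distribution \<theta> 1\<bar>"
    unfolding M_eq \<phi>_eq by (subst Bochner_Integration.integral_diff[OF int1 int2]) (rule refl)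
  also have "\<dots> \<le> (\<integral>u. \<bar>\<gamma> (u * l) * m (u * l) - \<gamma> (u * l) * \<phi> (u * l) powr (- (\<theta> + \<alpha>) / \<alpha>)\<bar> \<partial>beta_distribution \<theta> 1)"
    by (rule integral_abs_bound)
  also have "\<dots> \<le> (\<integral>u. C * l * u \<partial>beta_distribution \<theta> 1)"
  proof (rule integral_mono_AE)
    show "AE u in beta_distribution \<theta> 1.
        \<bar>\<gamma> (u * l) * m (u * l) - \<gamma> (u * l) * \<phi> (u * l) powr (- (\<theta> + \<alpha>) / \<alpha>)\<bar> \<le> C * l * u"
      using AE_beta_distribution[of \<theta> 1]
    proof eventually_elim
      case (elim u)
      then have u: "0 \<le> u * l" using l by simp
      have "\<bar>\<gamma> (u * l) * m (u * l) - \<gamma> (u * l) * \<phi> (u * l) powr (- (\<theta> + \<alpha>) / \<alpha>)\<bar>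
          = \<gamma> (u * l) * \<bar>m (u * l) - \<phi> (u * l) powr (- (\<theta> + \<alpha>) / \<alpha>)\<bar>"
        using \<gamma>_bounds[OF u] by (simp add: abs_mult flip: right_diff_distrib)
      also have "\<dots> \<le> 1 * (C * (u * l))"
        using \<gamma>_bounds[OF u] C[OF u] unfolding m_def \<phi>_def S.stick_mean_def by (intro mult_mono) auto
      finally show ?case by (simp add: mult_ac)
    qed
  qed (intro Bochner_Integration.integrable_abs Bochner_Integration.integrable_diff integrable_mult_right int1 int2 int_id)+
  also have "\<dots> = C * l * (\<theta> / (\<theta> + 1))"
    using integral_beta_distribution_1[OF \<theta>] by simp
  finally show ?thesis unfolding \<phi>_def .
qed

end

text \<open>For n = 0 both quantities lie between 1 - \<theta> l K and 1. The induction step uses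
  the hypothesis for the shifted process, with \<theta> + \<alpha> in place of \<theta>. The
  statement therefore stands outside the locale, with the process and its parameters free to
  vary.\<close>

lemma simple_function_stick_mean_bound:
  assumes "pitman_yor M \<alpha> \<theta> G V \<xi>" "0 < \<alpha>" "0 < \<theta>" "0 \<le> l"
    and h: "simple_function borel h" "\<And>x. 0 \<le> h x" "\<And>x. h x \<le> K"
  shows "\<bar>(\<integral>w. (1 + l * enn2real (stick_sum h (\<lambda>n. V n w) (\<lambda>n. \<xi> n w))) powr (- \<theta>) \<partial>M)
      - (\<integral>x. (1 + l * h x) powr \<alpha> \<partial>G) powr (- \<theta> / \<alpha>)\<bar>
    \<le> K * ((\<theta> + real n * \<alpha>) * (\<Prod>i<n. (\<theta> + real i * \<alpha>) / (\<theta> + real i * \<alpha> + 1))) * l"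
  using assms(1-4)
proof (induction n arbitrary: \<theta> V \<xi> l)
  case (0 \<theta> V \<xi> l)
  interpret pitman_yor M \<alpha> \<theta> G V \<xi> by fact
  interpret G: prob_space G by (rule base_prob)
  have [measurable_cong]: "sets G = sets borel" by (rule sets_base)
  have [measurable]: "h \<in> borel_measurable borel"
    using h(1) by (rule borel_measurable_simple_function)
  have K0: "0 \<le> K" using h(2,3) order.trans by blast
  have one_le: "1 \<le> 1 + l * h x" and le_K: "1 + l * h x \<le> 1 + l * K" for x
    using h \<open>0 \<le> l\<close> by (auto intro: mult_left_mono)
  define a where "a = expectation (\<lambda>w. (1 + l * stick_mean h w) powr (- \<theta>))"
  define \<phi> where "\<phi> = (\<integral>x. (1 + l * h x) powr \<alpha> \<partial>G)"
  have mean_le: "AE w in M. stick_mean h w \<le> K"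
    using AE_sticks
  proof eventually_elim
    case (elim w)
    then have "stick_sum h (\<lambda>n. V n w) (\<lambda>n. \<xi> n w) \<le> ennreal K"
      using h K0 by (intro stick_sum_le) (auto intro: less_imp_le)
    then show ?case unfolding stick_mean_def using K0 by (metis enn2real_ennreal enn2real_mono ennreal_less_top)
  qed
  note b = stick_mean_powr_bounds[OF \<open>0 \<le> l\<close>, of \<theta> h]
  have int: "integrable M (\<lambda>w. (1 + l * stick_mean h w) powr (- \<theta>))"
    using b \<open>0 < \<theta>\<close> by (intro integrable_const_bound[where B = 1]) auto
  have a: "1 - \<theta> * (l * K) \<le> a" "a \<le> 1"
  proof -
    show "a \<le> 1" unfolding a_def using b \<open>0 < \<theta>\<close> int by (intro integral_le_const) auto
    show "1 - \<theta> * (l * K) \<le> a" unfolding a_def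
    proof (intro integral_ge_const int, use mean_le in eventually_elim)
      case (elim w)
      have "1 - \<theta> * (l * K) \<le> 1 - \<theta> * (l * stick_mean h w)"
        using elim \<open>0 < \<theta>\<close> \<open>0 \<le> l\<close> by (auto intro!: mult_left_mono)
      also have "\<dots> \<le> (1 + l * stick_mean h w) powr (- \<theta>)"
        using \<open>0 < \<theta>\<close> \<open>0 \<le> l\<close> by (intro powr_neg_ge_linear) (auto simp: stick_mean_def)
      finally show ?case .
    qed
  qed
  have int\<phi>: "integrable G (\<lambda>x. (1 + l * h x) powr \<alpha>)"
    using le_K one_le \<open>0 < \<alpha>\<close> order.trans[OF zero_le_one one_le]
    by (intro G.integrable_const_bound[where B = "(1 + l * K) powr \<alpha>"] AE_I2) (auto intro!: powr_mono2)
  have \<phi>: "1 \<le> \<phi>" "\<phi> \<le> (1 + l * K) powr \<alpha>"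
    unfolding \<phi>_def using int\<phi> one_le le_K \<open>0 < \<alpha>\<close> order.trans[OF zero_le_one one_le]
    by (auto intro!: G.integral_ge_const G.integral_le_const AE_I2 ge_one_powr_ge_zero powr_mono2)
  have \<phi>': "1 - \<theta> * (l * K) \<le> \<phi> powr (- \<theta> / \<alpha>)" "\<phi> powr (- \<theta> / \<alpha>) \<le> 1"
  proof -
    have "1 - \<theta> * (l * K) \<le> (1 + l * K) powr (- \<theta>)"
      using \<open>0 < \<theta>\<close> \<open>0 \<le> l\<close> K0 by (intro powr_neg_ge_linear) auto
    also have "\<dots> = ((1 + l * K) powr \<alpha>) powr (- \<theta> / \<alpha>)"
      using \<open>0 < \<alpha>\<close> by (simp add: powr_powr)
    also have "\<dots> \<le> \<phi> powr (- \<theta> / \<alpha>)"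
      using \<phi> \<open>0 < \<alpha>\<close> \<open>0 < \<theta>\<close> by (intro powr_mono2') auto
    finally show "1 - \<theta> * (l * K) \<le> \<phi> powr (- \<theta> / \<alpha>)" .
    show "\<phi> powr (- \<theta> / \<alpha>) \<le> 1"
      using powr_mono[of "- \<theta> / \<alpha>" 0 \<phi>] \<phi> \<open>0 < \<alpha>\<close> \<open>0 < \<theta>\<close> by simp
  qed
  have "\<bar>a - \<phi> powr (- \<theta> / \<alpha>)\<bar> \<le> \<theta> * (l * K)"
    using a \<phi>' by linarith
  then show ?case unfolding a_def \<phi>_def stick_mean_def by (simp add: mult_ac)
next
  case (Suc n \<theta> V \<xi> l)
  interpret pitman_yor M \<alpha> \<theta> G V \<xi> by fact
  define C where "C \<theta> n = K * ((\<theta> + real n * \<alpha>) * (\<Prod>i<n. (\<theta> + real i * \<alpha>) / (\<theta> + real i * \<alpha> + 1)))" for \<theta> n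
  have "\<bar>expectation (\<lambda>w. (1 + s * enn2real (stick_sum h (\<lambda>n. V (Suc n) w) (\<lambda>n. \<xi> (Suc n) w))) powr (- (\<theta> + \<alpha>)))
      - (\<integral>x. (1 + s * h x) powr \<alpha> \<partial>G) powr (- (\<theta> + \<alpha>) / \<alpha>)\<bar> \<le> C (\<theta> + \<alpha>) n * s" if "0 \<le> s" for s
    unfolding C_def using Suc.prems that by (intro Suc.IH shift) auto
  then have "\<bar>expectation (\<lambda>w. (1 + l * stick_mean h w) powr (- \<theta>))
      - (\<integral>x. (1 + l * h x) powr \<alpha> \<partial>G) powr (- \<theta> / \<alpha>)\<bar> \<le> C (\<theta> + \<alpha>) n * l * (\<theta> / (\<theta> + 1))"
    using Suc.prems h by (intro simple_function_stick_mean_contraction) auto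
  \<comment> \<open>The factor \<theta> / (\<theta> + 1) of the contraction is the one of index 0,
    and the product for \<theta> + \<alpha> supplies the factors of indices 1 to n.\<close>
  also have "\<dots> = C \<theta> (Suc n) * l"
  proof -
    have "\<theta> + \<alpha> + real i * \<alpha> = \<theta> + real (Suc i) * \<alpha>" for i by (simp add: algebra_simps)
    then show ?thesis
      unfolding C_def by (simp only: prod.lessThan_Suc_shift comp_def of_nat_0 mult_zero_left add_0_right mult_ac)
  qed
  finally show ?case unfolding C_def stick_mean_def .
qed

lemma simple_function_stick_mean_identity:
  assumes py: "pitman_yor M \<alpha> \<theta> G V \<xi>" "0 < \<alpha>" "0 < \<theta>" "0 \<le> l"
    and h: "simple_function borel h" "\<And>x. 0 \<le> h x"
  shows "(\<integral>w. (1 + l * enn2real (stick_sum h (\<lambda>n. V n w) (\<lambda>n. \<xi> n w))) powr (- \<theta>) \<partial>M)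
      = (\<integral>x. (1 + l * h x) powr \<alpha> \<partial>G) powr (- \<theta> / \<alpha>)" (is "?a = ?b")
proof -
  obtain K where K: "\<And>x. h x \<le> K"
  proof
    show "h x \<le> Max (range h)" for x
      using simple_functionD(1)[OF h(1)] by (intro Max_ge) auto
  qed
  define p where "p n = (\<theta> + real n * \<alpha>) * (\<Prod>i<n. (\<theta> + real i * \<alpha>) / (\<theta> + real i * \<alpha> + 1))" for n
  have "\<alpha> < 1" using py(1) by (simp add: pitman_yor.parameters)
  then have "p \<longlonglongrightarrow> 0"
    unfolding p_def using py by (intro tendsto_prod_linear_ratio) auto
  then have "(\<lambda>n. K * p n * l) \<longlonglongrightarrow> K * 0 * l" by (intro tendsto_intros)
  moreover have "\<bar>?a - ?b\<bar> \<le> K * p n * l" for n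
    unfolding p_def by (rule simple_function_stick_mean_bound[OF py h K])
  ultimately have "\<bar>?a - ?b\<bar> \<le> K * 0 * l"
    by (intro LIMSEQ_le_const) auto
  then show ?thesis by simp
qed

section \<open>From simple functions to unbounded functions, and the total mass of the
  process\<close>

context pitman_yor
begin

text \<open>At this stage the total mass of the process and the finiteness of its means are not yet known,
  so an infinite mean is counted with the value 0; this is the limit of
  \<open>(1 + l y) powr (- \<theta>)\<close> as \<open>y\<close> grows.\<close>

lemma expectation_extended_stick_mean_powr:
  assumes h [measurable]: "h \<in> borel_measurable borel" and h0: "\<And>x. 0 \<le> h x"
    and int: "integrable G (\<lambda>x. (1 + h x) powr \<alpha>)"
    and \<alpha>: "0 < \<alpha>" and \<theta>: "0 < \<theta>" and l: "0 < l" "l \<le> 1"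
  shows "expectation (\<lambda>w. if stick_sum h (\<lambda>n. V n w) (\<lambda>n. \<xi> n w) = \<infinity> then 0
      else (1 + l * stick_mean h w) powr (- \<theta>))
    = (\<integral>x. (1 + l * h x) powr \<alpha> \<partial>G) powr (- \<theta> / \<alpha>)"
proof -
  have [measurable_cong]: "sets G = sets borel" by (rule sets_base)
  interpret G: prob_space G by (rule base_prob)
  obtain f where f: "incseq f" "\<And>i. simple_function borel (f i)" "\<And>x. bdd_above (range (\<lambda>i. f i x))"
      "\<And>i x. 0 \<le> f i x" "h = (SUP i. f i)"
    using borel_measurable_implies_simple_function_sequence_real[OF h h0] by auto
  have f_meas [measurable]: "f i \<in> borel_measurable borel" for i
    using f(2) by (rule borel_measurable_simple_function)
  have f_incseq: "incseq (\<lambda>i. f i x)" for x using f(1) by (auto simp: incseq_def le_fun_def)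
  have f_lim: "(\<lambda>i. f i x) \<longlonglongrightarrow> h x" for x
    unfolding f(5) SUP_apply by (rule LIMSEQ_incseq_SUP[OF f(3) f_incseq])
  have f_le: "f i x \<le> h x" for i x by (rule incseq_le[OF f_incseq f_lim])
  \<comment> \<open>Monotone convergence under the stick-breaking measure, valid for all
    \<open>v\<close> and \<open>x\<close> because no finiteness is asked for.\<close>
  have S_lim: "(\<lambda>i. stick_sum (f i) v x) \<longlonglongrightarrow> stick_sum h v x" for v x
  proof -
    have "(\<lambda>i. \<integral>\<^sup>+y. ennreal (f i y) \<partial>stick_breaking_measure v x) \<longlonglongrightarrow> (\<integral>\<^sup>+y. ennreal (h y) \<partial>stick_breaking_measure v x)"
    proof (rule nn_integral_LIMSEQ)
      show "incseq (\<lambda>i y. ennreal (f i y))"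
        using f(1) by (auto simp: incseq_def le_fun_def intro!: ennreal_leI)
      show "(\<lambda>i. ennreal (f i y)) \<longlonglongrightarrow> ennreal (h y)" for y
        by (rule tendsto_ennrealI[OF f_lim])
    qed measurable
    then show ?thesis by (simp add: nn_integral_stick_breaking_measure)
  qed
  let ?k = "\<lambda>w. if stick_sum h (\<lambda>n. V n w) (\<lambda>n. \<xi> n w) = \<infinity> then 0
      else (1 + l * stick_mean h w) powr (- \<theta>)"
  have [measurable]: "?k \<in> borel_measurable M" by measurable
  have M_lim: "(\<lambda>i. expectation (\<lambda>w. (1 + l * stick_mean (f i) w) powr (- \<theta>))) \<longlonglongrightarrow> expectation ?k"
  proof (rule integral_dominated_convergence[where w = "\<lambda>_. 1"])
    show "AE w in M. (\<lambda>i. (1 + l * stick_mean (f i) w) powr (- \<theta>)) \<longlonglongrightarrow> ?k w"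
      using AE_sticks
    proof eventually_elim
      case (elim w)
      define s where "s i = stick_sum (f i) (\<lambda>n. V n w) (\<lambda>n. \<xi> n w)" for i
      have fin: "s i < \<infinity>" for i
      proof -
        have "s i \<le> ennreal (Max (range (f i)))"
          unfolding s_def
        proof (rule stick_sum_le)
          show le: "f i x \<le> Max (range (f i))" for x
            using simple_functionD(1)[OF f(2)[of i]] by (intro Max_ge) auto
          show "0 \<le> Max (range (f i))" by (rule order.trans[OF f(4) le])
        qed (use elim in \<open>auto intro: less_imp_le\<close>)
        then show ?thesis by (auto intro: le_less_trans)
      qed
      have mean: "ennreal (stick_mean (f i) w) = s i" for i
        using fin[of i] unfolding stick_mean_def s_def by (intro ennreal_enn2real) simp
      have lim: "s \<longlonglongrightarrow> stick_sum h (\<lambda>n. V n w) (\<lambda>n. \<xi> n w)" unfolding s_def by (rule S_lim)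
      show ?case
      proof (cases "stick_sum h (\<lambda>n. V n w) (\<lambda>n. \<xi> n w) = \<infinity>")
        case True
        then have "(\<lambda>i. ennreal (stick_mean (f i) w)) \<longlonglongrightarrow> top" using lim by (simp add: mean)
        then have "filterlim (\<lambda>i. stick_mean (f i) w) at_top sequentially"
          by (simp add: ennreal_tendsto_top_eq_at_top)
        then have "filterlim (\<lambda>i. 1 + l * stick_mean (f i) w) at_top sequentially"
          using l by (intro filterlim_tendsto_add_at_top[OF tendsto_const]
              filterlim_tendsto_pos_mult_at_top[OF tendsto_const])
        then have "(\<lambda>i. (1 + l * stick_mean (f i) w) powr (- \<theta>)) \<longlonglongrightarrow> 0"
          using \<theta> by (intro tendsto_neg_powr) auto
        then show ?thesis using True by simp
      next
        case False
        then have "ennreal (stick_mean h w) = stick_sum h (\<lambda>n. V n w) (\<lambda>n. \<xi> n w)"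
          unfolding stick_mean_def by (intro ennreal_enn2real) (simp add: less_top)
        then have "s \<longlonglongrightarrow> ennreal (stick_mean h w)" using lim by simp
        then have "(\<lambda>i. enn2real (s i)) \<longlonglongrightarrow> stick_mean h w"
          by (rule tendsto_enn2real) (simp add: stick_mean_def)
        then have "(\<lambda>i. stick_mean (f i) w) \<longlonglongrightarrow> stick_mean h w"
          unfolding stick_mean_def s_def .
        moreover have "0 < 1 + l * stick_mean h w"
          using l by (auto simp: stick_mean_def intro!: add_pos_nonneg)
        ultimately have "(\<lambda>i. (1 + l * stick_mean (f i) w) powr (- \<theta>)) \<longlonglongrightarrow> (1 + l * stick_mean h w) powr (- \<theta>)"
          by (intro tendsto_powr tendsto_add tendsto_mult tendsto_const) auto
        then show ?thesis using False by simp
      qed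
    qed
    show "AE w in M. norm ((1 + l * stick_mean (f i) w) powr (- \<theta>)) \<le> 1" for i
      using stick_mean_powr_bounds(2)[of l \<theta> "f i"] l \<theta> by simp
  qed simp_all
  \<comment> \<open>Because l \<le> 1, the integrable function
    \<open>(1 + h x) powr \<alpha>\<close> dominates all approximants.\<close>
  have G_lim: "(\<lambda>i. \<integral>x. (1 + l * f i x) powr \<alpha> \<partial>G) \<longlonglongrightarrow> (\<integral>x. (1 + l * h x) powr \<alpha> \<partial>G)"
  proof (rule integral_dominated_convergence[OF _ _ int])
    show "AE x in G. (\<lambda>i. (1 + l * f i x) powr \<alpha>) \<longlonglongrightarrow> (1 + l * h x) powr \<alpha>"
    proof (rule AE_I2)
      fix x
      have "0 < 1 + l * h x" using l h0 by (intro add_pos_nonneg) auto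
      then show "(\<lambda>i. (1 + l * f i x) powr \<alpha>) \<longlonglongrightarrow> (1 + l * h x) powr \<alpha>"
        by (intro tendsto_powr tendsto_add tendsto_mult tendsto_const f_lim) auto
    qed
    show "AE x in G. norm ((1 + l * f i x) powr \<alpha>) \<le> (1 + h x) powr \<alpha>" for i
    proof (rule AE_I2)
      fix x
      have "l * f i x \<le> 1 * h x" using l f_le h0 f(4) by (intro mult_mono) auto
      then show "norm ((1 + l * f i x) powr \<alpha>) \<le> (1 + h x) powr \<alpha>"
        using l f(4) \<alpha> by (auto intro!: powr_mono2 add_nonneg_nonneg)
    qed
  qed measurable
  have "1 \<le> (\<integral>x. (1 + l * h x) powr \<alpha> \<partial>G)"
  proof (rule G.integral_ge_const)
    show "integrable G (\<lambda>x. (1 + l * h x) powr \<alpha>)"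
    proof (rule Bochner_Integration.integrable_bound[OF int])
      show "AE x in G. norm ((1 + l * h x) powr \<alpha>) \<le> norm ((1 + h x) powr \<alpha>)"
        using l h0 \<alpha> by (intro AE_I2) (auto intro!: powr_mono2 add_nonneg_nonneg mult_left_le_one_le)
    qed measurable
    show "AE x in G. 1 \<le> (1 + l * h x) powr \<alpha>"
      using l h0 \<alpha> by (intro AE_I2) (auto intro!: ge_one_powr_ge_zero)
  qed
  then have "(\<lambda>i. (\<integral>x. (1 + l * f i x) powr \<alpha> \<partial>G) powr (- \<theta> / \<alpha>))
      \<longlonglongrightarrow> (\<integral>x. (1 + l * h x) powr \<alpha> \<partial>G) powr (- \<theta> / \<alpha>)"
    by (intro tendsto_powr G_lim tendsto_const) auto
  moreover have "expectation (\<lambda>w. (1 + l * stick_mean (f i) w) powr (- \<theta>))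
      = (\<integral>x. (1 + l * f i x) powr \<alpha> \<partial>G) powr (- \<theta> / \<alpha>)" for i
    unfolding stick_mean_def using l \<alpha> \<theta> f
    by (intro simple_function_stick_mean_identity pitman_yor_axioms) auto
  ultimately show ?thesis using M_lim by (auto intro: LIMSEQ_unique)
qed

text \<open>The transform at scale l is at most the probability of a finite mean, since infinite
  means contribute 0. As l tends to 0, its value on the side of the base measure tends to 1. This
  requires only a moment of order \<alpha> of h, under which the mean itself may have infinite
  expectation.\<close>

lemma AE_stick_sum_finite:
  assumes h [measurable]: "h \<in> borel_measurable borel" and h0: "\<And>x. 0 \<le> h x"
    and int: "integrable G (\<lambda>x. (1 + h x) powr \<alpha>)" and \<alpha>: "0 < \<alpha>" and \<theta>: "0 < \<theta>"
  shows "AE w in M. stick_sum h (\<lambda>n. V n w) (\<lambda>n. \<xi> n w) < \<infinity>"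
proof -
  have [measurable_cong]: "sets G = sets borel" by (rule sets_base)
  interpret G: prob_space G by (rule base_prob)
  let ?S = "\<lambda>w. stick_sum h (\<lambda>n. V n w) (\<lambda>n. \<xi> n w)"
  define l where "l n = inverse (real (Suc n))" for n
  have l: "0 < l n" "l n \<le> 1" for n by (simp_all add: l_def inverse_le_1_iff)
  have l_lim: "l \<longlonglongrightarrow> 0" unfolding l_def by (rule LIMSEQ_inverse_real_of_nat)
  have "(\<lambda>n. \<integral>x. (1 + l n * h x) powr \<alpha> \<partial>G) \<longlonglongrightarrow> (\<integral>x. (1 + 0 * h x) powr \<alpha> \<partial>G)"
  proof (rule integral_dominated_convergence[OF _ _ int])
    show "AE x in G. (\<lambda>n. (1 + l n * h x) powr \<alpha>) \<longlonglongrightarrow> (1 + 0 * h x) powr \<alpha>"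
      by (intro AE_I2 tendsto_powr tendsto_add tendsto_mult tendsto_const l_lim) auto
    show "AE x in G. norm ((1 + l n * h x) powr \<alpha>) \<le> (1 + h x) powr \<alpha>" for n
      using l[of n] h0 \<alpha> by (intro AE_I2) (auto intro!: powr_mono2 add_nonneg_nonneg mult_left_le_one_le)
  qed measurable
  then have "(\<lambda>n. (\<integral>x. (1 + l n * h x) powr \<alpha> \<partial>G) powr (- \<theta> / \<alpha>)) \<longlonglongrightarrow> 1 powr (- \<theta> / \<alpha>)"
    by (intro tendsto_powr) (auto simp: G.prob_space)
  moreover have "(\<integral>x. (1 + l n * h x) powr \<alpha> \<partial>G) powr (- \<theta> / \<alpha>) \<le> prob {w \<in> space M. ?S w < \<infinity>}" for n
  proof -
    let ?k = "\<lambda>w. if ?S w = \<infinity> then 0 else (1 + l n * stick_mean h w) powr (- \<theta>)"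
    have "(\<integral>x. (1 + l n * h x) powr \<alpha> \<partial>G) powr (- \<theta> / \<alpha>) = expectation ?k"
      by (rule expectation_extended_stick_mean_powr[symmetric]) (use assms l in auto)
    also have "\<dots> \<le> expectation (indicator {w \<in> space M. ?S w < \<infinity>})"
    proof (rule integral_mono_AE)
      have le: "?k w \<le> indicator {w \<in> space M. ?S w < \<infinity>} w" if "w \<in> space M" for w
        using stick_mean_powr_bounds(2)[of "l n" \<theta> h w] l[of n] \<theta> that
        by (auto simp: indicator_def less_top)
      have nonneg: "0 \<le> ?k w" for w by simp
      show "integrable M ?k"
        using order.trans[OF le] nonneg
        by (intro integrable_const_bound[where B = 1] AE_I2) (auto simp: indicator_def)
      show "AE w in M. ?k w \<le> indicator {w \<in> space M. ?S w < \<infinity>} w"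
        using le by (rule AE_I2)
    qed (auto simp: less_top[symmetric] emeasure_eq_measure)
    also have "\<dots> = prob {w \<in> space M. ?S w < \<infinity>}" by simp
    finally show ?thesis .
  qed
  ultimately have "1 \<le> prob {w \<in> space M. ?S w < \<infinity>}"
    by (intro LIMSEQ_le_const2[of _ 1]) auto
  then have "prob {w \<in> space M. ?S w < \<infinity>} = 1" by (intro antisym prob_le_1)
  then show ?thesis by (subst (asm) prob_Collect_eq_1) auto
qed

lemma expectation_stick_mean_powr:
  assumes h [measurable]: "h \<in> borel_measurable borel" and h0: "\<And>x. 0 \<le> h x"
    and int: "integrable G (\<lambda>x. (1 + h x) powr \<alpha>)" and \<alpha>: "0 < \<alpha>" and \<theta>: "0 < \<theta>"
  shows "expectation (\<lambda>w. (1 + stick_mean h w) powr (- \<theta>)) = (\<integral>x. (1 + h x) powr \<alpha> \<partial>G) powr (- \<theta> / \<alpha>)"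
proof -
  have "expectation (\<lambda>w. (1 + stick_mean h w) powr (- \<theta>))
      = expectation (\<lambda>w. if stick_sum h (\<lambda>n. V n w) (\<lambda>n. \<xi> n w) = \<infinity> then 0
          else (1 + 1 * stick_mean h w) powr (- \<theta>))"
    using AE_stick_sum_finite[OF assms] by (intro integral_cong_AE) (auto elim!: eventually_mono)
  then show ?thesis
    using expectation_extended_stick_mean_powr[OF assms, of 1] by simp
qed

text \<open>For h = 1 the identity says that (1 + m)^(- \<theta>) has expectation 2^(- \<theta>),
  where m is the total mass. As m \<le> 1, this is the smallest value the power can take, so it is
  attained almost surely and m = 1. No direct analysis of the product of the remaining lengths is
  made.\<close>

lemma AE_stick_sum_one:
  assumes \<alpha>: "0 < \<alpha>" and \<theta>: "0 < \<theta>"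
  shows "AE w in M. stick_sum (\<lambda>_. 1) (\<lambda>n. V n w) (\<lambda>n. \<xi> n w) = 1"
proof -
  interpret G: prob_space G by (rule base_prob)
  let ?m = "stick_mean (\<lambda>_. 1)"
  have le: "AE w in M. stick_sum (\<lambda>_. 1) (\<lambda>n. V n w) (\<lambda>n. \<xi> n w) \<le> 1"
    using AE_sticks
  proof eventually_elim
    case (elim w)
    then show ?case
      using stick_sum_le[of "\<lambda>n. V n w" "\<lambda>_. 1" 1] by (auto intro: less_imp_le)
  qed
  have "expectation (\<lambda>w. (1 + ?m w) powr (- \<theta>)) = (2 powr \<alpha>) powr (- \<theta> / \<alpha>)"
    using expectation_stick_mean_powr[of "\<lambda>_. 1"] \<alpha> \<theta> by (simp add: G.prob_space)
  also have "\<dots> = 2 powr (- \<theta>)" using \<alpha> by (simp add: powr_powr)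
  finally have E: "expectation (\<lambda>w. (1 + ?m w) powr (- \<theta>)) = 2 powr (- \<theta>)" .
  have int: "integrable M (\<lambda>w. (1 + ?m w) powr (- \<theta>))"
    using stick_mean_powr_bounds(2)[of 1 \<theta> "\<lambda>_. 1"] \<theta>
    by (intro integrable_const_bound[where B = 1] AE_I2) auto
  have ge: "AE w in M. 0 \<le> (1 + ?m w) powr (- \<theta>) - 2 powr (- \<theta>)"
    using le
  proof eventually_elim
    case (elim w)
    then have "?m w \<le> 1" unfolding stick_mean_def using enn2real_mono[OF elim] by simp
    then show ?case using \<theta> by (auto simp: stick_mean_def intro!: powr_mono2' add_pos_nonneg)
  qed
  have "expectation (\<lambda>w. (1 + ?m w) powr (- \<theta>) - 2 powr (- \<theta>)) = 0"
    using int E by (simp add: prob_space)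
  then have "AE w in M. (1 + ?m w) powr (- \<theta>) - 2 powr (- \<theta>) = 0"
    using ge int by (subst (asm) integral_nonneg_eq_0_iff_AE) auto
  then show ?thesis
    using le
  proof eventually_elim
    case (elim w)
    have pos: "0 < 1 + ?m w" by (simp add: stick_mean_def add_pos_nonneg)
    \<comment> \<open>The power - \<theta> is inverted by the power - 1 / \<theta>.\<close>
    have "1 + ?m w = ((1 + ?m w) powr (- \<theta>)) powr (- 1 / \<theta>)"
      using pos \<theta> by (simp add: powr_powr)
    also have "\<dots> = (2 powr (- \<theta>)) powr (- 1 / \<theta>)" using elim by simp
    also have "\<dots> = 2" using \<theta> by (simp add: powr_powr)
    finally have "?m w = 1" by simp
    moreover have "ennreal (?m w) = stick_sum (\<lambda>_. 1) (\<lambda>n. V n w) (\<lambda>n. \<xi> n w)"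
      unfolding stick_mean_def using elim by (intro ennreal_enn2real) (auto intro: le_less_trans)
    ultimately show ?case by simp
  qed
qed

lemma AE_prob_space_process:
  assumes "0 < \<alpha>" "0 < \<theta>"
  shows "AE w in M. prob_space (pitman_yor_process V \<xi> w)"
  using AE_stick_sum_one[OF assms]
proof eventually_elim
  case (elim w)
  have "emeasure (pitman_yor_process V \<xi> w) (space (pitman_yor_process V \<xi> w))
      = (\<integral>\<^sup>+y. ennreal 1 \<partial>pitman_yor_process V \<xi> w)" by simp
  also have "\<dots> = 1"
    unfolding pitman_yor_process_def using elim by (subst nn_integral_stick_breaking_measure) auto
  finally show ?case by (rule prob_spaceI)
qed

text \<open>Write f = \<epsilon> (1 + h) with h nonnegative. Total mass 1 turns the integral of f
  under the process into \<epsilon> times 1 plus the mean of h, and both sides of the identity scale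
  by \<open>\<epsilon> powr (- \<theta>)\<close>.\<close>

lemma Markov_Krein:
  assumes f [measurable]: "f \<in> borel_measurable borel" and \<epsilon>: "0 < \<epsilon>" "\<And>x. \<epsilon> \<le> f x"
    and int: "integrable G (\<lambda>x. f x powr \<alpha>)" and \<alpha>: "0 < \<alpha>" and \<theta>: "0 < \<theta>"
  shows "AE w in M. integrable (pitman_yor_process V \<xi> w) f"
    and "(\<integral>\<^sup>+w. ennreal ((\<integral>y. f y \<partial>pitman_yor_process V \<xi> w) powr (- \<theta>)) \<partial>M)
      = ennreal ((\<integral>x. f x powr \<alpha> \<partial>G) powr (- \<theta> / \<alpha>))"
proof -
  define h where "h x = f x / \<epsilon> - 1" for x
  have [measurable]: "h \<in> borel_measurable borel" unfolding h_def by measurable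
  have h0: "0 \<le> h x" for x using \<epsilon> by (simp add: h_def)
  have f_eq: "f x = \<epsilon> * (1 + h x)" for x using \<epsilon> by (simp add: h_def)
  have pow: "(1 + h x) powr \<alpha> = f x powr \<alpha> / \<epsilon> powr \<alpha>" for x
    using \<epsilon> h0[of x] by (simp add: f_eq powr_mult)
  have int_h: "integrable G (\<lambda>x. (1 + h x) powr \<alpha>)"
    unfolding pow using int by simp
  have S: "AE w in M. (\<integral>\<^sup>+y. ennreal (f y) \<partial>pitman_yor_process V \<xi> w) = ennreal (\<epsilon> * (1 + stick_mean h w))"
    using AE_stick_sum_one[OF \<alpha> \<theta>] AE_stick_sum_finite[OF _ h0 int_h \<alpha> \<theta>, simplified]
  proof eventually_elim
    case (elim w)
    let ?N = "stick_breaking_measure (\<lambda>n. V n w) (\<lambda>n. \<xi> n w)"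
    have "(\<integral>\<^sup>+y. ennreal (f y) \<partial>?N) = (\<integral>\<^sup>+y. ennreal \<epsilon> * (ennreal 1 + ennreal (h y)) \<partial>?N)"
      using \<epsilon> h0 unfolding f_eq by (intro nn_integral_cong) (simp add: ennreal_mult' ennreal_plus)
    also have "\<dots> = ennreal \<epsilon> * ((\<integral>\<^sup>+y. ennreal 1 \<partial>?N) + (\<integral>\<^sup>+y. ennreal (h y) \<partial>?N))"
      by (subst nn_integral_cmult, simp, subst nn_integral_add) simp_all
    also have "(\<integral>\<^sup>+y. ennreal 1 \<partial>?N) = 1"
      using elim by (subst nn_integral_stick_breaking_measure) simp_all
    also have "(\<integral>\<^sup>+y. ennreal (h y) \<partial>?N) = ennreal (stick_mean h w)"
      unfolding stick_mean_def using elim by (subst nn_integral_stick_breaking_measure) simp_all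
    also have "ennreal \<epsilon> * (1 + ennreal (stick_mean h w)) = ennreal (\<epsilon> * (1 + stick_mean h w))"
      using \<epsilon> by (simp add: ennreal_mult' ennreal_plus stick_mean_def)
    finally show ?case by (simp add: pitman_yor_process_def)
  qed
  have f0: "0 \<le> f x" for x using \<epsilon> order.trans[OF less_imp_le] by blast
  have int_eq: "AE w in M. has_bochner_integral (pitman_yor_process V \<xi> w) f (\<epsilon> * (1 + stick_mean h w))"
    using S
  proof eventually_elim
    case (elim w)
    then show ?case
      using f0 \<epsilon> by (intro has_bochner_integral_nn_integral)
        (auto simp: pitman_yor_process_def stick_mean_def)
  qed
  then show "AE w in M. integrable (pitman_yor_process V \<xi> w) f"
    by eventually_elim (rule has_bochner_integral_iff[THEN iffD1, THEN conjunct1])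
  have "(\<integral>\<^sup>+w. ennreal ((\<integral>y. f y \<partial>pitman_yor_process V \<xi> w) powr (- \<theta>)) \<partial>M)
      = (\<integral>\<^sup>+w. ennreal (\<epsilon> powr (- \<theta>) * (1 + stick_mean h w) powr (- \<theta>)) \<partial>M)"
  proof (intro nn_integral_cong_AE, use int_eq in eventually_elim)
    case (elim w)
    then have "(\<integral>y. f y \<partial>pitman_yor_process V \<xi> w) = \<epsilon> * (1 + stick_mean h w)"
      by (rule has_bochner_integral_integral_eq)
    then show ?case using \<epsilon> by (simp add: powr_mult stick_mean_def)
  qed
  also have "\<dots> = ennreal (expectation (\<lambda>w. \<epsilon> powr (- \<theta>) * (1 + stick_mean h w) powr (- \<theta>)))"
    using stick_mean_powr_bounds(2)[of 1 \<theta> h] \<theta>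
    by (intro nn_integral_eq_integral integrable_mult_right integrable_const_bound[where B = 1]) auto
  also have "expectation (\<lambda>w. \<epsilon> powr (- \<theta>) * (1 + stick_mean h w) powr (- \<theta>))
      = \<epsilon> powr (- \<theta>) * (\<integral>x. (1 + h x) powr \<alpha> \<partial>G) powr (- \<theta> / \<alpha>)"
    using expectation_stick_mean_powr[OF _ h0 int_h \<alpha> \<theta>] by simp
  also have "\<dots> = (\<integral>x. f x powr \<alpha> \<partial>G) powr (- \<theta> / \<alpha>)"
  proof -
    have "(\<integral>x. f x powr \<alpha> \<partial>G) = \<epsilon> powr \<alpha> * (\<integral>x. (1 + h x) powr \<alpha> \<partial>G)"
      unfolding pow using \<epsilon> by simp
    moreover have "(\<epsilon> powr \<alpha>) powr (- \<theta> / \<alpha>) = \<epsilon> powr (- \<theta>)"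
      using \<alpha> by (simp add: powr_powr)
    moreover have "0 \<le> (\<integral>x. (1 + h x) powr \<alpha> \<partial>G)" by simp
    ultimately show ?thesis by (simp add: powr_mult)
  qed
  finally show "(\<integral>\<^sup>+w. ennreal ((\<integral>y. f y \<partial>pitman_yor_process V \<xi> w) powr (- \<theta>)) \<partial>M)
      = ennreal ((\<integral>x. f x powr \<alpha> \<partial>G) powr (- \<theta> / \<alpha>))" .
qed

end

subsection \<open>The random variance\<close>

text \<open>Away from its vertex \<open>s\<close> the polynomial is inverted by the two branches s +
  sqrt ((y - k) / a) and s - sqrt ((y - k) / a). These are differentiable and hence map null sets to
  null sets.\<close>

lemma AE_quadratic_notin_null_set:
  fixes a b c :: real
  assumes N: "N \<in> null_sets lborel" and a: "a \<noteq> 0"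
  shows "AE v in lborel. a * v\<^sup>2 + b * v + c \<notin> N"
proof -
  define s k where "s = - b / (2 * a)" and "k = c - b\<^sup>2 / (4 * a)"
  have square: "a * v\<^sup>2 + b * v + c = a * (v - s)\<^sup>2 + k" for v
    using a by (simp add: s_def k_def power2_eq_square field_simps)
  define Z where "Z = {v. a * v\<^sup>2 + b * v + c \<in> N}"
  \<comment> \<open>Restricts to values with positive radicand, where the square root is
    differentiable. The vertex itself is a single point and is added separately.\<close>
  define N' where "N' = {y \<in> N. 0 < (y - k) / a}"
  have "negligible N"
    unfolding negligible_iff_null_sets using N by (rule null_sets_completionI)
  then have N': "negligible N'" by (rule negligible_subset) (auto simp: N'_def)
  have image: "negligible ((\<lambda>y. s + e * sqrt ((y - k) / a)) ` N')" for e
  proof (rule negligible_differentiable_image_negligible[OF _ N'])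
    show "(\<lambda>y. s + e * sqrt ((y - k) / a)) differentiable_on N'"
      unfolding differentiable_on_def
    proof
      fix y assume "y \<in> N'"
      then have "0 < (y - k) / a" by (simp add: N'_def)
      then have "((\<lambda>y. s + e * sqrt ((y - k) / a)) has_real_derivative
          e * (inverse (sqrt ((y - k) / a)) / 2 * (1 / a))) (at y)"
        using a by (auto intro!: derivative_eq_intros DERIV_real_sqrt[THEN DERIV_chain2])
      then have "(\<lambda>y. s + e * sqrt ((y - k) / a)) differentiable at y"
        unfolding real_differentiable_def by (rule exI)
      then show "(\<lambda>y. s + e * sqrt ((y - k) / a)) differentiable at y within N'"
        by (rule differentiable_at_withinI)
    qed
  qed simp
  have "Z \<subseteq> insert s ((\<lambda>y. s + 1 * sqrt ((y - k) / a)) ` N' \<union> (\<lambda>y. s + (- 1) * sqrt ((y - k) / a)) ` N')"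
  proof
    fix v assume v: "v \<in> Z"
    define y where "y = a * (v - s)\<^sup>2 + k"
    have y: "y \<in> N" using v by (simp add: Z_def square y_def)
    have root: "(y - k) / a = (v - s)\<^sup>2" using a by (simp add: y_def)
    show "v \<in> insert s ((\<lambda>y. s + 1 * sqrt ((y - k) / a)) ` N' \<union> (\<lambda>y. s + (- 1) * sqrt ((y - k) / a)) ` N')"
    proof (cases "v = s")
      case False
      then have "y \<in> N'" using y root by (simp add: N'_def)
      moreover have "v = s + 1 * sqrt ((y - k) / a) \<or> v = s + (- 1) * sqrt ((y - k) / a)"
        unfolding root by auto
      ultimately show ?thesis by blast
    qed simp
  qed
  then have "negligible Z"
    by (rule negligible_subset[rotated]) (intro negligible_insert[THEN iffD2] negligible_Un image)
  then have Z: "Z \<in> null_sets lebesgue" by (simp add: negligible_iff_null_sets)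
  \<comment> \<open>Negligibility refers to the completed measure; Borel measurability of the
    preimage brings the result back to \<open>lborel\<close>.\<close>
  have "Z = (\<lambda>v. a * v\<^sup>2 + b * v + c) -` N \<inter> space lborel" by (auto simp: Z_def)
  also have "\<dots> \<in> sets lborel"
    using N by (intro measurable_sets[where A = borel]) auto
  finally have "Z \<in> null_sets lborel"
    using Z by (simp add: null_sets_def emeasure_completion)
  then show ?thesis by (rule AE_I') (auto simp: Z_def)
qed

lemma AE_beta_distributionI:
  assumes "AE v in lborel. P v"
  shows "AE v in beta_distribution a b. P v"
  unfolding beta_distribution_def using assms by (subst AE_density) auto

text \<open>Isolates the form in which the moment condition enters the study of the variance:
  integrability of the power \<alpha> of nonnegative quadratic polynomials. Nonnegativity is asked
  on the whole line because the bounds in \<open>Markov_Krein\<close> are pointwise.\<close>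

locale pitman_yor_quadratic = pitman_yor +
  assumes alpha_pos: "0 < \<alpha>" and theta_pos: "0 < \<theta>"
    and integrable_quadratic_powr:
      "\<And>a b c :: real. (\<And>x. 0 \<le> a + b * x + c * x\<^sup>2) \<Longrightarrow> integrable G (\<lambda>x. (a + b * x + c * x\<^sup>2) powr \<alpha>)"
begin

definition moment1 where "moment1 w = (\<integral>x. x \<partial>pitman_yor_process V \<xi> w)"
definition moment2 where "moment2 w = (\<integral>x. x\<^sup>2 \<partial>pitman_yor_process V \<xi> w)"

lemma measurable_moments [measurable]:
  "moment1 \<in> borel_measurable M" "moment2 \<in> borel_measurable M"
  unfolding moment1_def moment2_def pitman_yor_process_def
  by (intro measurable_integral_stick_breaking_measure random_stick random_atom; simp)+

text \<open>Comes from \<open>Markov_Krein\<close> for 1 + x^2, which is bounded below by 1,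
  together with total mass 1 and \<bar>x\<bar> \<le> 1 + x^2.\<close>

lemma AE_integrable_moments:
  "AE w in M. prob_space (pitman_yor_process V \<xi> w) \<and> integrable (pitman_yor_process V \<xi> w) (\<lambda>x. x\<^sup>2)
    \<and> integrable (pitman_yor_process V \<xi> w) (\<lambda>x. x)"
proof -
  have "integrable G (\<lambda>x. (1 + x\<^sup>2) powr \<alpha>)"
    using integrable_quadratic_powr[of 1 0 1] by simp
  then have "AE w in M. integrable (pitman_yor_process V \<xi> w) (\<lambda>x. 1 + x\<^sup>2)"
    by (intro Markov_Krein(1)[of _ 1] alpha_pos theta_pos) auto
  then show ?thesis
    using AE_prob_space_process[OF alpha_pos theta_pos]
  proof eventually_elim
    case (elim w)
    interpret P: prob_space "pitman_yor_process V \<xi> w" by fact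
    have sq: "integrable (pitman_yor_process V \<xi> w) (\<lambda>x. x\<^sup>2)"
      using Bochner_Integration.integrable_diff[OF elim(1) P.integrable_const[of 1]] by simp
    have "integrable (pitman_yor_process V \<xi> w) (\<lambda>x. x)"
    proof (rule Bochner_Integration.integrable_bound[OF elim(1)])
      have "\<bar>x\<bar> \<le> 1 + x\<^sup>2" for x :: real
      proof -
        have "0 \<le> (\<bar>x\<bar> - 1)\<^sup>2 + \<bar>x\<bar>" by simp
        then show ?thesis by (simp add: power2_diff)
      qed
      then show "AE x in pitman_yor_process V \<xi> w. norm x \<le> norm (1 + x\<^sup>2)" by (auto simp: add_nonneg_nonneg)
    qed (simp add: pitman_yor_process_def)
    then show ?case using sq P.prob_space_axioms by simp
  qed
qed

lemma AE_moment1_le_moment2: "AE w in M. (moment1 w)\<^sup>2 \<le> moment2 w"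
  using AE_integrable_moments
proof eventually_elim
  case (elim w)
  then interpret P: prob_space "pitman_yor_process V \<xi> w" by simp
  have "0 \<le> P.variance (\<lambda>x. x)" by (rule P.variance_positive)
  also have "\<dots> = moment2 w - (moment1 w)\<^sup>2"
    unfolding moment1_def moment2_def using elim by (intro P.variance_eq) auto
  finally show ?case by simp
qed

text \<open>The coefficients are quantified inside the almost sure statement: one exceptional null
  set serves all polynomials.\<close>

lemma AE_integral_quadratic:
  "AE w in M. \<forall>a b c. (\<integral>x. a + b * x + c * x\<^sup>2 \<partial>pitman_yor_process V \<xi> w) = a + b * moment1 w + c * moment2 w"
  using AE_integrable_moments
proof eventually_elim
  case (elim w)
  then interpret P: prob_space "pitman_yor_process V \<xi> w" by simp
  show ?case using elim by (simp add: moment1_def moment2_def P.prob_space)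
qed

lemma nn_integral_quadratic_moments_powr:
  assumes "0 < \<epsilon>" "\<And>x. \<epsilon> \<le> a + b * x + c * x\<^sup>2"
  shows "(\<integral>\<^sup>+w. ennreal ((a + b * moment1 w + c * moment2 w) powr (- \<theta>)) \<partial>M)
    = ennreal ((\<integral>x. (a + b * x + c * x\<^sup>2) powr \<alpha> \<partial>G) powr (- \<theta> / \<alpha>))"
proof -
  have "(\<integral>\<^sup>+w. ennreal ((a + b * moment1 w + c * moment2 w) powr (- \<theta>)) \<partial>M)
      = (\<integral>\<^sup>+w. ennreal ((\<integral>x. a + b * x + c * x\<^sup>2 \<partial>pitman_yor_process V \<xi> w) powr (- \<theta>)) \<partial>M)"
    using AE_integral_quadratic by (intro nn_integral_cong_AE) (auto elim!: eventually_mono)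
  also have "\<dots> = ennreal ((\<integral>x. (a + b * x + c * x\<^sup>2) powr \<alpha> \<partial>G) powr (- \<theta> / \<alpha>))"
    using assms order.trans[OF less_imp_le[OF assms(1)] assms(2)]
    by (intro Markov_Krein(2)[of _ \<epsilon>] alpha_pos theta_pos integrable_quadratic_powr) auto
  finally show ?thesis .
qed

text \<open>Conditionally on the first atom and on the rest of the process, the variance is a quadratic
  polynomial in the first stick, with leading coefficient minus the square of the distance between
  the first atom and the mean of the rest. Since the base measure is atomless, this coefficient
  does not vanish.\<close>

lemma absolutely_continuous_variance:
  assumes atomless: "\<And>x. emeasure G {x} = 0"
  shows "absolutely_continuous lborel (distr M borel (\<lambda>w. moment2 w - (moment1 w)\<^sup>2))"
  unfolding absolutely_continuous_def
proof
  fix N :: "real set" assume N: "N \<in> null_sets lborel"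
  then have N_sets [measurable]: "N \<in> sets borel" by auto
  have [measurable_cong]: "sets G = sets borel" by (rule sets_base)
  interpret S: pitman_yor M \<alpha> "\<theta> + \<alpha>" G "\<lambda>n. V (Suc n)" "\<lambda>n. \<xi> (Suc n)" by (rule shift)
  \<comment> \<open>Series of type \<open>stick_sum\<close> are faithful for nonnegative functions
    only, and x may be negative. Both f and g are nonnegative, and x^2 = f - 1 and x = g - f recover
    the two moments.\<close>
  define f g :: "real \<Rightarrow> real" where "f x = 1 + x\<^sup>2" and "g x = 1 + x + x\<^sup>2" for x
  have [measurable]: "f \<in> borel_measurable borel" "g \<in> borel_measurable borel"
    unfolding f_def g_def by measurable
  have g_pos: "0 \<le> g x" for x
  proof -
    have "0 \<le> (x + 1 / 2)\<^sup>2 + 3 / 4" by simp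
    then show ?thesis by (simp add: g_def power2_sum power_divide)
  qed
  have f_pos: "0 \<le> f x" for x by (simp add: f_def)
  have int: "integrable G (\<lambda>x. (1 + f x) powr \<alpha>)" "integrable G (\<lambda>x. (1 + g x) powr \<alpha>)"
  proof -
    have "0 \<le> 2 + x + x\<^sup>2" for x :: real using g_pos[of x] by (simp add: g_def)
    then show "integrable G (\<lambda>x. (1 + f x) powr \<alpha>)" "integrable G (\<lambda>x. (1 + g x) powr \<alpha>)"
      using integrable_quadratic_powr[of 2 0 1] integrable_quadratic_powr[of 2 1 1]
      by (simp_all add: f_def g_def add.assoc[symmetric])
  qed
  \<comment> \<open>The variance as a function of the first stick \<open>v\<close>, the first atom
    \<open>x\<close> and the integrals \<open>p\<close>, \<open>q\<close> of f and g under the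
    remainder: second moment as integral of f minus 1, first moment as integral of g minus integral
    of f.\<close>
  define Q where "Q = (\<lambda>(v, x, p, q). (v * f x + (1 - v) * enn2real p - 1)
      - ((v * g x + (1 - v) * enn2real q) - (v * f x + (1 - v) * enn2real p))\<^sup>2)"
  have Q [measurable]: "Q \<in> borel_measurable (borel \<Otimes>\<^sub>M (borel \<Otimes>\<^sub>M (borel \<Otimes>\<^sub>M borel)))"
    unfolding Q_def by measurable
  let ?p = "\<lambda>w. stick_sum f (\<lambda>n. V (Suc n) w) (\<lambda>n. \<xi> (Suc n) w)"
  let ?q = "\<lambda>w. stick_sum g (\<lambda>n. V (Suc n) w) (\<lambda>n. \<xi> (Suc n) w)"
  have fin: "AE w in M. ?p w < \<infinity>" "AE w in M. ?q w < \<infinity>"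
    using alpha_pos theta_pos by (intro S.AE_stick_sum_finite f_pos g_pos int; simp)+
  have "AE w in M. moment2 w - (moment1 w)\<^sup>2 = Q (V 1 w, \<xi> 1 w, ?p w, ?q w)"
    using AE_sticks AE_integral_quadratic fin
  proof eventually_elim
    case (elim w)
    have mean: "(\<integral>x. F x \<partial>pitman_yor_process V \<xi> w) = V 1 w * F (\<xi> 1 w)
        + (1 - V 1 w) * enn2real (stick_sum F (\<lambda>n. V (Suc n) w) (\<lambda>n. \<xi> (Suc n) w))"
      if [measurable]: "F \<in> borel_measurable borel" and F: "\<And>x. 0 \<le> F x"
        and fin: "stick_sum F (\<lambda>n. V (Suc n) w) (\<lambda>n. \<xi> (Suc n) w) < top" for F
    proof -
      let ?s = "stick_sum F (\<lambda>n. V (Suc n) w) (\<lambda>n. \<xi> (Suc n) w)"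
      have V: "0 \<le> V 1 w" "V 1 w \<le> 1" using elim(1) by (auto simp: less_imp_le)
      have "(\<integral>x. F x \<partial>pitman_yor_process V \<xi> w) = enn2real (stick_sum F (\<lambda>n. V n w) (\<lambda>n. \<xi> n w))"
        unfolding pitman_yor_process_def
        by (subst integral_eq_nn_integral) (auto simp: F nn_integral_stick_breaking_measure)
      also have "stick_sum F (\<lambda>n. V n w) (\<lambda>n. \<xi> n w)
          = ennreal (V 1 w) * ennreal (F (\<xi> 1 w)) + ennreal (1 - V 1 w) * ennreal (enn2real ?s)"
        using fin V by (subst stick_sum_Suc) simp_all
      also have "\<dots> = ennreal (V 1 w * F (\<xi> 1 w) + (1 - V 1 w) * enn2real ?s)"
        using V F by (subst ennreal_plus) (simp_all add: ennreal_mult)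
      also have "enn2real \<dots> = V 1 w * F (\<xi> 1 w) + (1 - V 1 w) * enn2real ?s"
        using V F by (intro enn2real_ennreal add_nonneg_nonneg mult_nonneg_nonneg) simp_all
      finally show ?thesis .
    qed
    have "(\<integral>x. f x \<partial>pitman_yor_process V \<xi> w) = 1 + moment2 w"
      "(\<integral>x. g x \<partial>pitman_yor_process V \<xi> w) = 1 + moment1 w + moment2 w"
      using elim(2)[rule_format, of 1 0 1] elim(2)[rule_format, of 1 1 1] by (simp_all add: f_def g_def)
    moreover have "?p w < top" "?q w < top" using elim(3,4) by simp_all
    ultimately have "V 1 w * f (\<xi> 1 w) + (1 - V 1 w) * enn2real (?p w) = 1 + moment2 w"
      "V 1 w * g (\<xi> 1 w) + (1 - V 1 w) * enn2real (?q w) = 1 + moment1 w + moment2 w"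
      using mean[of f] mean[of g] f_pos g_pos by simp_all
    then show ?case unfolding Q_def by (simp only: prod.case) simp
  qed
  then have "(\<integral>\<^sup>+w. indicator N (moment2 w - (moment1 w)\<^sup>2) \<partial>M)
      = (\<integral>\<^sup>+w. indicator N (Q (V 1 w, \<xi> 1 w, ?p w, ?q w)) \<partial>M)"
    by (intro nn_integral_cong_AE) (erule eventually_mono, simp only:)
  also have "\<dots> = (\<integral>\<^sup>+w. (\<integral>\<^sup>+x. (\<integral>\<^sup>+v. indicator N (Q (v, x, ?p w, ?q w))
      \<partial>beta_distribution (1 - \<alpha>) (\<theta> + \<alpha>)) \<partial>G) \<partial>M)"
    by (rule nn_integral_first_stick[where F = "\<lambda>t. indicator N (Q t)"]) measurable
  also have "\<dots> = (\<integral>\<^sup>+w. 0 \<partial>M)"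
  proof (rule nn_integral_cong)
    fix w
    \<comment> \<open>\<open>d\<close> is the mean of the remainder. It is fixed when the first atom
      is integrated out, so an atomless base measure gives probability 0 to the atom being equal to
      \<open>d\<close>.\<close>
    define p d where "p = enn2real (?p w)" and "d = enn2real (?q w) - enn2real (?p w)"
    have "AE x in G. x \<noteq> d"
      using atomless[of d] sets_base by (intro AE_I'[of "{d}"]) (auto simp: null_sets_def)
    then have "AE x in G. (\<integral>\<^sup>+v. indicator N (Q (v, x, ?p w, ?q w)) \<partial>beta_distribution (1 - \<alpha>) (\<theta> + \<alpha>)) = 0"
    proof eventually_elim
      case (elim x)
      have quad: "Q (v, x, ?p w, ?q w) = - (x - d)\<^sup>2 * v\<^sup>2 + (1 + x\<^sup>2 - p - 2 * d * (x - d)) * v + (p - 1 - d\<^sup>2)" for v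
        by (simp add: Q_def p_def d_def f_def g_def power2_eq_square algebra_simps)
      have "AE v in beta_distribution (1 - \<alpha>) (\<theta> + \<alpha>). Q (v, x, ?p w, ?q w) \<notin> N"
        unfolding quad using elim
        by (intro AE_beta_distributionI AE_quadratic_notin_null_set N) simp
      then have "AE v in beta_distribution (1 - \<alpha>) (\<theta> + \<alpha>). indicator N (Q (v, x, ?p w, ?q w)) = (0 :: ennreal)"
        by eventually_elim simp
      from nn_integral_cong_AE[OF this] show ?case by simp
    qed
    from nn_integral_cong_AE[OF this]
    show "(\<integral>\<^sup>+x. (\<integral>\<^sup>+v. indicator N (Q (v, x, ?p w, ?q w)) \<partial>beta_distribution (1 - \<alpha>) (\<theta> + \<alpha>)) \<partial>G) = 0"
      by simp
  qed
  finally have "(\<integral>\<^sup>+w. indicator N (moment2 w - (moment1 w)\<^sup>2) \<partial>M) = 0" by simp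
  then have "emeasure (distr M borel (\<lambda>w. moment2 w - (moment1 w)\<^sup>2)) N = 0"
    by (subst nn_integral_indicator[symmetric], simp, subst nn_integral_distr) simp_all
  then show "N \<in> null_sets (distr M borel (\<lambda>w. moment2 w - (moment1 w)\<^sup>2))" by auto
qed

end

section \<open>The moment condition and the two formulas\<close>

text \<open>On the half-line a quadratic polynomial is bounded by a multiple of m = max(1, x^2), and
  m^\<alpha> is at most 1 + x^(2 \<alpha>).\<close>

lemma integrable_quadratic_powr_of_moment:
  fixes a b c \<alpha> :: real
  assumes G: "finite_measure G" and sets: "sets G = sets borel" and \<alpha>: "0 < \<alpha>"
    and pos: "AE x in G. 0 \<le> x"
    and moment: "(\<integral>\<^sup>+ x\<in>{0..}. ennreal (x powr (2 * \<alpha>)) \<partial>G) < \<infinity>"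
    and nonneg: "\<And>x. 0 \<le> a + b * x + c * x\<^sup>2"
  shows "integrable G (\<lambda>x. (a + b * x + c * x\<^sup>2) powr \<alpha>)"
proof -
  interpret G: finite_measure G by (rule G)
  have [measurable_cong]: "sets G = sets borel" by (rule sets)
  have "(\<integral>\<^sup>+ x. ennreal (x powr (2 * \<alpha>)) \<partial>G) = (\<integral>\<^sup>+ x\<in>{0..}. ennreal (x powr (2 * \<alpha>)) \<partial>G)"
    using pos by (intro nn_integral_cong_AE) (auto elim!: eventually_mono)
  then have int: "integrable G (\<lambda>x. x powr (2 * \<alpha>))"
    using moment by (intro integrableI_nonneg) auto
  define K where "K = \<bar>a\<bar> + \<bar>b\<bar> + \<bar>c\<bar>"
  have K: "0 \<le> K" by (simp add: K_def)
  show ?thesis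
  proof (rule Bochner_Integration.integrable_bound)
    show "integrable G (\<lambda>x. (2 * K) powr \<alpha> * (1 + x powr (2 * \<alpha>)))"
      using int by (intro integrable_mult_right Bochner_Integration.integrable_add) auto
    show "AE x in G. norm ((a + b * x + c * x\<^sup>2) powr \<alpha>) \<le> norm ((2 * K) powr \<alpha> * (1 + x powr (2 * \<alpha>)))"
      using pos
    proof eventually_elim
      case (elim x)
      define m where "m = max 1 (x\<^sup>2)"
      have "x \<le> m"
      proof (cases "x \<le> 1")
        case False
        then have "x * 1 \<le> x * x" by (intro mult_left_mono) auto
        then show ?thesis by (simp add: m_def power2_eq_square le_max_iff_disj)
      qed (simp add: m_def le_max_iff_disj)
      then have "b * x \<le> \<bar>b\<bar> * m"
        using elim by (intro mult_mono) auto
      moreover have "c * x\<^sup>2 \<le> \<bar>c\<bar> * m" by (intro mult_mono) (auto simp: m_def)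
      moreover have "a \<le> \<bar>a\<bar> * m"
        using mult_left_mono[of 1 m "\<bar>a\<bar>"] by (simp add: m_def)
      ultimately have "a + b * x + c * x\<^sup>2 \<le> K * m" by (simp add: K_def algebra_simps)
      also have "\<dots> \<le> 2 * K * m"
        using K by (simp add: m_def)
      finally have "(a + b * x + c * x\<^sup>2) powr \<alpha> \<le> (2 * K * m) powr \<alpha>"
        using nonneg \<alpha> by (intro powr_mono2) auto
      also have "\<dots> = (2 * K) powr \<alpha> * m powr \<alpha>"
        using K by (simp add: powr_mult m_def)
      also have "m powr \<alpha> \<le> 1 + x powr (2 * \<alpha>)"
      proof (cases "x = 0")
        case False
        then have "(x\<^sup>2) powr \<alpha> = x powr (2 * \<alpha>)"
          using elim by (simp add: powr_powr flip: powr_numeral)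
        then show ?thesis by (auto simp: m_def max_def)
      qed (simp add: m_def)
      then have "(2 * K) powr \<alpha> * m powr \<alpha> \<le> (2 * K) powr \<alpha> * (1 + x powr (2 * \<alpha>))"
        by (intro mult_left_mono) auto
      finally show ?case by (simp add: abs_mult)
    qed
  qed measurable
qed

text \<open>The density vanishes on the boundary of \<open>Delta2\<close> for all exponents, because
  \<open>0 powr _\<close> is 0.\<close>

lemma AE_dirichlet_distribution:
  "AE p in dirichlet_distribution a b c. 0 < fst p \<and> 0 < snd p \<and> fst p + snd p < 1"
proof -
  have [measurable]: "Delta2 \<in> sets (borel \<Otimes>\<^sub>M borel)"
    unfolding borel_prod by (rule sets_Delta2)
  have [measurable]: "(\<lambda>(x, y). ennreal (indicator Delta2 (x, y) * (Gamma (a + b + c) / (Gamma a * Gamma b * Gamma c)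
        * x powr (a - 1) * y powr (b - 1) * (1 - x - y) powr (c - 1)))) \<in> borel_measurable (lborel :: (real \<times> real) measure)"
    unfolding lborel_prod[symmetric] by measurable
  show ?thesis
    unfolding dirichlet_distribution_def
  proof (subst AE_density)
    show "AE p in lborel. 0 < (case p of (x, y) \<Rightarrow> ennreal (indicator Delta2 (x, y) *
        (Gamma (a + b + c) / (Gamma a * Gamma b * Gamma c) * x powr (a - 1) * y powr (b - 1) * (1 - x - y) powr (c - 1)))) \<longrightarrow>
        0 < fst p \<and> 0 < snd p \<and> fst p + snd p < 1"
    proof (intro AE_I2 impI)
      fix p :: "real \<times> real"
      obtain x y where p: "p = (x, y)" by (cases p)
      assume "0 < (case p of (x, y) \<Rightarrow> ennreal (indicator Delta2 (x, y) *
        (Gamma (a + b + c) / (Gamma a * Gamma b * Gamma c) * x powr (a - 1) * y powr (b - 1) * (1 - x - y) powr (c - 1))))"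
      then have "(x, y) \<in> Delta2" "x \<noteq> 0" "y \<noteq> 0" "1 - x - y \<noteq> 0"
        unfolding p by (auto simp: indicator_def of_bool_def split: if_splits)
      then show "0 < fst p \<and> 0 < snd p \<and> fst p + snd p < 1"
        unfolding p by (auto simp: Delta2_def)
    qed
  qed measurable
qed

lemma sets_dirichlet_distribution [simp, measurable_cong]:
  "sets (dirichlet_distribution a b c) = sets borel"
  by (simp add: dirichlet_distribution_def)

lemma prob_space_dirichlet_distribution:
  assumes "0 < a" "0 < b" "0 < c"
  shows "prob_space (dirichlet_distribution a b c)"
proof
  interpret B1: prob_space "beta_distribution a (b + c)" using assms by (intro prob_space_beta_distribution) auto
  interpret B2: prob_space "beta_distribution b c" using assms by (intro prob_space_beta_distribution) auto
  have "(\<integral>\<^sup>+p. 1 \<partial>dirichlet_distribution a b c) = 1"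
    using assms B1.emeasure_space_1 B2.emeasure_space_1
    by (subst nn_integral_dirichlet_distribution) auto
  then show "emeasure (dirichlet_distribution a b c) (space (dirichlet_distribution a b c)) = 1"
    by simp
qed

context pitman_yor_quadratic
begin

text \<open>Common form of \<open>Psi\<close> and \<open>Phi\<close>, with the integral over the
  whole line. For a polynomial bounded below by a positive constant, it is the expectation of the
  power - \<theta> of the random value a + b m1 + c m2.\<close>

definition quadratic_transform :: "real \<Rightarrow> real \<Rightarrow> real \<Rightarrow> real" where
  "quadratic_transform a b c = (\<integral>x. (a + b * x + c * x\<^sup>2) powr \<alpha> \<partial>G) powr (- \<theta> / \<alpha>)"

text \<open>Tonelli between the mixing variable and the process, with the Markov-Krein identity
  applied for each value of the mixing variable. The lower bound \<open>\<epsilon>\<close> depends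
  on that value: in the applications it degenerates near the boundary of the mixing domain.\<close>

lemma
  fixes a b c \<epsilon> :: "'b \<Rightarrow> real"
  assumes B: "prob_space B"
    and [measurable]: "a \<in> borel_measurable B" "b \<in> borel_measurable B" "c \<in> borel_measurable B"
    and bound: "AE p in B. 0 < \<epsilon> p \<and> (\<forall>x. \<epsilon> p \<le> a p + b p * x + c p * x\<^sup>2 \<and> \<epsilon> p \<le> a p - b p * x + c p * x\<^sup>2)"
  shows measurable_symmetrized_quadratic_transform:
      "(\<lambda>p. (quadratic_transform (a p) (b p) (c p) + quadratic_transform (a p) (- b p) (c p)) / 2) \<in> borel_measurable B"
    and nn_integral_symmetrized_quadratic_transform:
      "(\<integral>\<^sup>+p. ennreal ((quadratic_transform (a p) (b p) (c p) + quadratic_transform (a p) (- b p) (c p)) / 2) \<partial>B)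
      = (\<integral>\<^sup>+w. (\<integral>\<^sup>+p. ennreal (1 / 2 * ((a p + b p * moment1 w + c p * moment2 w) powr (- \<theta>)
          + (a p - b p * moment1 w + c p * moment2 w) powr (- \<theta>))) \<partial>B) \<partial>M)"
proof -
  have [measurable_cong]: "sets G = sets borel" by (rule sets_base)
  interpret G: prob_space G by (rule base_prob)
  interpret B: prob_space B by (rule B)
  interpret BM: pair_prob_space B M ..
  show "(\<lambda>p. (quadratic_transform (a p) (b p) (c p) + quadratic_transform (a p) (- b p) (c p)) / 2) \<in> borel_measurable B"
    unfolding quadratic_transform_def by measurable
  have "(\<integral>\<^sup>+p. ennreal ((quadratic_transform (a p) (b p) (c p) + quadratic_transform (a p) (- b p) (c p)) / 2) \<partial>B)
      = (\<integral>\<^sup>+p. (\<integral>\<^sup>+w. ennreal (1 / 2 * ((a p + b p * moment1 w + c p * moment2 w) powr (- \<theta>)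
          + (a p - b p * moment1 w + c p * moment2 w) powr (- \<theta>))) \<partial>M) \<partial>B)"
  proof (rule nn_integral_cong_AE, use bound in eventually_elim)
    case (elim p)
    have plus: "(\<integral>\<^sup>+w. ennreal ((a p + b p * moment1 w + c p * moment2 w) powr (- \<theta>)) \<partial>M)
        = ennreal (quadratic_transform (a p) (b p) (c p))"
      unfolding quadratic_transform_def using elim by (intro nn_integral_quadratic_moments_powr[of "\<epsilon> p"]) auto
    have minus: "(\<integral>\<^sup>+w. ennreal ((a p - b p * moment1 w + c p * moment2 w) powr (- \<theta>)) \<partial>M)
        = ennreal (quadratic_transform (a p) (- b p) (c p))"
      unfolding quadratic_transform_def using elim
        nn_integral_quadratic_moments_powr[of "\<epsilon> p" "a p" "- b p" "c p"] by auto
    have "(\<integral>\<^sup>+w. ennreal (1 / 2 * ((a p + b p * moment1 w + c p * moment2 w) powr (- \<theta>)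
          + (a p - b p * moment1 w + c p * moment2 w) powr (- \<theta>))) \<partial>M)
        = (\<integral>\<^sup>+w. ennreal (1 / 2) * (ennreal ((a p + b p * moment1 w + c p * moment2 w) powr (- \<theta>))
          + ennreal ((a p - b p * moment1 w + c p * moment2 w) powr (- \<theta>))) \<partial>M)"
      by (intro nn_integral_cong, subst ennreal_mult', simp, subst ennreal_plus) simp_all
    also have "\<dots> = ennreal (1 / 2) * ((\<integral>\<^sup>+w. ennreal ((a p + b p * moment1 w + c p * moment2 w) powr (- \<theta>)) \<partial>M)
          + (\<integral>\<^sup>+w. ennreal ((a p - b p * moment1 w + c p * moment2 w) powr (- \<theta>)) \<partial>M))"
      by (subst nn_integral_cmult, simp, subst nn_integral_add) simp_all
    also have "\<dots> = ennreal (1 / 2 * (quadratic_transform (a p) (b p) (c p) + quadratic_transform (a p) (- b p) (c p)))"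
      unfolding plus minus
      by (subst ennreal_mult', simp, subst ennreal_plus) (simp_all add: quadratic_transform_def)
    finally show ?case by simp
  qed
  also have "\<dots> = (\<integral>\<^sup>+w. (\<integral>\<^sup>+p. ennreal (1 / 2 * ((a p + b p * moment1 w + c p * moment2 w) powr (- \<theta>)
          + (a p - b p * moment1 w + c p * moment2 w) powr (- \<theta>))) \<partial>B) \<partial>M)"
    by (rule BM.Fubini'[symmetric]) measurable
  finally show "(\<integral>\<^sup>+p. ennreal ((quadratic_transform (a p) (b p) (c p) + quadratic_transform (a p) (- b p) (c p)) / 2) \<partial>B) = \<dots>" .
qed

text \<open>For each path the power of the variance is written as a Beta mixture of powers that are
  linear inside; exchanging the mixture with the expectation makes the linear powers
  computable.\<close>

lemma expectation_variance_powr: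
  assumes \<theta>: "1 / 2 < \<theta>" and t: "0 \<le> t"
  shows "expectation (\<lambda>w. (1 / (1 + t * (moment2 w - (moment1 w)\<^sup>2))) powr (\<theta> - 1 / 2))
    = (\<integral>r. (quadratic_transform 1 (2 * sqrt (t * r * (1 - r))) (t * (1 - r))
          + quadratic_transform 1 (- (2 * sqrt (t * r * (1 - r)))) (t * (1 - r))) / 2
        \<partial>beta_distribution (1 / 2) (\<theta> - 1 / 2))"
proof -
  let ?B = "beta_distribution (1 / 2) (\<theta> - 1 / 2)"
  let ?b = "\<lambda>r. 2 * sqrt (t * r * (1 - r))" and ?c = "\<lambda>r. t * (1 - r)"
  let ?q = "\<lambda>r. (quadratic_transform 1 (?b r) (?c r) + quadratic_transform 1 (- ?b r) (?c r)) / 2"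
  have B: "prob_space ?B" using \<theta> by (intro prob_space_beta_distribution) auto
  have bound: "AE r in ?B. 0 < 1 - r \<and> (\<forall>x. 1 - r \<le> 1 + ?b r * x + ?c r * x\<^sup>2 \<and> 1 - r \<le> 1 - ?b r * x + ?c r * x\<^sup>2)"
    using AE_beta_distribution[of "1 / 2" "\<theta> - 1 / 2"]
  proof eventually_elim
    case (elim r)
    \<comment> \<open>The two polynomials exceed 1 - r exactly by such a square, with s = 1 and s =
      - 1.\<close>
    have "0 \<le> (sqrt r + s * (sqrt (t * (1 - r)) * x))\<^sup>2" for s x by simp
    also have "(sqrt r + s * (sqrt (t * (1 - r)) * x))\<^sup>2 = r + s * (?b r * x) + s\<^sup>2 * (?c r * x\<^sup>2)" for s x
    proof -
      have "sqrt (t * r * (1 - r)) = sqrt r * sqrt (t * (1 - r))"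
        by (simp add: mult_ac flip: real_sqrt_mult)
      then show ?thesis using elim t by (simp add: power2_sum power_mult_distrib)
    qed
    finally have "0 \<le> r + s * (?b r * x) + s\<^sup>2 * (?c r * x\<^sup>2)" for s x .
    from this[of 1] this[of "- 1"] show ?case using elim by (simp add: algebra_simps)
  qed
  have "expectation (\<lambda>w. (1 / (1 + t * (moment2 w - (moment1 w)\<^sup>2))) powr (\<theta> - 1 / 2))
      = enn2real (\<integral>\<^sup>+w. ennreal ((1 / (1 + t * (moment2 w - (moment1 w)\<^sup>2))) powr (\<theta> - 1 / 2)) \<partial>M)"
    by (rule integral_eq_nn_integral) auto
  also have "(\<integral>\<^sup>+w. ennreal ((1 / (1 + t * (moment2 w - (moment1 w)\<^sup>2))) powr (\<theta> - 1 / 2)) \<partial>M)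
      = (\<integral>\<^sup>+w. (\<integral>\<^sup>+r. ennreal (1 / 2 * ((1 + ?b r * moment1 w + ?c r * moment2 w) powr (- \<theta>)
          + (1 - ?b r * moment1 w + ?c r * moment2 w) powr (- \<theta>))) \<partial>?B) \<partial>M)"
  proof (rule nn_integral_cong_AE, use AE_moment1_le_moment2 in eventually_elim)
    case (elim w)
    \<comment> \<open>With this choice d - b^2 is 1 + t times the variance, and r + d (1 - r) = 1 +
      t (1 - r) m2.\<close>
    define b d where "b = sqrt t * moment1 w" and "d = 1 + t * moment2 w"
    have bd: "d - b\<^sup>2 = 1 + t * (moment2 w - (moment1 w)\<^sup>2)"
      using t by (simp add: b_def d_def power_mult_distrib algebra_simps)
    have pos: "0 < 1 + t * (moment2 w - (moment1 w)\<^sup>2)"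
      using t elim by (intro add_pos_nonneg) auto
    have "ennreal ((1 / (1 + t * (moment2 w - (moment1 w)\<^sup>2))) powr (\<theta> - 1 / 2)) = ennreal ((d - b\<^sup>2) powr (1 / 2 - \<theta>))"
      unfolding bd using pos powr_minus_divide[of "1 + t * (moment2 w - (moment1 w)\<^sup>2)" "\<theta> - 1 / 2"]
      by (simp add: powr_divide)
    also have "\<dots> = (\<integral>\<^sup>+r. ennreal (1 / 2 * ((r + 2 * b * sqrt (r * (1 - r)) + d * (1 - r)) powr (- \<theta>)
        + (r - 2 * b * sqrt (r * (1 - r)) + d * (1 - r)) powr (- \<theta>))) \<partial>?B)"
      using bd pos by (intro nn_integral_beta_half_quadratic[symmetric] \<theta>) simp
    also have "\<dots> = (\<integral>\<^sup>+r. ennreal (1 / 2 * ((1 + ?b r * moment1 w + ?c r * moment2 w) powr (- \<theta>)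
          + (1 - ?b r * moment1 w + ?c r * moment2 w) powr (- \<theta>))) \<partial>?B)"
    proof (rule nn_integral_cong)
      fix r :: real
      have "sqrt (t * r * (1 - r)) = sqrt t * sqrt (r * (1 - r))"
        by (simp add: mult.assoc flip: real_sqrt_mult)
      then have "r + 2 * b * sqrt (r * (1 - r)) + d * (1 - r) = 1 + ?b r * moment1 w + ?c r * moment2 w"
        "r - 2 * b * sqrt (r * (1 - r)) + d * (1 - r) = 1 - ?b r * moment1 w + ?c r * moment2 w"
        by (simp_all add: b_def d_def algebra_simps)
      then show "ennreal (1 / 2 * ((r + 2 * b * sqrt (r * (1 - r)) + d * (1 - r)) powr (- \<theta>)
          + (r - 2 * b * sqrt (r * (1 - r)) + d * (1 - r)) powr (- \<theta>)))
        = ennreal (1 / 2 * ((1 + ?b r * moment1 w + ?c r * moment2 w) powr (- \<theta>)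
          + (1 - ?b r * moment1 w + ?c r * moment2 w) powr (- \<theta>)))"
        by (simp only:)
    qed
    finally show ?case .
  qed
  also have "\<dots> = (\<integral>\<^sup>+r. ennreal (?q r) \<partial>?B)"
    by (rule nn_integral_symmetrized_quadratic_transform[OF B _ _ _ bound, symmetric]) measurable
  also have "enn2real \<dots> = (\<integral>r. ?q r \<partial>?B)"
    using measurable_symmetrized_quadratic_transform[OF B _ _ _ bound]
    by (intro integral_eq_nn_integral[symmetric]) (simp_all add: quadratic_transform_def)
  finally show ?thesis .
qed

lemma expectation_inverse_variance:
  assumes \<theta>: "3 / 2 < \<theta>" and z: "0 < z"
  shows "expectation (\<lambda>w. 1 / (z + (moment2 w - (moment1 w)\<^sup>2)))
    = z powr (\<theta> - 1) * (\<integral>p. (quadratic_transform z (2 * sqrt (z * fst p * snd p)) (snd p)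
          + quadratic_transform z (- (2 * sqrt (z * fst p * snd p))) (snd p)) / 2
        \<partial>dirichlet_distribution (1 / 2) 1 (\<theta> - 3 / 2))"
proof -
  let ?B = "dirichlet_distribution (1 / 2) 1 (\<theta> - 3 / 2)"
  let ?b = "\<lambda>p. 2 * sqrt (z * fst p * snd p)" and ?c = "\<lambda>p :: real \<times> real. snd p"
  let ?q = "\<lambda>p. (quadratic_transform z (?b p) (?c p) + quadratic_transform z (- ?b p) (?c p)) / 2"
  have B: "prob_space ?B" using \<theta> by (intro prob_space_dirichlet_distribution) auto
  have [measurable]: "fst \<in> borel_measurable ?B" "snd \<in> borel_measurable ?B"
    unfolding measurable_cong_sets[OF sets_dirichlet_distribution refl] borel_prod[symmetric] by measurable
  have bound: "AE p in ?B. 0 < z * (1 - fst p) \<and> (\<forall>x. z * (1 - fst p) \<le> z + ?b p * x + ?c p * x\<^sup>2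
      \<and> z * (1 - fst p) \<le> z - ?b p * x + ?c p * x\<^sup>2)"
    using AE_dirichlet_distribution[of "1 / 2" 1 "\<theta> - 3 / 2"]
  proof eventually_elim
    case (elim p)
    \<comment> \<open>The same lower bound as for the Beta mixture: z times 1 minus the first
      coordinate is what remains of the polynomial after removing this square.\<close>
    have "0 \<le> (sqrt (z * fst p) + s * (sqrt (snd p) * x))\<^sup>2" for s x by simp
    also have "(sqrt (z * fst p) + s * (sqrt (snd p) * x))\<^sup>2 = z * fst p + s * (?b p * x) + s\<^sup>2 * (?c p * x\<^sup>2)" for s x
    proof -
      have "sqrt (z * fst p * snd p) = sqrt (z * fst p) * sqrt (snd p)" by (rule real_sqrt_mult)
      moreover have "(sqrt (z * fst p))\<^sup>2 = z * fst p" "(sqrt (snd p))\<^sup>2 = snd p" using elim z by auto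
      ultimately show ?thesis by (simp only: power2_sum power_mult_distrib) simp
    qed
    finally have "0 \<le> z * fst p + s * (?b p * x) + s\<^sup>2 * (?c p * x\<^sup>2)" for s x .
    from this[of 1] this[of "- 1"] show ?case using elim z by (simp add: algebra_simps)
  qed
  have "expectation (\<lambda>w. 1 / (z + (moment2 w - (moment1 w)\<^sup>2)))
      = enn2real (\<integral>\<^sup>+w. ennreal (1 / (z + (moment2 w - (moment1 w)\<^sup>2))) \<partial>M)"
    using AE_moment1_le_moment2 z by (intro integral_eq_nn_integral) (auto elim!: eventually_mono)
  also have "(\<integral>\<^sup>+w. ennreal (1 / (z + (moment2 w - (moment1 w)\<^sup>2))) \<partial>M)
      = (\<integral>\<^sup>+w. ennreal (z powr (\<theta> - 1)) * (\<integral>\<^sup>+p. ennreal (1 / 2 * ((z + ?b p * moment1 w + ?c p * moment2 w) powr (- \<theta>)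
          + (z - ?b p * moment1 w + ?c p * moment2 w) powr (- \<theta>))) \<partial>?B) \<partial>M)"
  proof (rule nn_integral_cong_AE, use AE_moment1_le_moment2 in eventually_elim)
    case (elim w)
    \<comment> \<open>The factor in front compensates the power of z that the Dirichlet mixture
      produces.\<close>
    have "1 / (z + (moment2 w - (moment1 w)\<^sup>2)) = z powr (\<theta> - 1) * (z powr (1 - \<theta>) / (z + (moment2 w - (moment1 w)\<^sup>2)))"
    proof -
      have "z powr (\<theta> - 1) * z powr (1 - \<theta>) = 1" using z by (simp flip: powr_add)
      then show ?thesis by simp
    qed
    then show ?case
      by (simp only: nn_integral_dirichlet_half_quadratic[OF \<theta> z elim] ennreal_mult'[symmetric] powr_ge_zero)
  qed
  also have "\<dots> = ennreal (z powr (\<theta> - 1)) * (\<integral>\<^sup>+w. (\<integral>\<^sup>+p. ennreal (1 / 2 * ((z + ?b p * moment1 w + ?c p * moment2 w) powr (- \<theta>)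
          + (z - ?b p * moment1 w + ?c p * moment2 w) powr (- \<theta>))) \<partial>?B) \<partial>M)"
  proof (rule nn_integral_cmult)
    interpret B: prob_space ?B by (rule B)
    show "(\<lambda>w. \<integral>\<^sup>+p. ennreal (1 / 2 * ((z + ?b p * moment1 w + ?c p * moment2 w) powr (- \<theta>)
          + (z - ?b p * moment1 w + ?c p * moment2 w) powr (- \<theta>))) \<partial>?B) \<in> borel_measurable M"
      by measurable
  qed
  also have "\<dots> = ennreal (z powr (\<theta> - 1)) * (\<integral>\<^sup>+p. ennreal (?q p) \<partial>?B)"
  proof -
    have "(\<integral>\<^sup>+p. ennreal (?q p) \<partial>?B) = (\<integral>\<^sup>+w. (\<integral>\<^sup>+p. ennreal (1 / 2 * ((z + ?b p * moment1 w + ?c p * moment2 w) powr (- \<theta>)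
          + (z - ?b p * moment1 w + ?c p * moment2 w) powr (- \<theta>))) \<partial>?B) \<partial>M)"
      by (rule nn_integral_symmetrized_quadratic_transform[OF B _ _ _ bound]) measurable
    then show ?thesis by (simp only:)
  qed
  also have "enn2real \<dots> = z powr (\<theta> - 1) * (\<integral>p. ?q p \<partial>?B)"
    using measurable_symmetrized_quadratic_transform[OF B _ _ _ bound]
    by (subst integral_eq_nn_integral) (simp_all add: quadratic_transform_def enn2real_mult)
  finally show ?thesis .
qed

end

theorem theorem1p1:
  fixes M :: "'w measure" and G :: "real measure" and \<alpha> \<theta> :: real
    and V \<xi> :: "nat \<Rightarrow> 'w \<Rightarrow> real" and \<VV> :: "'w \<Rightarrow> real"
  assumes "0 < \<alpha>" "\<alpha> < 1" "\<theta> > 1 / 2"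
    and "prob_space G" "sets G = sets borel"
    and "AE x in G. 0 \<le> x"
    and atomless: "\<And>x. emeasure G {x} = 0"
    and moment: "(\<integral>\<^sup>+ x\<in>{0..}. ennreal (x powr (2 * \<alpha>)) \<partial>G) < \<infinity>"
    and "pitman_yor M \<alpha> \<theta> G V \<xi>"
    and "\<And>\<omega>. \<VV> \<omega> = measure_variance (pitman_yor_process V \<xi> \<omega>)"
  shows "(\<forall>t\<ge>0.
      prob_space.expectation M (\<lambda>\<omega>. (1 / (1 + t * \<VV> \<omega>)) powr (\<theta> - 1 / 2))
      = (LINT r:{0<..<1}|beta_distribution (1 / 2) (\<theta> - 1 / 2).
           1 / 2 * (Psi 1 \<alpha> \<theta> G (sqrt (t * r * (1 - r))) (t * (1 - r))
                  + Psi (- 1) \<alpha> \<theta> G (sqrt (t * r * (1 - r))) (t * (1 - r))))) \<and>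
    (\<theta> > 3 / 2 \<longrightarrow>
      (\<exists>f. (\<forall>x. 0 \<le> f x) \<and> distributed M lborel \<VV> (\<lambda>x. ennreal (f x))) \<and>
      (\<forall>f. (\<forall>x. 0 \<le> f x) \<and> distributed M lborel \<VV> (\<lambda>x. ennreal (f x)) \<longrightarrow>
        (\<forall>z>0.
          prob_space.expectation M (\<lambda>\<omega>. 1 / (z + \<VV> \<omega>))
            = (LINT x:{0..}|lborel. f x / (z + x)) \<and>
          (LINT x:{0..}|lborel. f x / (z + x))
            = z powr (\<theta> - 1) *
              (LINT p:Delta2|dirichlet_distribution (1 / 2) 1 (\<theta> - 3 / 2).
                 (Phi 1 \<alpha> \<theta> G z (fst p) (snd p) + Phi (- 1) \<alpha> \<theta> G z (fst p) (snd p)) / 2))))"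
proof -
  interpret G: prob_space G by fact
  interpret PY: pitman_yor M \<alpha> \<theta> G V \<xi> by fact
  interpret pitman_yor_quadratic M \<alpha> \<theta> G V \<xi>
  proof
    show "integrable G (\<lambda>x. (a + b * x + c * x\<^sup>2) powr \<alpha>)" if "\<And>x. 0 \<le> a + b * x + c * x\<^sup>2" for a b c :: real
      by (rule integrable_quadratic_powr_of_moment[OF G.finite_measure_axioms \<open>sets G = sets borel\<close>
            \<open>0 < \<alpha>\<close> \<open>AE x in G. 0 \<le> x\<close> moment that])
  qed (use assms in auto)
  have [measurable_cong]: "sets G = sets borel" by fact
  have \<VV>: "\<VV> = (\<lambda>w. moment2 w - (moment1 w)\<^sup>2)"
    using assms(10) by (simp add: fun_eq_iff measure_variance_def moment1_def moment2_def)
  have [measurable]: "\<VV> \<in> borel_measurable M" unfolding \<VV> by measurable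
  \<comment> \<open>The base measure is carried by the half-line, so the restricted integrals in
    \<open>Psi\<close> and \<open>Phi\<close> are integrals over the whole line.\<close>
  have half_line: "(LINT x:{0..}|G. (a + b * x + c * x\<^sup>2) powr \<alpha>) = (\<integral>x. (a + b * x + c * x\<^sup>2) powr \<alpha> \<partial>G)" for a b c
    unfolding set_lebesgue_integral_def using \<open>AE x in G. 0 \<le> x\<close>
    by (intro integral_cong_AE) (simp, simp, erule eventually_mono, simp)
  have Psi_eq: "Psi 1 \<alpha> \<theta> G u v = quadratic_transform 1 (2 * u) v"
      "Psi (- 1) \<alpha> \<theta> G u v = quadratic_transform 1 (- (2 * u)) v" for u v
    unfolding Psi_def quadratic_transform_def half_line[symmetric] by simp_all
  have Phi_eq: "Phi 1 \<alpha> \<theta> G z x y = quadratic_transform z (2 * sqrt (z * x * y)) y"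
      "Phi (- 1) \<alpha> \<theta> G z x y = quadratic_transform z (- (2 * sqrt (z * x * y))) y" for z x y
    unfolding Phi_def quadratic_transform_def half_line[symmetric] by simp_all
  have first: "PY.expectation (\<lambda>\<omega>. (1 / (1 + t * \<VV> \<omega>)) powr (\<theta> - 1 / 2))
      = (LINT r:{0<..<1}|beta_distribution (1 / 2) (\<theta> - 1 / 2).
           1 / 2 * (Psi 1 \<alpha> \<theta> G (sqrt (t * r * (1 - r))) (t * (1 - r))
                  + Psi (- 1) \<alpha> \<theta> G (sqrt (t * r * (1 - r))) (t * (1 - r))))" if "0 \<le> t" for t
  proof -
    have [measurable]: "(\<lambda>r. quadratic_transform 1 (s * sqrt (t * r * (1 - r))) (t * (1 - r))) \<in> borel_measurable borel" for s
      unfolding quadratic_transform_def by measurable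
    have "(LINT r:{0<..<1}|beta_distribution (1 / 2) (\<theta> - 1 / 2).
           1 / 2 * (Psi 1 \<alpha> \<theta> G (sqrt (t * r * (1 - r))) (t * (1 - r))
                  + Psi (- 1) \<alpha> \<theta> G (sqrt (t * r * (1 - r))) (t * (1 - r))))
        = (\<integral>r. (quadratic_transform 1 (2 * sqrt (t * r * (1 - r))) (t * (1 - r))
          + quadratic_transform 1 (- (2 * sqrt (t * r * (1 - r)))) (t * (1 - r))) / 2
        \<partial>beta_distribution (1 / 2) (\<theta> - 1 / 2))"
      unfolding set_lebesgue_integral_def Psi_eq
    proof (rule integral_cong_AE)
      show "AE r in beta_distribution (1 / 2) (\<theta> - 1 / 2).
          indicator {0<..<1} r *\<^sub>R (1 / 2 * (quadratic_transform 1 (2 * sqrt (t * r * (1 - r))) (t * (1 - r))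
            + quadratic_transform 1 (- (2 * sqrt (t * r * (1 - r)))) (t * (1 - r))))
          = (quadratic_transform 1 (2 * sqrt (t * r * (1 - r))) (t * (1 - r))
            + quadratic_transform 1 (- (2 * sqrt (t * r * (1 - r)))) (t * (1 - r))) / 2"
        using AE_beta_distribution by eventually_elim simp
    qed (use \<open>\<And>s. (\<lambda>r. quadratic_transform 1 (s * sqrt (t * r * (1 - r))) (t * (1 - r))) \<in> borel_measurable borel\<close>[of 2]
        \<open>\<And>s. (\<lambda>r. quadratic_transform 1 (s * sqrt (t * r * (1 - r))) (t * (1 - r))) \<in> borel_measurable borel\<close>[of "- 2"] in simp_all)
    then show ?thesis
      unfolding \<VV> by (simp only: expectation_variance_powr[OF \<open>\<theta> > 1 / 2\<close> that])
  qed
  have density: "\<exists>f. (\<forall>x. 0 \<le> f x) \<and> distributed M lborel \<VV> (\<lambda>x. ennreal (f x))"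
  proof -
    have distr: "distr M lborel \<VV> = distr M borel \<VV>" by (rule distr_cong) simp_all
    have ac: "absolutely_continuous lborel (distr M borel \<VV>)"
      unfolding \<VV> by (rule absolutely_continuous_variance[OF atomless])
    interpret L: prob_space "distr M borel \<VV>" by (rule PY.prob_space_distr) simp
    obtain D where D: "D \<in> borel_measurable lborel" "AE x in lborel. RN_deriv lborel (distr M borel \<VV>) x = ennreal (D x)"
        "\<And>x. 0 \<le> D x"
      using sigma_finite_measure.real_RN_deriv[OF sigma_finite_lborel L.finite_measure_axioms ac] by auto
    have "distr M borel \<VV> = density lborel (RN_deriv lborel (distr M borel \<VV>))"
      by (rule sigma_finite_measure.density_RN_deriv[OF sigma_finite_lborel ac, symmetric]) simp
    also have "\<dots> = density lborel (\<lambda>x. ennreal (D x))"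
      using D by (intro density_cong) auto
    finally show ?thesis
      using D distr by (intro exI[of _ D]) (auto simp: distributed_def)
  qed
  have second: "PY.expectation (\<lambda>\<omega>. 1 / (z + \<VV> \<omega>)) = (LINT x:{0..}|lborel. f x / (z + x))"
    if f: "\<And>x. 0 \<le> f x" "distributed M lborel \<VV> (\<lambda>x. ennreal (f x))" and z: "0 < z" for f z
  proof -
    \<comment> \<open>The test function is cut off to the half-line; the variance lies there almost
      surely, so the expectation is unaffected for any version of the density.\<close>
    have "(\<integral>x. f x * (indicator {0..} x / (z + x)) \<partial>lborel) = PY.expectation (\<lambda>\<omega>. indicator {0..} (\<VV> \<omega>) / (z + \<VV> \<omega>))"
      using f by (intro distributed_integral) auto
    also have "\<dots> = PY.expectation (\<lambda>\<omega>. 1 / (z + \<VV> \<omega>))"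
    proof (rule integral_cong_AE)
      show "AE \<omega> in M. indicator {0..} (\<VV> \<omega>) / (z + \<VV> \<omega>) = 1 / (z + \<VV> \<omega>)"
        using AE_moment1_le_moment2 by eventually_elim (simp add: \<VV>)
    qed measurable
    finally show ?thesis
      by (simp add: set_lebesgue_integral_def mult.commute)
  qed
  have third: "PY.expectation (\<lambda>\<omega>. 1 / (z + \<VV> \<omega>)) = z powr (\<theta> - 1) *
      (LINT p:Delta2|dirichlet_distribution (1 / 2) 1 (\<theta> - 3 / 2).
        (Phi 1 \<alpha> \<theta> G z (fst p) (snd p) + Phi (- 1) \<alpha> \<theta> G z (fst p) (snd p)) / 2)"
    if \<theta>: "3 / 2 < \<theta>" and z: "0 < z" for z
  proof -
    let ?D = "dirichlet_distribution (1 / 2) 1 (\<theta> - 3 / 2)"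
    have [measurable]: "fst \<in> borel_measurable ?D" "snd \<in> borel_measurable ?D"
      unfolding measurable_cong_sets[OF sets_dirichlet_distribution refl] borel_prod[symmetric] by measurable
    have q: "(\<lambda>p. quadratic_transform z (s * sqrt (z * fst p * snd p)) (snd p)) \<in> borel_measurable ?D" for s
      unfolding quadratic_transform_def by measurable
    note [measurable] = q[of 2] q[of "- 2", simplified]
    have [measurable]: "Delta2 \<in> sets ?D" by simp
    have "(LINT p:Delta2|?D. (Phi 1 \<alpha> \<theta> G z (fst p) (snd p) + Phi (- 1) \<alpha> \<theta> G z (fst p) (snd p)) / 2)
        = (\<integral>p. (quadratic_transform z (2 * sqrt (z * fst p * snd p)) (snd p)
          + quadratic_transform z (- (2 * sqrt (z * fst p * snd p))) (snd p)) / 2 \<partial>?D)"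
      unfolding set_lebesgue_integral_def Phi_eq
    proof (rule integral_cong_AE)
      show "AE p in ?D. indicator Delta2 p *\<^sub>R ((quadratic_transform z (2 * sqrt (z * fst p * snd p)) (snd p)
            + quadratic_transform z (- (2 * sqrt (z * fst p * snd p))) (snd p)) / 2)
          = (quadratic_transform z (2 * sqrt (z * fst p * snd p)) (snd p)
            + quadratic_transform z (- (2 * sqrt (z * fst p * snd p))) (snd p)) / 2"
        using AE_dirichlet_distribution
      proof eventually_elim
        case (elim p)
        then have "p \<in> Delta2" by (cases p) (simp add: Delta2_def)
        then show ?case by simp
      qed
    qed measurable
    then show ?thesis
      unfolding \<VV> by (simp only: expectation_inverse_variance[OF \<theta> z])
  qed
  show ?thesis
  proof (intro conjI allI impI)
    fix t :: real assume "0 \<le> t"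
    then show "PY.expectation (\<lambda>\<omega>. (1 / (1 + t * \<VV> \<omega>)) powr (\<theta> - 1 / 2))
      = (LINT r:{0<..<1}|beta_distribution (1 / 2) (\<theta> - 1 / 2).
           1 / 2 * (Psi 1 \<alpha> \<theta> G (sqrt (t * r * (1 - r))) (t * (1 - r))
                  + Psi (- 1) \<alpha> \<theta> G (sqrt (t * r * (1 - r))) (t * (1 - r))))"
      by (rule first)
  next
    show "\<exists>f. (\<forall>x. 0 \<le> f x) \<and> distributed M lborel \<VV> (\<lambda>x. ennreal (f x))" by (rule density)
  next
    fix f z assume f: "(\<forall>x. 0 \<le> f x) \<and> distributed M lborel \<VV> (\<lambda>x. ennreal (f x))" and z: "0 < (z :: real)"
    show "PY.expectation (\<lambda>\<omega>. 1 / (z + \<VV> \<omega>)) = (LINT x:{0..}|lborel. f x / (z + x))"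
      using f z by (intro second) auto
    then show "(LINT x:{0..}|lborel. f x / (z + x)) = z powr (\<theta> - 1) *
        (LINT p:Delta2|dirichlet_distribution (1 / 2) 1 (\<theta> - 3 / 2).
          (Phi 1 \<alpha> \<theta> G z (fst p) (snd p) + Phi (- 1) \<alpha> \<theta> G z (fst p) (snd p)) / 2)"
      if "3 / 2 < \<theta>" using third[OF that z] by simp
  qed
qed

end
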